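(* Fix $0<\gamma<1$ and let $\mathcal T_n^\theta$ be the random tree on $n$ vertices with change point at $\tau_1=\lfloor n^\gamma\rfloor$, initializer $f_0$ and second attachment function $f_1$. Suppose $f_0$ is an admissible attachment function, and $f_1$ is an admissible attachment function such that $\lim_{k\to\infty}f_1(k)/k$ exists in $[0,\infty)$ and, with $\lambda_1^*=\lambda^*(f_1)$ and $\hat\xi_{f_1}(\lambda_1^* )=\int_0^\infty\lambda_1^*e^{-\lambda_1^*t}\xi_{f_1}(t)\,dt$, $$\mathbb E\left(\hat\xi_{f_1}(\lambda_1^* )\left|\log\hat\xi_{f_1}(\lambda_1^* )\right|\right)<\infty.$$ Let $D_n(k)$ be the number of vertices of degree $k$ in $\mathcal T_n^\theta$. Then the limiting degree distribution does not feel the effect of the change point or of $f_0$: for any fixed $k\ge0$, as $n\to\infty$, $$\frac{D_n(k)}{n}\longrightarrow p_k(f_1)\quad\text{in probability}.$$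
   Context: An attachment function is a function $f:\{0,1,2,\dots\}\to(0,\infty)$. Let $E_0,E_1,\dots$ be independent, $E_i$ exponential with rate $f(i)$; $\xi_f$ is the point process with points $E_0+\dots+E_{i-1}$, $i\ge1$, and $\xi_f(t)$ is its number of points in $[0,t]$. For $\lambda>0$ put $\hat\rho_f(\lambda)=\sum_{k=1}^\infty\prod_{i=0}^{k-1}\frac{f(i)}{\lambda+f(i)}$ and $\underline\lambda=\inf\{\lambda>0:\hat\rho_f(\lambda)<\infty\}$. $f$ is admissible if $\sup_{k\ge0}f(k)/(k+1)<\infty$ and $\lim_{\lambda\downarrow\underline\lambda}\hat\rho_f(\lambda)>1$. Then $\lambda^*(f)$ is the unique $\lambda$ with $\hat\rho_f(\lambda)=1$, and $p_k(f)=\frac{\lambda^*}{\lambda^*+f(k)}\prod_{j=0}^{k-1}\frac{f(j)}{\lambda^*+f(j)}$, $k\ge0$. Tree with change point $\tau$: $\mathcal T_1^\theta$ is a single vertex; given $\mathcal T_{m-1}^\theta$ on $\{1,\dots,m-1\}$, the new vertex $m$ attaches as a child to $v$ with probability proportional to $f_0(\deg(v))$ if $m\le\tau$ and to $f_1(\deg(v))$ if $\tau<m\le n$, where $\deg(v)$ is the number of children of $v$ in $\mathcal T^\theta_{m-1}$. Degree always means number of children. *)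

theory Defs
  imports "HOL-Probability.Probability"
begin

definition attachment_function :: "(nat \<Rightarrow> real) \<Rightarrow> bool" where
  "attachment_function f \<longleftrightarrow> (\<forall>k. 0 < f k)"


(* The k-th summand below is the (k+1)-st summand of the usual series, which starts at 1.
   Only arguments lam > 0 are meaningful; the value may be infinite. *)
definition rho_hat :: "(nat \<Rightarrow> real) \<Rightarrow> real \<Rightarrow> ennreal" where
  "rho_hat f lam = (\<Sum>k. ennreal (\<Prod>i\<le>k. f i / (lam + f i)))"

definition lambda_low :: "(nat \<Rightarrow> real) \<Rightarrow> real" where
  "lambda_low f = Inf {lam. 0 < lam \<and> rho_hat f lam < \<infinity>}"

(* The first two conjuncts make the set in lambda_low nonempty. The limit, which exists by
   monotonicity, is taken in the extended reals and may be infinite. *)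
definition admissible :: "(nat \<Rightarrow> real) \<Rightarrow> bool" where
  "admissible f \<longleftrightarrow>
     attachment_function f \<and>
     bdd_above (range (\<lambda>k. f k / (real k + 1))) \<and>
     (\<exists>L. (rho_hat f \<longlongrightarrow> L) (at_right (lambda_low f)) \<and> 1 < L)"

definition lambda_star :: "(nat \<Rightarrow> real) \<Rightarrow> real" where
  "lambda_star f = (THE lam. 0 < lam \<and> rho_hat f lam = 1)"

definition limit_degree_prob :: "(nat \<Rightarrow> real) \<Rightarrow> nat \<Rightarrow> real" where
  "limit_degree_prob f k =
     lambda_star f / (lambda_star f + f k) * (\<Prod>j<k. f j / (lambda_star f + f j))"


(* The canonical space carrying independent exponential clocks E_i with rates f i:
   an outcome is the sequence of the values of the E_i. *)
definition clocks :: "(nat \<Rightarrow> real) \<Rightarrow> (nat \<Rightarrow> real) measure" where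
  "clocks f = PiM UNIV (\<lambda>i. density lborel (\<lambda>x. ennreal (exponential_density (f i) x)))"

(* The number of points E_0 + ... + E_i, i >= 0, in [0,t]; it is infinite if the process
   has exploded by time t. *)
definition xi :: "(nat \<Rightarrow> real) \<Rightarrow> real \<Rightarrow> ennreal" where
  "xi E t = (\<Sum>i. indicator {0..t} (\<Sum>j\<le>i. E j))"

definition xi_hat :: "real \<Rightarrow> (nat \<Rightarrow> real) \<Rightarrow> ennreal" where
  "xi_hat lam E = (\<integral>\<^sup>+ t. ennreal (lam * exp (- lam * t)) * xi E t * indicator {0..} t \<partial>lborel)"

(* x |log x| on the extended nonnegative reals, with value 0 at 0 and infinity at infinity *)
definition x_abs_log :: "ennreal \<Rightarrow> ennreal" where
  "x_abs_log x = (if x = \<infinity> then \<infinity> else x * ennreal \<bar>ln (enn2real x)\<bar>)"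

definition x_log_x_condition :: "(nat \<Rightarrow> real) \<Rightarrow> bool" where
  "x_log_x_condition f \<longleftrightarrow>
     (\<integral>\<^sup>+ E. x_abs_log (xi_hat (lambda_star f) E) \<partial>clocks f) < \<infinity>"


(* A recursive tree on the vertices 1,...,m is given by its parent map:
   t w = Some v means that w is a child of v, and t 1 = None for the root 1. *)
type_synonym rtree = "nat \<Rightarrow> nat option"

definition deg :: "rtree \<Rightarrow> nat \<Rightarrow> nat" where
  "deg t v = card {w. t w = Some v}"

definition degree_count :: "nat \<Rightarrow> rtree \<Rightarrow> nat \<Rightarrow> nat" where
  "degree_count n t k = card {v \<in> {1..n}. deg t v = k}"

(* The vertex v of 1,...,m is chosen with probability proportional to f (deg t v). *)
definition choose_parent :: "(nat \<Rightarrow> real) \<Rightarrow> nat \<Rightarrow> rtree \<Rightarrow> nat pmf" where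
  "choose_parent f m t =
     embed_pmf (\<lambda>v. if v \<in> {1..m} then f (deg t v) / (\<Sum>u\<in>{1..m}. f (deg t u)) else 0)"

lemma pmf_choose_parent:
  assumes "attachment_function f" and "1 \<le> m"
  shows "pmf (choose_parent f m t) v =
           (if v \<in> {1..m} then f (deg t v) / (\<Sum>u\<in>{1..m}. f (deg t u)) else 0)"
proof -
  define S where "S = (\<Sum>u\<in>{1..m}. f (deg t u))"
  have pos: "0 < f k" for k
    using assms(1) by (simp add: attachment_function_def)
  have S: "0 < S"
    unfolding S_def using assms(2) pos by (intro sum_pos) auto
  have "(\<integral>\<^sup>+ v. ennreal (if v \<in> {1..m} then f (deg t v) / S else 0) \<partial>count_space UNIV)
        = (\<Sum>v\<in>{1..m}. ennreal (f (deg t v) / S))"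
    by (subst nn_integral_count_space'[where A = "{1..m}"]) (auto intro!: sum.cong)
  also have "\<dots> = ennreal (\<Sum>v\<in>{1..m}. f (deg t v) / S)"
    using S pos by (intro sum_ennreal) (simp add: less_imp_le)
  also have "(\<Sum>v\<in>{1..m}. f (deg t v) / S) = 1"
    using S by (simp add: S_def sum_divide_distrib[symmetric])
  finally have "(\<integral>\<^sup>+ v. ennreal (if v \<in> {1..m} then f (deg t v) / S else 0) \<partial>count_space UNIV) = 1"
    by simp
  then show ?thesis
    unfolding choose_parent_def S_def[symmetric]
    using S pos by (subst pmf_embed_pmf) (auto simp: less_imp_le)
qed

(* The law of the tree on m vertices (for m = 0 a dummy value). The step from m to m+1
   vertices inserts the vertex m+1. *)
fun change_point_tree :: "(nat \<Rightarrow> real) \<Rightarrow> (nat \<Rightarrow> real) \<Rightarrow> nat \<Rightarrow> nat \<Rightarrow> rtree pmf" where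
  "change_point_tree f0 f1 \<tau> 0 = return_pmf Map.empty"
| "change_point_tree f0 f1 \<tau> (Suc 0) = return_pmf Map.empty"
| "change_point_tree f0 f1 \<tau> (Suc (Suc m)) =
     bind_pmf (change_point_tree f0 f1 \<tau> (Suc m)) (\<lambda>t.
       map_pmf (\<lambda>v. t(Suc (Suc m) \<mapsto> v))
         (choose_parent (if Suc (Suc m) \<le> \<tau> then f0 else f1) (Suc m) t))"


(* Convergence in probability to a constant, where the n-th variable may live on its own
   probability space. *)
definition tendsto_in_prob ::
  "(nat \<Rightarrow> 'a measure) \<Rightarrow> (nat \<Rightarrow> 'a \<Rightarrow> real) \<Rightarrow> real \<Rightarrow> bool" where
  "tendsto_in_prob M X c \<longleftrightarrow>
     (\<forall>\<epsilon>>0. (\<lambda>n. measure (M n) {\<omega> \<in> space (M n). \<epsilon> < \<bar>X n \<omega> - c\<bar>}) \<longlonglongrightarrow> 0)"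

end

theory Submission
  imports Defs "HOL-Real_Asymp.Real_Asymp"
begin

text \<open>
  Let \<open>T\<^sub>k(m)\<close> be the number of vertices that have at least \<open>k\<close> children when the tree has \<open>m\<close>
  vertices, and let \<open>N\<^sub>k = T\<^sub>k - T\<^bsub>k+1\<^esub>\<close>. After the change point the next step raises
  \<open>T\<^bsub>k+1\<^esub>\<close> by one with conditional probability \<open>f(k) N\<^sub>k / S\<close>, where \<open>f = f\<^sub>1\<close> and
  \<open>S = (\<Sum>k. f(k) N\<^sub>k)\<close> is the total weight. The accumulated difference between the increments and these
  probabilities is a martingale with bounded steps, hence smaller than any fixed multiple of \<open>n\<close> up
  to an exponentially small probability (\<open>noise_uniform_tail\<close>). After rescaling time and
  counts by \<open>n\<close>, every limit of the tails is therefore a flow on \<open>0 < r < 1\<close>,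
  \<open>T\<^bsub>k+1\<^esub>' = f(k) (T\<^sub>k - T\<^bsub>k+1\<^esub>) / \<sigma>\<close> with \<open>T\<^sub>0(r) = r\<close>, where \<open>\<sigma>\<close> is the limit of
  \<open>S / n\<close>. The total number of children is always \<open>m - 1\<close>, so if \<open>f(k) = c k + g(k)\<close> with
  \<open>g(k) = o(k)\<close>, then \<open>S = c (m - 1) + (\<Sum>k. g(k) N\<^sub>k)\<close>, and up to a small error the last sum only
  sees boundedly many degrees. This makes \<open>\<sigma>\<close> a continuous functional of the tails although a positive
  proportion of the edges could sit at vertices of unbounded degree.

  The change point occurs after \<open>o(n)\<close> steps, so the flow is defined on the whole of \<open>(0,1)\<close> and
  starts from nothing. The heart of the matter is that such a flow is unique (\<open>flow_unique\<close>):
  \<open>T\<^sub>k(r) = \<pi>\<^sub>k r\<close> with \<open>\<pi>\<^sub>k = (\<Prod>i<k. f(i) / (\<lambda> + f(i)))\<close> and \<open>\<lambda> = \<lambda>\<^sup>*(f)\<close>; the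
  differences \<open>\<pi>\<^sub>k - \<pi>\<^bsub>k+1\<^esub>\<close> are the \<open>p\<^sub>k(f)\<close>. In the clock \<open>s\<close> with \<open>ds = dr / \<sigma>\<close> the flow is
  linear: it is the mean evolution of the branching process with reproduction \<open>\<xi>\<^sub>f\<close>, whose growth rate is
  \<open>\<lambda>\<close>, observed since time \<open>-\<infinity>\<close>. Three facts give uniqueness.

  \<^item> No edges are lost at infinite degree (\<open>escaping_zero\<close>). In the past their number would have been at
    least a multiple of \<open>exp (c s)\<close>. Being a source for all smaller degrees, it would by iteration bound the size
    below by every multiple of \<open>exp (c s)\<close>, because a source growing at rate \<open>c \<le> \<lambda>\<close> is reproduced
    by at least itself in every generation.

  \<^item> The total reproductive value \<open>(\<Sum>k. h(k) N\<^sub>k)\<close> is proportional to \<open>exp (\<lambda> s)\<close>, and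
    \<open>h(k) = O(k + 1)\<close> because \<open>c < \<lambda>\<close>; hence the scaled size \<open>r exp (-\<lambda> s)\<close> is bounded
    (\<open>scaled_size_bounded\<close>).

  \<^item> Let \<open>M\<close> and \<open>m\<close> be the supremum and the infimum of the scaled size, which is the average of
    the ratios \<open>T\<^sub>k exp (-\<lambda> s) / \<pi>\<^sub>k\<close> with weights \<open>\<pi>\<^sub>k\<close>, \<open>k \<ge> 1\<close>. All ratios lie between \<open>m\<close> and
    \<open>M\<close>, so where the average is close to \<open>M\<close> they are all close to \<open>M\<close>, and similarly for
    \<open>m\<close>. Comparing the conserved reproductive value at two such moments yields \<open>M = m\<close>
    (\<open>scaled_constant\<close>).

  If the degree proportions did not converge, there would be arbitrarily large trees with small martingale
  parts and a proportion bounded away from its limit. By compactness all rescaled quantities of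
  these trees converge along a common filter, their limit is the unique flow, and this is a contradiction
  (\<open>degree_fraction_converges\<close>).
\<close>

section \<open>Survival products and truncated reproductive values\<close>

text \<open>The products in the series \<open>rho_hat\<close>; for \<open>lam = lambda_star f\<close> this is the limiting proportion of
  vertices with at least \<open>k\<close> children. In the branching process it is the Laplace transform of the time of the
  \<open>k\<close>-th birth.\<close>
definition surv :: "(nat \<Rightarrow> real) \<Rightarrow> real \<Rightarrow> nat \<Rightarrow> real" where
  "surv f lam k = (\<Prod>i<k. f i / (lam + f i))"

text \<open>Fisher's reproductive value of an individual with \<open>k\<close> children: the expected number of its further
  children, each discounted at rate \<open>lam\<close> for the time until its birth. Only children up to the \<open>K\<close>-th are
  counted, so that all sums over degrees stay finite.\<close>
definition repro :: "(nat \<Rightarrow> real) \<Rightarrow> real \<Rightarrow> nat \<Rightarrow> nat \<Rightarrow> real" where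
  "repro f lam K k = (\<Sum>j\<in>{k<..K}. surv f lam j) / surv f lam k"

lemma surv_0 [simp]: "surv f lam 0 = 1"
  by (simp add: surv_def)

lemma surv_Suc: "surv f lam (Suc k) = surv f lam k * (f k / (lam + f k))"
  by (simp add: surv_def)

lemma surv_pos: "(\<And>k. 0 < f k) \<Longrightarrow> 0 \<le> lam \<Longrightarrow> 0 < surv f lam k"
  unfolding surv_def by (intro prod_pos) (auto intro!: divide_pos_pos add_nonneg_pos)

lemma surv_decseq:
  assumes "\<And>k. 0 < f k" and "0 \<le> lam"
  shows "decseq (surv f lam)"
proof (rule decseq_SucI)
  fix k
  have "f k / (lam + f k) \<le> 1"
    using assms(1)[of k] assms(2) by (simp add: divide_le_eq)
  then show "surv f lam (Suc k) \<le> surv f lam k"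
    using surv_pos[of f lam k] assms by (simp only: surv_Suc mult_left_le less_imp_le)
qed

lemma surv_antimono:
  assumes "\<And>k. 0 < f k" and "0 \<le> lam" and "lam \<le> mu"
  shows "surv f mu k \<le> surv f lam k"
  unfolding surv_def
proof (rule prod_mono)
  fix i
  show "0 \<le> f i / (mu + f i) \<and> f i / (mu + f i) \<le> f i / (lam + f i)"
    using assms(1)[of i] assms(2,3) by (auto intro!: divide_left_mono divide_nonneg_nonneg mult_pos_pos)
qed

text \<open>The eigenvalue equation for the growth rate \<open>lam\<close> of the flow of tails.\<close>
lemma surv_balance:
  assumes "\<And>k. 0 < f k" and "0 \<le> lam"
  shows "(lam + f k) * surv f lam (Suc k) = f k * surv f lam k"
  using assms(1)[of k] assms(2) by (simp add: surv_Suc)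

lemma repro_top: "repro f lam K K = 0"
  by (simp add: repro_def)

lemma repro_0: "repro f lam K 0 = (\<Sum>j\<in>{1..K}. surv f lam j)"
proof -
  have "{0<..K} = {1..K}" by auto
  then show ?thesis by (simp add: repro_def)
qed

lemma repro_nonneg: "(\<And>k. 0 < f k) \<Longrightarrow> 0 \<le> lam \<Longrightarrow> 0 \<le> repro f lam K k"
  unfolding repro_def by (intro divide_nonneg_nonneg sum_nonneg less_imp_le[OF surv_pos])

text \<open>First-step analysis: at rate \<open>f k\<close> the next child is born, worth \<open>1\<close>, and the parent moves to state
  \<open>Suc k\<close>, while value is discounted at rate \<open>lam\<close>.\<close>
lemma repro_rec:
  assumes pos: "\<And>k. 0 < f k" and lam: "0 \<le> lam" and k: "k < K"
  shows "f k * (1 + repro f lam K (Suc k)) = (lam + f k) * repro f lam K k"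
proof -
  have "{k<..K} = insert (Suc k) {Suc k<..K}"
    using k by auto
  then have "(\<Sum>j\<in>{k<..K}. surv f lam j) = surv f lam (Suc k) + (\<Sum>j\<in>{Suc k<..K}. surv f lam j)"
    by simp
  also have "\<dots> = surv f lam (Suc k) * (1 + repro f lam K (Suc k))"
    using surv_pos[of f lam "Suc k", OF pos lam] by (simp add: repro_def algebra_simps)
  finally have "repro f lam K k = surv f lam (Suc k) * (1 + repro f lam K (Suc k)) / surv f lam k"
    by (simp add: repro_def)
  moreover have "surv f lam (Suc k) / surv f lam k = f k / (lam + f k)"
    using surv_pos[of f lam k, OF pos lam] by (simp add: surv_Suc)
  ultimately have "repro f lam K k = f k / (lam + f k) * (1 + repro f lam K (Suc k))"
    by (metis times_divide_eq_left)
  then show ?thesis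
    using pos[of k] lam by simp
qed

text \<open>For \<open>f k = c * (k + 1)\<close> the linear function \<open>c / (lam - c) * (k + 1)\<close> solves the recursion \<open>repro_rec\<close>;
  in general it is a supersolution as soon as \<open>f k \<le> c * (k + 1)\<close>. Below the threshold \<open>i0\<close> each step down costs at
  most \<open>1\<close>, which the second summand pays for.\<close>
lemma repro_le:
  assumes pos: "\<And>k. 0 < f k" and c: "0 \<le> c" "c < lam"
    and f: "\<And>k. i0 \<le> k \<Longrightarrow> f k \<le> c * (real k + 1)" and kK: "k \<le> K"
  shows "repro f lam K k \<le> c / (lam - c) * (real k + 1) + (c / (lam - c) + 1) * real (i0 - k)"
  using kK
proof (induction k rule: inc_induct)
  case base
  show ?case
    unfolding repro_top using c by (intro add_nonneg_nonneg mult_nonneg_nonneg) auto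
next
  case (step k)
  define A where "A = c / (lam - c)"
  have A: "0 \<le> A" and Ac: "c * (1 + A) = lam * A"
    using c by (auto simp: A_def field_simps)
  have fk: "0 < f k" by (rule pos)
  have lam: "0 < lam" using c by simp
  define y where "y = A * (real k + 1) + (A + 1) * real (i0 - k)"
  have "f k * (1 + repro f lam K (Suc k)) \<le> f k * (1 + (A * (real k + 2) + (A + 1) * real (i0 - Suc k)))"
    using step.IH fk by (intro mult_left_mono) (auto simp: A_def add_ac)
  also have "\<dots> \<le> (lam + f k) * y"
  proof (cases "i0 \<le> k")
    case True
    have "f k * (1 + A) \<le> (c * (real k + 1)) * (1 + A)"
      using f[OF True] A by (intro mult_right_mono) auto
    also have "\<dots> = lam * (A * (real k + 1))"
      using Ac by (metis mult.assoc mult.commute)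
    finally show ?thesis
      using True by (simp add: y_def algebra_simps)
  next
    case False
    then have "1 + (A * (real k + 2) + (A + 1) * real (i0 - Suc k)) = y"
      by (simp add: y_def of_nat_diff algebra_simps)
    moreover have "0 \<le> y"
      using A by (simp add: y_def)
    ultimately show ?thesis
      using lam by (simp add: algebra_simps)
  qed
  finally have "(lam + f k) * repro f lam K k \<le> (lam + f k) * y"
    using repro_rec[of f lam k K] pos lam step.hyps by simp
  then show ?case
    using fk lam by (simp add: y_def A_def)
qed

lemma rho_hat_surv: "rho_hat f lam = (\<Sum>k. ennreal (surv f lam (Suc k)))"
  by (simp add: rho_hat_def surv_def lessThan_Suc_atMost)

lemma rho_hat_finite_iff:
  assumes pos: "\<And>k. 0 < f k" and lam: "0 \<le> lam"
  shows "rho_hat f lam < \<infinity> \<longleftrightarrow> summable (\<lambda>k. surv f lam (Suc k))"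
proof
  assume "rho_hat f lam < \<infinity>"
  then show "summable (\<lambda>k. surv f lam (Suc k))"
    unfolding rho_hat_surv
    by (intro summable_suminf_not_top) (auto intro: less_imp_le surv_pos pos lam)
next
  assume "summable (\<lambda>k. surv f lam (Suc k))"
  then show "rho_hat f lam < \<infinity>"
    unfolding rho_hat_surv
    by (subst suminf_ennreal2) (auto intro: less_imp_le surv_pos pos lam)
qed

lemma rho_hat_eq:
  assumes pos: "\<And>k. 0 < f k" and lam: "0 \<le> lam" and "summable (\<lambda>k. surv f lam (Suc k))"
  shows "rho_hat f lam = ennreal (\<Sum>k. surv f lam (Suc k))"
  unfolding rho_hat_surv using assms
  by (intro suminf_ennreal2) (auto intro: less_imp_le surv_pos pos lam)

lemma rho_hat_antimono:
  assumes pos: "\<And>k. 0 < f k" and lam: "0 \<le> lam" "lam \<le> mu"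
  shows "rho_hat f mu \<le> rho_hat f lam"
  unfolding rho_hat_surv
  by (intro suminf_le) (auto intro!: ennreal_leI surv_antimono pos lam)

lemma rho_hat_eq_1D:
  assumes pos: "\<And>k. 0 < f k" and lam: "0 \<le> lam" and 1: "rho_hat f lam = 1"
  shows "(\<lambda>k. surv f lam (Suc k)) sums 1"
proof -
  have s: "summable (\<lambda>k. surv f lam (Suc k))"
    using rho_hat_finite_iff[of f lam] pos lam 1 by simp
  have nn: "0 \<le> (\<Sum>k. surv f lam (Suc k))"
    using s by (intro suminf_nonneg) (auto intro: less_imp_le surv_pos pos lam)
  have "ennreal (\<Sum>k. surv f lam (Suc k)) = ennreal 1"
    using rho_hat_eq[of f lam] pos lam s 1 by simp
  then have "(\<Sum>k. surv f lam (Suc k)) = 1"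
    using nn by (subst (asm) ennreal_inj) auto
  then show ?thesis
    using s by (metis summable_sums)
qed

lemma rho_hat_unique:
  assumes pos: "\<And>k. 0 < f k" and lam: "0 < lam" "lam < mu"
    and 1: "rho_hat f lam = 1" "rho_hat f mu = 1"
  shows False
proof -
  have s: "(\<lambda>k. surv f lam (Suc k) - surv f mu (Suc k)) sums (1 - 1)"
    using rho_hat_eq_1D[of f lam] rho_hat_eq_1D[of f mu] pos lam 1 by (intro sums_diff) auto
  have nn: "0 \<le> surv f lam (Suc k) - surv f mu (Suc k)" for k
    using surv_antimono[of f lam mu "Suc k"] pos lam by simp
  have "f 0 / (mu + f 0) < f 0 / (lam + f 0)"
    using pos[of 0] lam by (intro divide_strict_left_mono) (auto intro!: mult_pos_pos)
  then have "0 < surv f lam (Suc 0) - surv f mu (Suc 0)"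
    by (simp add: surv_Suc)
  then have "0 < (\<Sum>k. surv f lam (Suc k) - surv f mu (Suc k))"
    using s nn by (intro suminf_pos2[where i = 0]) (auto simp: sums_iff)
  then show False
    using s by (simp add: sums_iff)
qed

lemma rho_hat_le:
  assumes pos: "\<And>k. 0 < f k" and C: "0 \<le> C" "C < lam" and f: "\<And>k. f k \<le> C * (real k + 1)"
  shows "rho_hat f lam \<le> ennreal (C / (lam - C))"
  unfolding rho_hat_surv
proof (rule suminf_le_const)
  fix n
  have "(\<Sum>k<n. ennreal (surv f lam (Suc k))) = ennreal (\<Sum>k<n. surv f lam (Suc k))"
    using C by (intro sum_ennreal) (auto intro!: less_imp_le surv_pos pos)
  also have "(\<Sum>k<n. surv f lam (Suc k)) = repro f lam n 0"
    unfolding repro_0 by (simp add: sum.atLeast1_atMost_eq)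
  also have "\<dots> \<le> C / (lam - C)"
    using repro_le[of f C lam 0 0 n] pos C f by simp
  finally show "(\<Sum>k<n. ennreal (surv f lam (Suc k))) \<le> ennreal (C / (lam - C))"
    by (simp add: ennreal_leI)
qed auto

text \<open>If \<open>f\<close> eventually exceeds \<open>lam * (j + 1)\<close>, the products decay no faster than \<open>1 / k\<close>, and
  the harmonic series diverges.\<close>
lemma rho_hat_infinite:
  assumes pos: "\<And>k. 0 < f k" and lam: "0 < lam" "lam < c"
    and lim: "(\<lambda>j. f j / real j) \<longlonglongrightarrow> c"
  shows "\<not> rho_hat f lam < \<infinity>"
proof
  assume "rho_hat f lam < \<infinity>"
  then have s: "summable (\<lambda>k. surv f lam (Suc k))"
    using rho_hat_finite_iff[of f lam] pos lam by simp
  have "eventually (\<lambda>j. lam < f j / (real j + 1)) sequentially"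
  proof -
    have "(\<lambda>j. f j / real j * (real j / (real j + 1))) \<longlonglongrightarrow> c * 1"
      by (intro tendsto_mult lim) real_asymp
    then have "(\<lambda>j. f j / real j * (real j / (real j + 1))) \<longlonglongrightarrow> c"
      by (simp only: mult_1_right)
    then have "(\<lambda>j. f j / (real j + 1)) \<longlonglongrightarrow> c"
      by (rule Lim_transform_eventually, intro eventually_sequentiallyI[of 1]) simp
    then show ?thesis
      using lam by (intro order_tendstoD(1)) auto
  qed
  then obtain n where n: "\<And>j. n \<le> j \<Longrightarrow> lam * (real j + 1) \<le> f j"
    by (force simp: eventually_sequentially field_simps intro: less_imp_le)
  define a where "a = surv f lam n * (real n + 1)"
  have a: "0 < a"
    unfolding a_def using surv_pos[of f lam n] pos lam by simp
  have lower: "a / (real k + 1) \<le> surv f lam k" if "n \<le> k" for k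
    using that
  proof (induction k rule: dec_induct)
    case base
    show ?case by (simp add: a_def)
  next
    case (step k)
    have "(real k + 1) * (lam + f k) \<le> f k * (real k + 2)"
      using n[of k] step.hyps by (simp add: algebra_simps)
    then have q: "(real k + 1) / (real k + 2) \<le> f k / (lam + f k)"
      using pos[of k] lam by (simp add: field_simps)
    have "a / (real (Suc k) + 1) = a / (real k + 1) * ((real k + 1) / (real k + 2))"
      by (simp add: add_ac)
    also have "\<dots> \<le> surv f lam k * (f k / (lam + f k))"
      using q step.IH surv_pos[of f lam k] pos lam by (intro mult_mono) auto
    finally show ?case by (simp add: surv_Suc)
  qed
  have "summable (\<lambda>k. surv f lam k)"
    using s by (simp only: summable_Suc_iff)
  then have "summable (\<lambda>k. a / (real k + 1))"
    by (rule summable_comparison_test_ev[rotated])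
       (use lower a in \<open>auto intro!: eventually_sequentiallyI[of n]\<close>)
  then have "summable (\<lambda>k. inverse (real (Suc k)))"
    using a by (simp add: divide_inverse add_ac)
  then have "summable (\<lambda>k. inverse (real k))"
    by (simp only: summable_Suc_iff[where f = "\<lambda>k. inverse (real k)"])
  then show False
    using not_summable_harmonic[where 'a = real] by simp
qed

text \<open>To the right of a point where \<open>rho_hat\<close> is finite the series converges uniformly, so the intermediate
  value theorem applies; far to the right \<open>rho_hat\<close> is below \<open>1\<close>.\<close>
lemma rho_hat_attains_1:
  assumes pos: "\<And>k. 0 < f k" and l1: "0 < l1" and fin: "rho_hat f l1 < \<infinity>" and big: "1 < rho_hat f l1"
    and C: "0 \<le> C" and f: "\<And>k. f k \<le> C * (real k + 1)"
  shows "\<exists>lam\<ge>l1. rho_hat f lam = 1"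
proof -
  \<comment> \<open>large enough for the bound \<open>C / (l2 - C)\<close> of \<open>rho_hat_le\<close> to be at most \<open>1\<close>\<close>
  define l2 where "l2 = l1 + 3 * C + 1"
  define phi where "phi lam = (\<Sum>k. surv f lam (Suc k))" for lam
  have s1: "summable (\<lambda>k. surv f l1 (Suc k))"
    using rho_hat_finite_iff[of f l1] pos l1 fin by simp
  have s: "summable (\<lambda>k. surv f lam (Suc k))" if "l1 \<le> lam" for lam
    by (rule summable_comparison_test'[OF s1, of 0])
       (use that l1 surv_antimono[of f l1 lam] surv_pos[of f lam] pos in \<open>auto simp: abs_of_pos\<close>)
  have eq: "rho_hat f lam = ennreal (phi lam)" if "l1 \<le> lam" for lam
    unfolding phi_def using that l1 s by (intro rho_hat_eq pos) auto
  have "uniform_limit {l1..l2} (\<lambda>n lam. \<Sum>k<n. surv f lam (Suc k)) phi sequentially"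
    unfolding phi_def
    by (rule Weierstrass_m_test[OF _ s1])
       (use l1 surv_antimono[of f l1] surv_pos[of f] pos in \<open>auto simp: abs_of_pos\<close>)
  moreover have "continuous_on {l1..l2} (\<lambda>lam. surv f lam k)" for k
    unfolding surv_def using l1 pos
    by (intro continuous_intros) (auto simp: add_nonneg_pos less_imp_neq[symmetric])
  ultimately have "continuous_on {l1..l2} phi"
    by (intro uniform_limit_theorem) (auto intro!: always_eventually continuous_on_sum)
  moreover have "1 \<le> phi l1"
    using big eq[of l1] by (simp add: ennreal_less_iff less_imp_le flip: ennreal_1)
  moreover have "phi l2 \<le> 1"
  proof -
    have "ennreal (phi l2) \<le> ennreal (C / (l2 - C))"
      using eq[of l2] rho_hat_le[of f C l2] pos l1 C f by (simp add: l2_def)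
    then have "phi l2 \<le> C / (l2 - C)"
      using C l1 by (subst (asm) ennreal_le_iff) (auto simp: l2_def)
    also have "\<dots> \<le> 1"
      using C l1 by (simp add: l2_def divide_le_eq)
    finally show ?thesis .
  qed
  ultimately obtain lam where "l1 \<le> lam" "phi lam = 1"
    using IVT2'[of phi l2 1 l1] l1 C by (auto simp: l2_def)
  then show ?thesis
    using eq by auto
qed

lemma admissible_pos: "admissible f \<Longrightarrow> 0 < f k"
  by (simp add: admissible_def attachment_function_def)

lemma admissible_linear_bound:
  assumes "admissible f"
  obtains C where "0 < C" "\<And>k. f k \<le> C * (real k + 1)"
proof -
  obtain C where C: "\<And>k. f k / (real k + 1) \<le> C"
    using assms by (auto simp: admissible_def bdd_above_def)
  have "0 < f 0 / (real 0 + 1)"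
    using admissible_pos[OF assms, of 0] by simp
  also have "\<dots> \<le> C" by (rule C)
  finally have "0 < C" .
  moreover have "f k \<le> C * (real k + 1)" for k
    using C[of k] by (simp add: divide_le_eq)
  ultimately show ?thesis by (rule that)
qed

text \<open>Admissibility makes \<open>rho_hat\<close> exceed \<open>1\<close> just to the right of \<open>lambda_low f\<close>, so that the root lies
  strictly beyond \<open>lambda_low f\<close>, and the latter is at least the slope \<open>c\<close>. The strict inequality is what makes
  the reproductive value grow at most linearly.\<close>
lemma lambda_star_properties:
  assumes adm: "admissible f" and c: "0 \<le> c" and lim: "(\<lambda>j. f j / real j) \<longlonglongrightarrow> c"
  shows "c < lambda_star f" and "(\<lambda>k. surv f (lambda_star f) (Suc k)) sums 1"
proof -
  have pos: "0 < f k" for k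
    using adm by (rule admissible_pos)
  obtain C where C: "0 < C" "\<And>k. f k \<le> C * (real k + 1)"
    using admissible_linear_bound[OF adm] by blast
  define L where "L = {lam. 0 < lam \<and> rho_hat f lam < \<infinity>}"
  have low: "lambda_low f = Inf L"
    by (simp add: lambda_low_def L_def)
  have "rho_hat f (2 * C) \<le> ennreal (C / (2 * C - C))"
    by (rule rho_hat_le) (use C pos in auto)
  then have ne: "L \<noteq> {}"
    using C(1) by (auto simp: L_def intro!: exI[of _ "2 * C"] intro: le_less_trans)
  have cL: "c \<le> lam" if "lam \<in> L" for lam
    using rho_hat_infinite[of f lam c] pos lim that by (force simp: L_def)
  have clow: "c \<le> lambda_low f"
    unfolding low by (rule cInf_greatest[OF ne cL])
  obtain l where l: "(rho_hat f \<longlongrightarrow> l) (at_right (lambda_low f))" "1 < l"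
    using adm by (auto simp: admissible_def)
  then have "eventually (\<lambda>x. 1 < rho_hat f x) (at_right (lambda_low f))"
    by (rule order_tendstoD(1))
  then obtain b where b: "lambda_low f < b" "\<And>x. lambda_low f < x \<Longrightarrow> x < b \<Longrightarrow> 1 < rho_hat f x"
    by (auto simp: eventually_at_right_field)
  define l1 where "l1 = (lambda_low f + b) / 2"
  have l1: "lambda_low f < l1" "l1 < b" "0 < l1"
    using b(1) clow c by (auto simp: l1_def)
  obtain l0 where l0: "l0 \<in> L" "l0 < l1"
    using l1(1) ne unfolding low by (meson cInf_lessD)
  have "rho_hat f l1 \<le> rho_hat f l0"
    using l0 by (intro rho_hat_antimono pos) (auto simp: L_def)
  then have "rho_hat f l1 < \<infinity>"
    using l0 by (auto simp: L_def)
  then obtain lam where lam: "l1 \<le> lam" "rho_hat f lam = 1"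
    using rho_hat_attains_1[of f l1 C] pos l1 b(2) C by (auto simp: less_imp_le)
  have star: "lambda_star f = lam"
    unfolding lambda_star_def
  proof (rule the_equality)
    show "0 < lam \<and> rho_hat f lam = 1"
      using lam l1 by simp
  next
    fix mu
    assume "0 < mu \<and> rho_hat f mu = 1"
    then show "mu = lam"
      using rho_hat_unique[of f mu lam] rho_hat_unique[of f lam mu] pos lam l1
      by (metis linorder_neqE_linordered_idom order_less_le_trans)
  qed
  show "c < lambda_star f"
    using star lam l1 clow by simp
  show "(\<lambda>k. surv f (lambda_star f) (Suc k)) sums 1"
    unfolding star by (rule rho_hat_eq_1D) (use pos lam l1 in auto)
qed

text \<open>The limit law is the difference sequence of the survival products, so tails can be studied instead of
  degree classes.\<close>
lemma limit_degree_prob_surv: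
  assumes "\<And>k. 0 < f k" and "0 < lambda_star f"
  shows "limit_degree_prob f k = surv f (lambda_star f) k - surv f (lambda_star f) (Suc k)"
  unfolding limit_degree_prob_def surv_Suc
  using assms(1)[of k] assms(2) by (simp add: surv_def field_simps)

section \<open>The limiting flow and its escaping mass\<close>

text \<open>At least half of the first \<open>k\<close> terms lie beyond \<open>k div 2\<close>, are at least \<open>a k\<close>, and have a small sum.\<close>
lemma decseq_summable_times_index:
  fixes a :: "nat \<Rightarrow> real"
  assumes dec: "decseq a" and nn: "\<And>k. 0 \<le> a k" and sum: "summable a"
  shows "(\<lambda>k. real k * a k) \<longlonglongrightarrow> 0"
proof (rule LIMSEQ_I)
  fix e :: real
  assume e: "0 < e"
  obtain N where N: "\<And>m n. N \<le> m \<Longrightarrow> norm (sum a {m..<n}) < e / 2"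
    using sum e by (metis half_gt_zero summable_Cauchy)
  have "norm (real k * a k - 0) < e" if "2 * N \<le> k" for k
  proof -
    have "real k \<le> 2 * real (k - k div 2)"
      by linarith
    then have "real k * a k \<le> 2 * real (k - k div 2) * a k"
      using nn[of k] by (rule mult_right_mono)
    also have "\<dots> = 2 * (\<Sum>j\<in>{k div 2..<k}. a k)"
      by simp
    finally have "real k * a k \<le> 2 * (\<Sum>j\<in>{k div 2..<k}. a k)" .
    also have "(\<Sum>j\<in>{k div 2..<k}. a k) \<le> (\<Sum>j\<in>{k div 2..<k}. a j)"
      using dec by (intro sum_mono) (auto simp: decseq_def)
    also have "2 * (\<Sum>j\<in>{k div 2..<k}. a j) < e"
      using less_eq_div_iff_mult_less_eq[of 2 N k] N[of "k div 2" k] that by (auto simp: abs_less_iff)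
    finally show ?thesis
      using nn[of k] by simp
  qed
  then show "\<exists>no. \<forall>n\<ge>no. norm (real n * a n - 0) < e" by blast
qed

lemma diff_le_of_deriv_le:
  fixes F :: "real \<Rightarrow> real"
  assumes xy: "x \<le> y"
    and d: "\<And>t. x \<le> t \<Longrightarrow> t \<le> y \<Longrightarrow> (F has_real_derivative F' t) (at t)"
    and le: "\<And>t. x \<le> t \<Longrightarrow> t \<le> y \<Longrightarrow> F' t \<le> B"
  shows "F y - F x \<le> B * (y - x)"
proof (cases "x = y")
  case False
  then obtain t where "x < t" "t < y" "F y - F x = (y - x) * F' t"
    using MVT2[of x y F F'] xy d by auto
  then show ?thesis
    using le[of t] xy by (simp add: mult.commute mult_left_mono)
qed simp

text \<open>\<open>T k r\<close> is the rescaled number of vertices with at least \<open>k\<close> children when the tree has relative size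
  \<open>r\<close>, and \<open>sigma r\<close> is the rescaled total weight. The bound \<open>T_sum_le\<close> allows some edges to be attached to
  vertices of infinite degree; according to \<open>sigma_approx\<close> those edges still contribute \<open>c\<close> each to the
  weight. The flow is considered on \<open>(0,1)\<close> and has no initial condition besides \<open>T_0\<close>.\<close>
locale degree_flow =
  fixes f :: "nat \<Rightarrow> real" and lam c a b A :: real
    and T :: "nat \<Rightarrow> real \<Rightarrow> real" and sigma :: "real \<Rightarrow> real" and err :: "nat \<Rightarrow> real"
  assumes pos: "0 < f k"
    and c_nonneg: "0 \<le> c" and c_less: "c < lam"
    and surv_sums: "(\<lambda>k. surv f lam (Suc k)) sums 1"
    and repro_bound: "k \<le> K \<Longrightarrow> repro f lam K k \<le> A * (real k + 1)"
    and T_0: "0 < r \<Longrightarrow> r < 1 \<Longrightarrow> T 0 r = r"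
    and T_nonneg: "0 < r \<Longrightarrow> r < 1 \<Longrightarrow> 0 \<le> T k r"
    and T_Suc_le: "0 < r \<Longrightarrow> r < 1 \<Longrightarrow> T (Suc k) r \<le> T k r"
    and T_sum_le: "0 < r \<Longrightarrow> r < 1 \<Longrightarrow> (\<Sum>k<K. T (Suc k) r) \<le> r"
    and T_deriv: "0 < r \<Longrightarrow> r < 1 \<Longrightarrow>
      (T (Suc k) has_real_derivative f k * (T k r - T (Suc k) r) / sigma r) (at r)"
    and a_pos: "0 < a"
    and sigma_lower: "0 < r \<Longrightarrow> r < 1 \<Longrightarrow> a * r \<le> sigma r"
    and sigma_upper: "0 < r \<Longrightarrow> r < 1 \<Longrightarrow> sigma r \<le> b * r"
    and sigma_cont: "0 < r \<Longrightarrow> r < 1 \<Longrightarrow> isCont sigma r"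
    and sigma_approx: "0 < r \<Longrightarrow> r < 1 \<Longrightarrow>
      \<bar>sigma r - (c * r + (\<Sum>k<K. (f k - c * real k) * (T k r - T (Suc k) r)))\<bar> \<le> err K * r"
    and err_lim: "err \<longlonglongrightarrow> 0"
begin

lemma lam_pos: "0 < lam"
  using c_nonneg c_less by simp

lemma sigma_pos: "0 < r \<Longrightarrow> r < 1 \<Longrightarrow> 0 < sigma r"
  using sigma_lower[of r] a_pos by (meson less_le_trans mult_pos_pos)

lemma b_pos: "0 < b"
  using sigma_pos[of "1/2"] sigma_upper[of "1/2"] by simp

lemma err_nonneg: "0 \<le> err K"
  using order_trans[OF abs_ge_zero sigma_approx[of "1/2" K]] by simp

text \<open>The time of the branching process, in which the flow becomes linear with exponential rates. It is determined up
  to an additive constant, which is immaterial. All arguments keep the size \<open>r\<close> as the variable and differentiate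
  functions of the form \<open>exp (mu * clock r) * F r\<close>, so the clock never has to be inverted.\<close>
definition clock :: "real \<Rightarrow> real" where
  "clock = (SOME s. \<forall>r. 0 < r \<longrightarrow> r < 1 \<longrightarrow> (s has_real_derivative 1 / sigma r) (at r))"

lemma clock_deriv:
  assumes "0 < r" and "r < 1"
  shows "(clock has_real_derivative 1 / sigma r) (at r)"
proof -
  have "\<exists>s. \<forall>r::real. 0 < ereal r \<longrightarrow> ereal r < 1 \<longrightarrow> (s has_vector_derivative 1 / sigma r) (at r)"
    by (rule einterval_antiderivative)
       (auto intro!: continuous_intros sigma_cont simp: less_imp_neq[OF sigma_pos, symmetric] ereal_less)
  then have "\<exists>s. \<forall>r. 0 < r \<longrightarrow> r < 1 \<longrightarrow> (s has_real_derivative 1 / sigma r) (at r)"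
    by (simp add: has_real_derivative_iff_has_vector_derivative ereal_less)
  from someI_ex[OF this] show ?thesis
    unfolding clock_def using assms by blast
qed

lemma exp_clock_deriv:
  assumes "0 < r" and "r < 1"
  shows "((\<lambda>r. exp (mu * clock r)) has_real_derivative exp (mu * clock r) * (mu / sigma r)) (at r)"
  by (auto intro!: derivative_eq_intros clock_deriv[OF assms])

lemma clock_mono:
  assumes "0 < x" "x \<le> y" "y < 1"
  shows "clock x \<le> clock y"
  using assms
  by (intro DERIV_nonneg_imp_nondecreasing[OF assms(2)])
     (metis clock_deriv divide_nonneg_nonneg less_imp_le less_le_trans le_less_trans sigma_pos zero_le_one)

text \<open>In the clock the flow has been running since \<open>- \<infinity>\<close>, because \<open>sigma\<close> is at most linear.\<close>
lemma clock_at_bot: "filterlim clock at_bot (at_right 0)"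
proof (rule filterlim_at_bot_mono)
  show "filterlim (\<lambda>r::real. clock (1/2) - ln (1/2) / b + ln r / b) at_bot (at_right 0)"
  proof (subst filterlim_tendsto_add_at_bot_iff[OF tendsto_const])
    show "filterlim (\<lambda>r::real. ln r / b) at_bot (at_right 0)"
      using filterlim_tendsto_pos_mult_at_bot[OF tendsto_const _ ln_at_0, of "1 / b"] b_pos
      by simp
  qed
  have "clock r \<le> clock (1/2) - ln (1/2) / b + ln r / b" if r: "0 < r" "r \<le> 1/2" for r
  proof -
    have "clock r - ln r / b \<le> clock (1/2) - ln (1/2) / b"
    proof (rule DERIV_nonneg_imp_nondecreasing[OF r(2)])
      fix x
      assume x: "r \<le> x" "x \<le> 1/2"
      then have x': "0 < x" "x < 1" using r by auto
      have "1 / (b * x) \<le> 1 / sigma x"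
        using sigma_upper[OF x'] sigma_pos[OF x'] by (intro divide_left_mono) auto
      then have "0 \<le> 1 / sigma x - 1 / x / b" by (simp add: mult.commute)
      moreover have "((\<lambda>r. clock r - ln r / b) has_real_derivative 1 / sigma x - 1 / x / b) (at x)"
        using x' b_pos by (auto intro!: derivative_eq_intros clock_deriv)
      ultimately show "\<exists>y. ((\<lambda>r. clock r - ln r / b) has_real_derivative y) (at x) \<and> 0 \<le> y"
        by blast
    qed
    then show ?thesis by simp
  qed
  then show "eventually (\<lambda>r. clock r \<le> clock (1/2) - ln (1/2) / b + ln r / b) (at_right 0)"
    unfolding eventually_at_right_field by (intro exI[of _ "1/2"]) auto
qed

lemma exp_clock_tendsto:
  assumes "0 < mu"
  shows "((\<lambda>r. exp (mu * clock r)) \<longlongrightarrow> 0) (at_right 0)"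
  by (rule filterlim_compose[OF exp_at_bot])
     (use assms in \<open>intro filterlim_tendsto_pos_mult_at_bot[OF tendsto_const _ clock_at_bot]\<close>)

lemma eventually_in_window: "0 < w \<Longrightarrow> eventually (\<lambda>r::real. 0 < r \<and> r < w) (at_right 0)"
  unfolding eventually_at_right_field by auto

lemma T_antimono: "0 < r \<Longrightarrow> r < 1 \<Longrightarrow> j \<le> k \<Longrightarrow> T k r \<le> T j r"
  by (rule lift_Suc_antimono_le[of "\<lambda>k. T k r"]) (auto intro: T_Suc_le)

lemma T_le: "0 < r \<Longrightarrow> r < 1 \<Longrightarrow> T k r \<le> r"
  using T_antimono[of r 0 k] T_0 by simp

lemma T_tendsto: "(T k \<longlongrightarrow> 0) (at_right 0)"
proof (rule tendsto_sandwich)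
  show "eventually (\<lambda>r. 0 \<le> T k r) (at_right 0)" "eventually (\<lambda>r. T k r \<le> r) (at_right 0)"
    using T_nonneg T_le by (auto intro: eventually_mono[OF eventually_in_window[of 1]])
qed (auto intro: tendsto_intros)

lemma T_mono:
  assumes "0 < x" "x \<le> y" "y < 1"
  shows "T k x \<le> T k y"
proof (cases k)
  case 0
  then show ?thesis using assms T_0 by simp
next
  case (Suc j)
  show ?thesis
    unfolding Suc
  proof (rule DERIV_nonneg_imp_nondecreasing[OF assms(2)])
    fix t
    assume "x \<le> t" "t \<le> y"
    then have t: "0 < t" "t < 1" using assms by auto
    have "0 \<le> f j * (T j t - T (Suc j) t) / sigma t"
      using pos[of j] T_Suc_le[OF t] sigma_pos[OF t] by (intro divide_nonneg_nonneg mult_nonneg_nonneg) auto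
    then show "\<exists>d. (T (Suc j) has_real_derivative d) (at t) \<and> 0 \<le> d"
      using T_deriv[OF t] by blast
  qed
qed

lemma T_summable: "0 < r \<Longrightarrow> r < 1 \<Longrightarrow> summable (\<lambda>k. T (Suc k) r)"
  using T_nonneg T_sum_le by (intro summableI_nonneg_bounded[where x = r]) auto

lemma T_times_index: 
  assumes "0 < r" "r < 1"
  shows "(\<lambda>k. real k * T k r) \<longlonglongrightarrow> 0"
proof (rule decseq_summable_times_index)
  show "summable (\<lambda>k. T k r)"
    using T_summable[OF assms] summable_Suc_iff[of "\<lambda>k. T k r"] by simp
qed (use T_nonneg T_antimono assms in \<open>auto simp: decseq_def\<close>)

text \<open>A solution of \<open>D' \<ge> - beta * D\<close> (in clock time) that does not blow up too fast at \<open>- \<infinity>\<close> is nonnegative: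
  \<open>exp (beta * clock r) * D r\<close> increases from \<open>0\<close>.\<close>
lemma comparison:
  assumes w: "w \<le> 1"
    and deriv: "\<And>r. 0 < r \<Longrightarrow> r < w \<Longrightarrow> (D has_real_derivative D' r) (at r)"
    and ge: "\<And>r. 0 < r \<Longrightarrow> r < w \<Longrightarrow> - beta * D r / sigma r \<le> D' r"
    and lim: "((\<lambda>r. exp (beta * clock r) * D r) \<longlongrightarrow> 0) (at_right 0)"
    and r: "0 < r" "r < w"
  shows "0 \<le> D r"
proof -
  have mono: "exp (beta * clock x) * D x \<le> exp (beta * clock r) * D r" if x: "0 < x" "x < r" for x
  proof (rule DERIV_nonneg_imp_nondecreasing[OF less_imp_le[OF x(2)]])
    fix t
    assume "x \<le> t" "t \<le> r"
    then have t: "0 < t" "t < w" "t < 1" using x r w by auto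
    have "0 \<le> D' t - (- beta * D t / sigma t)"
      using ge[OF t(1,2)] by simp
    then have "0 \<le> exp (beta * clock t) * (D' t - (- beta * D t / sigma t))"
      by simp
    also have "\<dots> = exp (beta * clock t) * (beta / sigma t) * D t + D' t * exp (beta * clock t)"
      by (simp add: algebra_simps)
    finally show "\<exists>y. ((\<lambda>x. exp (beta * clock x) * D x) has_real_derivative y) (at t) \<and> 0 \<le> y"
      using DERIV_mult[OF exp_clock_deriv[OF t(1,3), of beta] deriv[OF t(1,2)]] by blast
  qed
  have "0 \<le> exp (beta * clock r) * D r"
    by (rule tendsto_upperbound[OF lim])
       (use mono r in \<open>auto intro: eventually_mono[OF eventually_in_window[of r]]\<close>)
  then show ?thesis by (simp add: zero_le_mult_iff)
qed

text \<open>Multiples of \<open>surv f mu k * exp (mu * clock r)\<close> solve the same triangular system as the tails, so a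
  comparison of the total size with an exponential is inherited by every tail. The factor \<open>sg\<close> covers upper and
  lower bounds at once.\<close>
lemma exponential_comparison:
  assumes w: "w \<le> 1" and mu: "0 \<le> mu"
    and base: "\<And>r. 0 < r \<Longrightarrow> r < w \<Longrightarrow> 0 \<le> sg * (r - B * exp (mu * clock r))"
    and r: "0 < r" "r < w"
  shows "0 \<le> sg * (T k r - B * surv f mu k * exp (mu * clock r))"
  using r
proof (induction k arbitrary: r)
  case 0
  then show ?case using base T_0 w by simp
next
  case (Suc k)
  define D where "D r = sg * (T (Suc k) r - B * surv f mu (Suc k) * exp (mu * clock r))" for r
  define D' where "D' r = sg * (f k * (T k r - T (Suc k) r) / sigma r
      - B * surv f mu (Suc k) * (exp (mu * clock r) * (mu / sigma r)))" for r
  have "0 \<le> D r"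
  proof (rule comparison[OF w _ _ _ Suc.prems])
    fix t :: real
    assume t: "0 < t" "t < w"
    then have t1: "t < 1" using w by simp
    show "(D has_real_derivative D' t) (at t)"
      unfolding D_def D'_def by (intro DERIV_cmult DERIV_diff T_deriv exp_clock_deriv t(1) t1)
    have "D' t - (- f k * D t / sigma t) = sg * (f k * T k t
        - B * exp (mu * clock t) * ((mu + f k) * surv f mu (Suc k))) / sigma t"
      using sigma_pos[OF t(1) t1] by (simp add: D_def D'_def field_simps)
    also have "\<dots> = f k * (sg * (T k t - B * surv f mu k * exp (mu * clock t))) / sigma t"
      using surv_balance[of f mu k] pos mu by (simp add: algebra_simps)
    also have "\<dots> \<ge> 0"
      using Suc.IH[OF t] pos[of k] sigma_pos[OF t(1) t1]
      by (intro divide_nonneg_nonneg mult_nonneg_nonneg[OF less_imp_le[OF pos]]) auto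
    finally show "- f k * D t / sigma t \<le> D' t" by simp
  next
    have "((\<lambda>r. sg * (exp (f k * clock r) * T (Suc k) r
        - B * surv f mu (Suc k) * exp ((f k + mu) * clock r))) \<longlongrightarrow> sg * (0 * 0 - B * surv f mu (Suc k) * 0)) (at_right 0)"
      by (intro tendsto_intros exp_clock_tendsto T_tendsto) (use pos[of k] mu in auto)
    then show "((\<lambda>r. exp (f k * clock r) * D r) \<longlongrightarrow> 0) (at_right 0)"
      by (simp add: D_def algebra_simps exp_add)
  qed
  then show ?case by (simp add: D_def)
qed

text \<open>The rescaled number of edges to children that are beyond the \<open>K\<close>-th of their parent.\<close>
definition remainder :: "nat \<Rightarrow> real \<Rightarrow> real" where
  "remainder K r = r - (\<Sum>k<K. T (Suc k) r)"

definition escaping :: "real \<Rightarrow> real" where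
  "escaping r = r - (\<Sum>k. T (Suc k) r)"

text \<open>The weight that the first \<open>K\<close> degree classes do not account for.\<close>
definition missing :: "nat \<Rightarrow> real \<Rightarrow> real" where
  "missing K r = sigma r - (\<Sum>k<K. f k * (T k r - T (Suc k) r))"

lemma remainder_nonneg: "0 < r \<Longrightarrow> r < 1 \<Longrightarrow> 0 \<le> remainder K r"
  using T_sum_le by (simp add: remainder_def)

lemma remainder_tendsto: "0 < r \<Longrightarrow> r < 1 \<Longrightarrow> (\<lambda>K. remainder K r) \<longlonglongrightarrow> escaping r"
  unfolding remainder_def escaping_def by (intro tendsto_intros summable_LIMSEQ T_summable)

lemma escaping_nonneg: "0 < r \<Longrightarrow> r < 1 \<Longrightarrow> 0 \<le> escaping r"
  by (rule tendsto_lowerbound[OF remainder_tendsto]) (auto simp: remainder_nonneg)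

lemma escaping_le_remainder: "0 < r \<Longrightarrow> r < 1 \<Longrightarrow> escaping r \<le> remainder K r"
  unfolding escaping_def remainder_def
  using sum_le_suminf[OF T_summable, of r "{..<K}"] T_nonneg by auto

lemma sum_index_diff:
  fixes x :: "nat \<Rightarrow> real"
  shows "(\<Sum>k<K. real k * (x k - x (Suc k))) = (\<Sum>k<K. x (Suc k)) - real K * x K"
  by (induction K) (auto simp: algebra_simps)

text \<open>The remaining edges sit at vertices of large degree and have asymptotic weight \<open>c\<close> each;
  \<open>remainder K r + K * T K r\<close> is the total degree of the vertices with at least \<open>K\<close> children.\<close>
lemma missing_approx:
  assumes "0 < r" "r < 1"
  shows "\<bar>missing K r - c * (remainder K r + real K * T K r)\<bar> \<le> err K * r"
proof -
  have "(\<Sum>k<K. (f k - c * real k) * (T k r - T (Suc k) r))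
      = (\<Sum>k<K. f k * (T k r - T (Suc k) r)) - c * (\<Sum>k<K. real k * (T k r - T (Suc k) r))"
    by (simp add: left_diff_distrib sum_subtractf sum_distrib_left mult.assoc)
  also have "\<dots> = (\<Sum>k<K. f k * (T k r - T (Suc k) r)) - c * (r - remainder K r - real K * T K r)"
    by (subst sum_index_diff) (simp add: remainder_def)
  finally show ?thesis
    using sigma_approx[OF assms, of K] by (simp add: missing_def algebra_simps)
qed

lemma missing_lower: "0 < r \<Longrightarrow> r < 1 \<Longrightarrow> - (err K * r) \<le> missing K r"
  using missing_approx[of r K] remainder_nonneg[of r K] T_nonneg[of r K] c_nonneg
  by (smt (verit) mult_nonneg_nonneg of_nat_0_le_iff)

lemma remainder_deriv:
  assumes "0 < r" "r < 1"
  shows "(remainder K has_real_derivative missing K r / sigma r) (at r)"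
proof -
  have "(remainder K has_real_derivative 1 - (\<Sum>k<K. f k * (T k r - T (Suc k) r) / sigma r)) (at r)"
    unfolding remainder_def by (intro DERIV_diff DERIV_ident DERIV_sum T_deriv assms)
  moreover have "1 - (\<Sum>k<K. f k * (T k r - T (Suc k) r) / sigma r) = missing K r / sigma r"
    using sigma_pos[OF assms] by (simp add: missing_def diff_divide_distrib sum_divide_distrib)
  ultimately show ?thesis by simp
qed

text \<open>Edges at infinite degree reproduce at rate \<open>c\<close>, so in clock time their number is proportional to
  \<open>exp (c s)\<close>; the inequality that is needed says that they cannot have appeared out of the finite degrees. The
  derivative of the truncated quantity is controlled by \<open>K * T K\<close>, which tends to \<open>0\<close>, uniformly on
  compact intervals because \<open>T K\<close> is monotone.\<close>
lemma escaping_decreasing: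
  assumes x: "0 < x" and xy: "x \<le> y" and y: "y < 1"
  shows "exp (- c * clock y) * escaping y \<le> exp (- c * clock x) * escaping x"
proof -
  have y0: "0 < y" and x1: "x < 1" using x xy y by auto
  define B where "B K = exp (- c * clock x) * ((c * (real K * T K y) + err K) / (a * x))" for K
  have "exp (- c * clock y) * remainder K y - exp (- c * clock x) * remainder K x \<le> B K * (y - x)" for K
  proof (rule diff_le_of_deriv_le[OF xy])
    fix t
    assume xt: "x \<le> t" "t \<le> y"
    then have t: "0 < t" "t < 1" using x y by auto
    show "((\<lambda>t. exp (- c * clock t) * remainder K t) has_real_derivative
        exp (- c * clock t) * ((missing K t - c * remainder K t) / sigma t)) (at t)"
      by (rule DERIV_cong[OF DERIV_mult[OF exp_clock_deriv[OF t] remainder_deriv[OF t]]])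
         (simp add: field_simps diff_divide_distrib)
    have e: "exp (- c * clock t) \<le> exp (- c * clock x)"
      using clock_mono[OF x xt(1) t(2)] c_nonneg by (simp add: mult_left_mono)
    have "missing K t - c * remainder K t \<le> c * (real K * T K t) + err K * t"
      using missing_approx[OF t, of K] by (simp add: abs_le_iff algebra_simps)
    also have "\<dots> \<le> c * (real K * T K y) + err K"
      using T_mono[OF t(1) xt(2) y, of K] c_nonneg err_nonneg[of K] t
      by (intro add_mono mult_left_mono) (auto simp: mult_left_le)
    finally have le: "missing K t - c * remainder K t \<le> c * (real K * T K y) + err K" .
    have nn: "0 \<le> c * (real K * T K y) + err K"
      using c_nonneg T_nonneg[OF y0 y, of K] err_nonneg[of K] by simp
    have "a * x \<le> sigma t"
      using sigma_lower[OF t] xt a_pos by (meson mult_left_mono less_imp_le order_trans)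
    then have "(missing K t - c * remainder K t) / sigma t \<le> (c * (real K * T K y) + err K) / (a * x)"
      using le nn a_pos x sigma_pos[OF t] by (intro frac_le) auto
    moreover have "0 \<le> (c * (real K * T K y) + err K) / (a * x)"
      using nn a_pos x by simp
    ultimately show "exp (- c * clock t) * ((missing K t - c * remainder K t) / sigma t) \<le> B K"
      unfolding B_def using e
      by (meson exp_ge_zero mult_left_mono mult_right_mono order_trans)
  qed
  moreover have "(\<lambda>K. B K * (y - x)) \<longlonglongrightarrow> exp (- c * clock x) * ((c * 0 + 0) / (a * x)) * (y - x)"
    unfolding B_def by (intro tendsto_intros T_times_index[OF y0 y] err_lim) (use a_pos x in auto)
  moreover have "(\<lambda>K. exp (- c * clock y) * remainder K y - exp (- c * clock x) * remainder K x)
      \<longlonglongrightarrow> exp (- c * clock y) * escaping y - exp (- c * clock x) * escaping x"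
    by (intro tendsto_intros remainder_tendsto y0 y x x1)
  ultimately have "exp (- c * clock y) * escaping y - exp (- c * clock x) * escaping x
      \<le> exp (- c * clock x) * ((c * 0 + 0) / (a * x)) * (y - x)"
    by (intro LIMSEQ_le) auto
  then show ?thesis by simp
qed

lemma surv_partial_sums: "(\<lambda>K. \<Sum>k<K. surv f lam (Suc k)) \<longlonglongrightarrow> 1"
  using surv_sums by (simp add: sums_def)

text \<open>If \<open>z\<close> times \<open>exp (c s)\<close> edges are at infinite degree, then a lower bound
  \<open>w * exp (c s)\<close> for the size gives the lower bounds \<open>w * surv f c k * exp (c s)\<close> for the tails. These sum to at least
  \<open>w * exp (c s)\<close> because \<open>c < lam\<close>, and adding the escaping edges improves \<open>w\<close> to \<open>w + z\<close>. Iterating contradicts finiteness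
  of the size.\<close>
lemma escaping_zero:
  assumes w: "0 < w" "w < 1"
  shows "escaping w = 0"
proof (rule ccontr)
  assume "escaping w \<noteq> 0"
  then have ew: "0 < escaping w"
    using escaping_nonneg[OF w] by simp
  define z where "z = exp (- c * clock w) * escaping w"
  have z: "0 < z" using ew by (simp add: z_def)
  have esc: "z * exp (c * clock r) \<le> escaping r" if r: "0 < r" "r < w" for r
  proof -
    have "z * exp (c * clock r) \<le> exp (- c * clock r) * escaping r * exp (c * clock r)"
      using escaping_decreasing[of r w] r w by (intro mult_right_mono) (auto simp: z_def)
    also have "\<dots> = escaping r"
      by (simp add: exp_minus field_simps)
    finally show ?thesis .
  qed
  have lower: "real n * z * exp (c * clock r) \<le> r" if "0 < r" "r < w" for n r
    using that
  proof (induction n arbitrary: r)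
    case (Suc n)
    have r: "0 < r" "r < 1" using Suc.prems w by auto
    define E where "E = exp (c * clock r)"
    have Tk: "real n * z * surv f lam k * E \<le> T k r" for k
    proof -
      have "0 \<le> 1 * (T k r - real n * z * surv f c k * exp (c * clock r))"
        by (rule exponential_comparison[of w]) (use Suc w c_nonneg in auto)
      moreover have "real n * z * surv f lam k * E \<le> real n * z * surv f c k * E"
        using surv_antimono[of f c lam k] pos c_nonneg c_less z
        by (intro mult_right_mono mult_left_mono) (auto simp: E_def)
      ultimately show ?thesis by (simp add: E_def)
    qed
    have "z * E + real n * z * E * (\<Sum>k<K. surv f lam (Suc k)) \<le> r" for K
    proof -
      have "real n * z * E * (\<Sum>k<K. surv f lam (Suc k)) = (\<Sum>k<K. real n * z * surv f lam (Suc k) * E)"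
        by (simp add: sum_distrib_left mult_ac)
      also have "\<dots> \<le> (\<Sum>k<K. T (Suc k) r)"
        by (intro sum_mono Tk)
      finally show ?thesis
        using esc[OF Suc.prems] escaping_le_remainder[OF r, of K] by (simp add: remainder_def E_def)
    qed
    moreover have "(\<lambda>K. z * E + real n * z * E * (\<Sum>k<K. surv f lam (Suc k))) \<longlonglongrightarrow> z * E + real n * z * E * 1"
      by (intro tendsto_intros surv_partial_sums)
    ultimately have "z * E + real n * z * E * 1 \<le> r"
      by (intro LIMSEQ_le_const2) auto
    then show ?case by (simp add: E_def algebra_simps)
  qed auto
  define r where "r = w / 2"
  have r: "0 < r" "r < w" using w by (auto simp: r_def)
  obtain n where "r / (z * exp (c * clock r)) < real n"
    using reals_Archimedean2 by blast
  then have "r < real n * (z * exp (c * clock r))"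
    using z by (simp add: divide_less_eq)
  with lower[OF r, of n] show False by (simp add: mult.assoc)
qed

lemma remainder_tendsto_0: "0 < r \<Longrightarrow> r < 1 \<Longrightarrow> (\<lambda>K. remainder K r) \<longlonglongrightarrow> 0"
  using remainder_tendsto[of r] escaping_zero[of r] by simp

end

section \<open>Conservation of reproductive value and uniqueness of the flow\<close>

lemma sum_weighted_diff:
  fixes h x :: "nat \<Rightarrow> real"
  assumes "h K = 0"
  shows "(\<Sum>k<K. h k * (x k - x (Suc k))) = h 0 * x 0 + (\<Sum>k<K. (h (Suc k) - h k) * x (Suc k))"
proof -
  have "(\<Sum>k<K. h k * (x k - x (Suc k))) = h 0 * x 0 - h K * x K + (\<Sum>k<K. (h (Suc k) - h k) * x (Suc k))"
    by (induction K) (auto simp: algebra_simps)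
  then show ?thesis using assms by simp
qed

lemma sum_linear_weight_diff_le:
  fixes x :: "nat \<Rightarrow> real"
  assumes "\<And>k. 0 \<le> x k" and "j \<le> K"
  shows "(\<Sum>k\<in>{j..<K}. (real k + 1) * (x k - x (Suc k))) \<le> (real j + 1) * x j + (\<Sum>k\<in>{j..<K}. x (Suc k))"
proof -
  have "(\<Sum>k\<in>{j..<K}. (real k + 1) * (x k - x (Suc k))) 
      = (real j + 1) * x j + (\<Sum>k\<in>{j..<K}. x (Suc k)) - (real K + 1) * x K"
    using assms(2) by (induction K rule: dec_induct) (auto simp: algebra_simps)
  then show ?thesis using assms(1)[of K] by simp
qed

context degree_flow
begin

text \<open>The total truncated reproductive value of the population.\<close>
definition worth :: "nat \<Rightarrow> real \<Rightarrow> real" where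
  "worth K r = (\<Sum>k<K. repro f lam K k * (T k r - T (Suc k) r))"

text \<open>The part of the reproductive value \<open>1\<close> of a newborn that the truncation at \<open>K\<close> children ignores.\<close>
definition deficit :: "nat \<Rightarrow> real" where
  "deficit K = 1 - repro f lam K 0"

lemma deficit_eq: "deficit K = 1 - (\<Sum>k<K. surv f lam (Suc k))"
  by (simp add: deficit_def repro_0 sum.atLeast1_atMost_eq)

lemma deficit_tendsto: "deficit \<longlonglongrightarrow> 0"
  using tendsto_diff[OF tendsto_const[of 1] surv_partial_sums] by (simp add: deficit_eq[abs_def])

lemma lam_nonneg: "0 \<le> lam"
  using lam_pos by simp

lemma deficit_nonneg: "0 \<le> deficit K"
  unfolding deficit_eq using surv_sums sum_le_suminf[of "\<lambda>k. surv f lam (Suc k)" "{..<K}"] surv_pos[of f lam] pos lam_nonneg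
  by (auto simp: sums_iff less_imp_le)

text \<open>Discounted reproductive value is conserved up to the effects of the truncation. Summation by parts puts
  the value in terms of the tails, whose derivatives are known, and \<open>repro_rec\<close> collapses the result.\<close>
lemma scaled_worth_deriv:
  assumes r: "0 < r" "r < 1"
  shows "((\<lambda>r. exp (- lam * clock r) * worth K r) has_real_derivative
    exp (- lam * clock r) * (missing K r / sigma r - deficit K)) (at r)"
proof -
  define h where "h = repro f lam K"
  define V where "V r = h 0 * r + (\<Sum>k<K. (h (Suc k) - h k) * T (Suc k) r)" for r
  have V: "worth K t = V t" if "0 < t" "t < 1" for t
    unfolding worth_def V_def h_def[symmetric]
    by (subst sum_weighted_diff) (auto simp: h_def repro_top T_0 that)
  define V' where "V' = h 0 + (\<Sum>k<K. (h (Suc k) - h k) * (f k * (T k r - T (Suc k) r) / sigma r))"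
  have dV: "(V has_real_derivative V') (at r)"
    unfolding V_def V'_def
    by (intro DERIV_add DERIV_sum DERIV_cmult T_deriv r DERIV_cmult_Id)
  have "(h (Suc k) - h k) * f k = lam * h k - f k" if "k < K" for k
    using repro_rec[of f lam k K] pos lam_nonneg that by (simp add: h_def algebra_simps)
  then have "(\<Sum>k<K. (h (Suc k) - h k) * (f k * (T k r - T (Suc k) r) / sigma r))
      = (\<Sum>k<K. (lam * h k - f k) * (T k r - T (Suc k) r) / sigma r)"
    by (intro sum.cong) (auto simp flip: mult.assoc)
  also have "\<dots> = (lam * worth K r - (sigma r - missing K r)) / sigma r"
    by (simp add: worth_def missing_def h_def sum_distrib_left sum_subtractf left_diff_distrib
        mult.assoc flip: sum_divide_distrib)
  also have "h 0 + \<dots> = (lam * V r + missing K r) / sigma r - deficit K"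
    using sigma_pos[OF r] V[OF r] by (simp add: deficit_def h_def field_simps)
  finally have V': "V' = (lam * V r + missing K r) / sigma r - deficit K"
    by (simp add: V'_def)
  have "((\<lambda>r. exp (- lam * clock r) * V r) has_real_derivative
      exp (- lam * clock r) * (missing K r / sigma r - deficit K)) (at r)"
    by (rule DERIV_cong[OF DERIV_mult[OF exp_clock_deriv[OF r] dV]])
       (use sigma_pos[OF r] in \<open>simp add: V' field_simps\<close>)
  then show ?thesis
    by (rule has_field_derivative_transform_within_open[where S = "{0<..<1}"]) (use r V in auto)
qed

lemma worth_upper:
  assumes r: "0 < r" "r < 1"
  shows "worth K r \<le> 2 * A * r"
proof -
  have A: "0 \<le> A"
    using repro_bound[of 0 0] by (simp add: repro_top)
  have "worth K r \<le> (\<Sum>k<K. A * (real k + 1) * (T k r - T (Suc k) r))"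
    unfolding worth_def using repro_bound T_Suc_le[OF r] by (intro sum_mono mult_right_mono) auto
  also have "\<dots> = A * (\<Sum>k\<in>{0..<K}. (real k + 1) * (T k r - T (Suc k) r))"
    by (simp add: sum_distrib_left mult.assoc atLeast0LessThan)
  also have "\<dots> \<le> A * ((real 0 + 1) * T 0 r + (\<Sum>k\<in>{0..<K}. T (Suc k) r))"
    using A T_nonneg[OF r] by (intro mult_left_mono sum_linear_weight_diff_le) auto
  also have "\<dots> \<le> A * (r + r)"
    using A T_0[OF r] T_sum_le[OF r, of K] by (intro mult_left_mono add_mono) (auto simp: atLeast0LessThan)
  finally show ?thesis by simp
qed

lemma repro_lower:
  assumes "k < K"
  shows "surv f lam (Suc k) / surv f lam k \<le> repro f lam K k"
  unfolding repro_def
proof (rule divide_right_mono)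
  have "(\<Sum>j\<in>{Suc k}. surv f lam j) \<le> (\<Sum>j\<in>{k<..K}. surv f lam j)"
    using assms surv_pos[of f lam] pos lam_nonneg by (intro sum_mono2) (auto simp: less_imp_le)
  then show "surv f lam (Suc k) \<le> (\<Sum>j\<in>{k<..K}. surv f lam j)" by simp
qed (use surv_pos[of f lam k] pos lam_nonneg in auto)

text \<open>Since the mean number of children is at most \<open>1\<close>, at least half of the vertices have at most one child, and the
  values of these two states are bounded away from \<open>0\<close>.\<close>
lemma worth_lower:
  obtains kappa where "0 < kappa" "\<And>r K. 0 < r \<Longrightarrow> r < 1 \<Longrightarrow> 2 \<le> K \<Longrightarrow> kappa * r \<le> worth K r"
proof -
  define q where "q k = surv f lam (Suc k) / surv f lam k" for k
  have q: "0 < q k" for k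
    unfolding q_def using surv_pos[of f lam] pos lam_nonneg by simp
  define kappa where "kappa = min (q 0) (q 1)"
  have kappa: "0 < kappa" using q by (simp add: kappa_def)
  have "kappa / 2 * r \<le> worth K r" if r: "0 < r" "r < 1" and K: "2 \<le> K" for r K
  proof -
    have hk: "kappa \<le> repro f lam K k" if "k \<in> {0, 1}" for k
      using repro_lower[of k K] that K by (auto simp: kappa_def q_def)
    have "T (Suc 1) r \<le> T 1 r" by (rule T_Suc_le[OF r])
    moreover have "T 1 r + T (Suc 1) r \<le> r"
      using T_sum_le[OF r, of 2] by (simp add: eval_nat_numeral)
    ultimately have "r / 2 \<le> T 0 r - T (Suc 1) r"
      using T_0[OF r] by simp
    then have "kappa / 2 * r \<le> kappa * (T 0 r - T (Suc 1) r)"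
      using kappa mult_left_mono[of "r / 2" _ kappa] by simp
    also have "\<dots> = (\<Sum>k\<in>{0, 1}. kappa * (T k r - T (Suc k) r))"
      by (simp add: algebra_simps)
    also have "\<dots> \<le> (\<Sum>k\<in>{0, 1}. repro f lam K k * (T k r - T (Suc k) r))"
      using hk T_Suc_le[OF r] by (intro sum_mono mult_right_mono) auto
    also have "\<dots> \<le> worth K r"
      unfolding worth_def using K T_Suc_le[OF r] repro_nonneg[of f lam] pos lam_nonneg
      by (intro sum_mono2) auto
    finally show ?thesis .
  qed
  with kappa show ?thesis by (intro that[of "kappa / 2"]) auto
qed

text \<open>The size is comparable with the reproductive value from both sides, and the discounted reproductive value does not
  decrease in time; going back from \<open>r = 1/2\<close> therefore bounds the scaled size of the past.\<close>
lemma scaled_size_bounded: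
  obtains B where "\<And>r. 0 < r \<Longrightarrow> r < 1 \<Longrightarrow> r * exp (- lam * clock r) \<le> B"
proof -
  obtain kappa where kappa: "0 < kappa" "\<And>r K. 0 < r \<Longrightarrow> r < 1 \<Longrightarrow> 2 \<le> K \<Longrightarrow> kappa * r \<le> worth K r"
    using worth_lower by blast
  define h where "h = (1/2 :: real)"
  have h: "0 < h" "h < 1" by (auto simp: h_def)
  define e where "e r = exp (- lam * clock r)" for r
  have e_mono: "e y \<le> e x" if "0 < x" "x \<le> y" "y < 1" for x y
    using clock_mono[OF that] lam_pos by (simp add: e_def mult_left_mono)
  have A: "0 \<le> A"
    using repro_bound[of 0 0] by (simp add: repro_top)
  have small: "kappa * (r * e r) \<le> 2 * A * e h" if r: "0 < r" "r \<le> h" for r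
  proof -
    have r1: "r < 1" using r h by simp
    define B where "B K = e r * (err K / a + deficit K)" for K
    have "- (e h * worth K h) - - (e r * worth K r) \<le> B K * (h - r)" for K
    proof (rule diff_le_of_deriv_le[OF r(2)])
      fix t
      assume rt: "r \<le> t" "t \<le> h"
      then have t: "0 < t" "t < 1" using r h by auto
      show "((\<lambda>t. - (e t * worth K t)) has_real_derivative
          - (e t * (missing K t / sigma t - deficit K))) (at t)"
        unfolding e_def by (rule DERIV_minus[OF scaled_worth_deriv[OF t]])
      have "err K * t / sigma t \<le> err K * t / (a * t)"
        using sigma_lower[OF t] sigma_pos[OF t] a_pos t err_nonneg[of K] by (intro divide_left_mono) auto
      moreover have "- (err K * t) / sigma t \<le> missing K t / sigma t"
        using missing_lower[OF t, of K] sigma_pos[OF t] by (intro divide_right_mono) auto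
      ultimately have "deficit K - missing K t / sigma t \<le> err K / a + deficit K"
        using t by simp
      then have "e t * (deficit K - missing K t / sigma t) \<le> e t * (err K / a + deficit K)"
        by (intro mult_left_mono) (auto simp: e_def)
      also have "\<dots> \<le> B K"
        unfolding B_def using e_mono[OF r(1) rt(1) t(2)] err_nonneg[of K] a_pos deficit_nonneg[of K]
        by (intro mult_right_mono) auto
      finally show "- (e t * (missing K t / sigma t - deficit K)) \<le> B K"
        by (simp add: algebra_simps)
    qed
    then have "e r * worth K r \<le> e h * worth K h + B K * (h - r)" for K
      by (simp add: algebra_simps)
    moreover have "e h * worth K h \<le> 2 * A * e h" for K
    proof -
      have "e h * worth K h \<le> e h * (2 * A * h)"
        using worth_upper[OF h, of K] by (intro mult_left_mono) (auto simp: e_def)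
      also have "\<dots> \<le> e h * (2 * A)"
        using A by (intro mult_left_mono) (auto simp: e_def h_def)
      finally show ?thesis by (simp add: mult_ac)
    qed
    ultimately have 1: "e r * worth K r \<le> 2 * A * e h + B K * (h - r)" for K
      by (meson add_right_mono order_trans)
    have 2: "kappa * (r * e r) \<le> e r * worth K r" if "2 \<le> K" for K
    proof -
      have "e r * (kappa * r) \<le> e r * worth K r"
        using kappa(2)[OF r(1) r1 that] by (intro mult_left_mono) (auto simp: e_def)
      then show ?thesis by (simp add: mult_ac)
    qed
    have "kappa * (r * e r) \<le> 2 * A * e h + B K * (h - r)" if "2 \<le> K" for K
      using 1[of K] 2[OF that] by simp
    moreover have "(\<lambda>K. 2 * A * e h + B K * (h - r)) \<longlonglongrightarrow> 2 * A * e h + e r * (0 / a + 0) * (h - r)"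
      unfolding B_def by (intro tendsto_intros err_lim deficit_tendsto) (use a_pos in auto)
    ultimately have "kappa * (r * e r) \<le> 2 * A * e h + e r * (0 / a + 0) * (h - r)"
      by (intro LIMSEQ_le_const) auto
    then show ?thesis by simp
  qed
  have "r * e r \<le> 2 * A * e h / kappa + e h" if r: "0 < r" "r < 1" for r
  proof (cases "r \<le> h")
    case True
    have "r * e r \<le> 2 * A * e h / kappa"
      using small[OF r(1) True] kappa(1) by (simp add: field_simps)
    moreover have "0 < e h" by (simp add: e_def)
    ultimately show ?thesis by linarith
  next
    case False
    then have "e r \<le> e h" using e_mono h r by simp
    then have "r * e r \<le> e h"
      using r by (smt (verit) e_def exp_gt_zero mult_left_le_one_le)
    moreover have "0 \<le> 2 * A * e h / kappa"
      using A kappa(1) by (simp add: e_def)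
    ultimately show ?thesis by linarith
  qed
  then show ?thesis by (intro that) (auto simp: e_def)
qed

definition scaled :: "nat \<Rightarrow> real \<Rightarrow> real" where
  "scaled k r = T k r * exp (- lam * clock r)"

lemma scaled_bounds:
  assumes base: "\<And>r. 0 < r \<Longrightarrow> r < 1 \<Longrightarrow> m \<le> scaled 0 r" "\<And>r. 0 < r \<Longrightarrow> r < 1 \<Longrightarrow> scaled 0 r \<le> M"
    and r: "0 < r" "r < 1"
  shows "m * surv f lam k \<le> scaled k r" and "scaled k r \<le> M * surv f lam k"
proof -
  have e: "exp (- lam * clock t) * exp (lam * clock t) = 1" for t
    by (simp flip: exp_add)
  have "0 \<le> 1 * (t - m * exp (lam * clock t))" "0 \<le> - 1 * (t - M * exp (lam * clock t))" if t: "0 < t" "t < 1" for t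
  proof -
    have "scaled 0 t * exp (lam * clock t) = t"
      using e[of t] by (simp add: scaled_def T_0[OF t] mult.assoc)
    moreover have "m * exp (lam * clock t) \<le> scaled 0 t * exp (lam * clock t)"
      using base(1)[OF t] by (rule mult_right_mono) simp
    moreover have "scaled 0 t * exp (lam * clock t) \<le> M * exp (lam * clock t)"
      using base(2)[OF t] by (rule mult_right_mono) simp
    ultimately show "0 \<le> 1 * (t - m * exp (lam * clock t))" "0 \<le> - 1 * (t - M * exp (lam * clock t))"
      by simp_all
  qed
  note cmp = exponential_comparison[of 1 lam, OF _ _ this(1) r, of k] exponential_comparison[of 1 lam, OF _ _ this(2) r, of k]
  have "m * surv f lam k * exp (lam * clock r) * exp (- lam * clock r) \<le> scaled k r"
    unfolding scaled_def using cmp(1) lam_nonneg by (intro mult_right_mono) auto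
  moreover have "scaled k r \<le> M * surv f lam k * exp (lam * clock r) * exp (- lam * clock r)"
    unfolding scaled_def using cmp(2) lam_nonneg by (intro mult_right_mono) auto
  moreover have "exp (lam * clock r) * exp (- lam * clock r) = 1"
    by (simp flip: exp_add)
  ultimately show "m * surv f lam k \<le> scaled k r" "scaled k r \<le> M * surv f lam k"
    by (simp_all only: mult.assoc mult_1_right)
qed

lemma scaled_sums:
  assumes r: "0 < r" "r < 1"
  shows "(\<lambda>k. scaled (Suc k) r) sums scaled 0 r"
proof -
  have "(\<lambda>k. T (Suc k) r) sums r"
    using T_summable[OF r] escaping_zero[OF r] by (simp add: escaping_def sums_iff)
  then show ?thesis
    unfolding scaled_def T_0[OF r] by (rule sums_mult2)
qed

text \<open>With no escaping mass and a bounded scaled size, all truncation errors vanish in the limit, uniformly between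
  the two moments.\<close>
lemma worth_conserved:
  assumes M: "\<And>r. 0 < r \<Longrightarrow> r < 1 \<Longrightarrow> scaled 0 r \<le> M"
    and x: "0 < x" "x \<le> y" "y < 1"
  shows "(\<lambda>K. exp (- lam * clock y) * worth K y - exp (- lam * clock x) * worth K x) \<longlonglongrightarrow> 0"
proof -
  define e where "e r = exp (- lam * clock r)" for r
  define G where "G K r = e r * worth K r" for K r
  define B where "B K = (c * (M * deficit K + M * (real K * surv f lam K)) + err K * M) / (a * x) + deficit K * M / x" for K
  have M0: "0 \<le> M"
    using M[of "1/2"] T_0[of "1/2"] by (smt (verit) scaled_def exp_ge_zero mult_nonneg_nonneg half_gt_zero_iff field_sum_of_halves)
  \<comment> \<open>both sides vanish as \<open>K \<rightarrow> \<infinity>\<close>, and their difference decreases in \<open>K\<close>\<close>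
  have rem: "e t * remainder K t \<le> M * deficit K" if t: "0 < t" "t < 1" for t K
  proof -
    have "decseq (\<lambda>K. M * deficit K - e t * remainder K t)"
    proof (rule decseq_SucI)
      fix n
      have "scaled (Suc n) t \<le> M * surv f lam (Suc n)"
        by (rule scaled_bounds(2)[of 0]) (use M t T_nonneg in \<open>auto simp: scaled_def\<close>)
      then show "M * deficit (Suc n) - e t * remainder (Suc n) t \<le> M * deficit n - e t * remainder n t"
        by (simp add: deficit_eq remainder_def scaled_def e_def algebra_simps)
    qed
    moreover have "(\<lambda>K. M * deficit K - e t * remainder K t) \<longlonglongrightarrow> M * 0 - e t * 0"
      by (intro tendsto_intros deficit_tendsto remainder_tendsto_0 t)
    ultimately have "M * 0 - e t * 0 \<le> M * deficit K - e t * remainder K t"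
      by (rule decseq_ge)
    then show ?thesis by simp
  qed
  have bound: "\<bar>e t * (missing K t / sigma t - deficit K)\<bar> \<le> B K" if t: "x \<le> t" "t \<le> y" for t K
  proof -
    have t01: "0 < t" "t < 1" using t x by auto
    have et: "e t * t \<le> M"
      using M[OF t01] by (simp add: scaled_def T_0[OF t01] e_def mult.commute)
    have "scaled K t \<le> M * surv f lam K"
      by (rule scaled_bounds(2)[of 0]) (use M t01 T_nonneg in \<open>auto simp: scaled_def\<close>)
    then have "real K * (e t * T K t) \<le> real K * (M * surv f lam K)"
      by (intro mult_left_mono) (auto simp: scaled_def e_def mult.commute)
    then have c1: "c * (e t * remainder K t + real K * (e t * T K t)) \<le> c * (M * deficit K + M * (real K * surv f lam K))"
      using rem[OF t01, of K] c_nonneg by (intro mult_left_mono add_mono) (auto simp: mult_ac)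
    have "\<bar>missing K t\<bar> \<le> c * (remainder K t + real K * T K t) + err K * t"
      using missing_approx[OF t01, of K] remainder_nonneg[OF t01, of K] T_nonneg[OF t01, of K] c_nonneg err_nonneg[of K] t01
      by (smt (verit) mult_nonneg_nonneg of_nat_0_le_iff)
    then have "e t * \<bar>missing K t\<bar> \<le> e t * (c * (remainder K t + real K * T K t) + err K * t)"
      by (intro mult_left_mono) (auto simp: e_def)
    also have "\<dots> = c * (e t * remainder K t + real K * (e t * T K t)) + err K * (e t * t)"
      by (simp add: algebra_simps)
    also have "\<dots> \<le> c * (M * deficit K + M * (real K * surv f lam K)) + err K * M"
      using c1 by (rule add_mono) (intro mult_left_mono et err_nonneg)
    finally have num: "e t * \<bar>missing K t\<bar> \<le> c * (M * deficit K + M * (real K * surv f lam K)) + err K * M" .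
    have "a * x \<le> sigma t"
      using sigma_lower[OF t01] t a_pos by (meson mult_left_mono less_imp_le order_trans)
    then have 1: "e t * \<bar>missing K t\<bar> / sigma t \<le> (c * (M * deficit K + M * (real K * surv f lam K)) + err K * M) / (a * x)"
      using num a_pos x by (intro frac_le) (auto intro: order_trans[rotated] simp: e_def)
    have "e t \<le> M / t"
      using et t01 by (simp add: pos_le_divide_eq)
    also have "\<dots> \<le> M / x"
      using M0 t x by (intro divide_left_mono) auto
    finally have 2: "deficit K * e t \<le> deficit K * (M / x)"
      using deficit_nonneg[of K] by (intro mult_left_mono) auto
    have "\<bar>e t * (missing K t / sigma t - deficit K)\<bar> \<le> \<bar>e t * (missing K t / sigma t)\<bar> + \<bar>e t * deficit K\<bar>"
      unfolding right_diff_distrib by (rule abs_triangle_ineq4)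
    also have "\<dots> = e t * \<bar>missing K t\<bar> / sigma t + deficit K * e t"
      using sigma_pos[OF t01] deficit_nonneg[of K] by (simp add: abs_mult e_def)
    also have "\<dots> \<le> B K"
      unfolding B_def using 1 2 by simp
    finally show ?thesis .
  qed
  have "G K y - G K x \<le> B K * (y - x)" for K
    unfolding G_def e_def
    by (rule diff_le_of_deriv_le[OF x(2) scaled_worth_deriv])
       (use x bound in \<open>auto simp: e_def abs_le_iff\<close>)
  moreover have "- G K y - - G K x \<le> B K * (y - x)" for K
    unfolding G_def e_def
    by (rule diff_le_of_deriv_le[OF x(2) DERIV_minus[OF scaled_worth_deriv]])
       (use x bound in \<open>auto simp: e_def abs_le_iff\<close>)
  ultimately have "norm (G K y - G K x) \<le> B K * (y - x)" for K
    by (smt (verit) real_norm_def)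
  then have ev: "eventually (\<lambda>K. norm (G K y - G K x) \<le> B K * (y - x)) sequentially"
    by simp
  have lim: "(\<lambda>K. B K * (y - x)) \<longlonglongrightarrow> ((c * (M * 0 + M * 0) + 0 * M) / (a * x) + 0 * M / x) * (y - x)"
    unfolding B_def
  proof (intro tendsto_intros deficit_tendsto err_lim decseq_summable_times_index surv_decseq)
    show "summable (surv f lam)"
      using surv_sums summable_Suc_iff[of "surv f lam"] by (simp add: sums_iff)
  qed (use pos lam_nonneg surv_pos[of f lam] a_pos x in \<open>auto simp: less_imp_le\<close>)
  have "(\<lambda>K. B K * (y - x)) \<longlonglongrightarrow> 0"
    using lim by simp
  from Lim_null_comparison[OF ev this] show ?thesis
    unfolding G_def e_def .
qed

lemma worth_scaled: "exp (- lam * clock r) * worth K r = (\<Sum>k<K. repro f lam K k * (scaled k r - scaled (Suc k) r))"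
  by (simp add: worth_def scaled_def sum_distrib_left algebra_simps)

text \<open>The maximum principle meets the conservation law. At a moment \<open>x\<close> where the scaled size is within \<open>e\<close> of its supremum
  \<open>M\<close>, every scaled tail is within \<open>e\<close> of \<open>M * surv f lam k\<close>, because the scaled size is the sum of the scaled tails and the
  survival products sum to \<open>1\<close>. Likewise at a moment \<open>y\<close> near the infimum \<open>m\<close>. The discounted reproductive values at \<open>x\<close>
  and \<open>y\<close> agree, and they are nearly \<open>M\<close> and \<open>m\<close> times the same positive constant.\<close>
lemma scaled_constant:
  obtains M where "\<And>r k. 0 < r \<Longrightarrow> r < 1 \<Longrightarrow> scaled k r = M * surv f lam k"
proof -
  obtain B where B: "\<And>r. 0 < r \<Longrightarrow> r < 1 \<Longrightarrow> r * exp (- lam * clock r) \<le> B"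
    using scaled_size_bounded by blast
  define S where "S = scaled 0 ` {0<..<1}"
  have S: "S \<noteq> {}" "bdd_above S" "bdd_below S"
  proof -
    show "S \<noteq> {}" by (simp add: S_def)
    show "bdd_above S"
      unfolding S_def bdd_above_def using B by (auto intro!: exI[of _ B] simp: scaled_def T_0)
    show "bdd_below S"
      unfolding S_def bdd_below_def by (auto intro!: exI[of _ 0] simp: scaled_def T_0)
  qed
  define M m where "M = Sup S" and "m = Inf S"
  have sM: "scaled 0 r \<le> M" and sm: "m \<le> scaled 0 r" if "0 < r" "r < 1" for r
    unfolding M_def m_def using S that by (auto intro!: cSup_upper cInf_lower simp: S_def)
  have m0: "0 \<le> m"
    unfolding m_def using S(1) by (intro cInf_greatest) (auto simp: S_def scaled_def T_0)
  have M0: "0 \<le> M"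
    using m0 sM[of "1/2"] sm[of "1/2"] by simp
  note bnd = scaled_bounds[of m M, OF sm sM]
  have sp: "0 < surv f lam k" for k
    by (rule surv_pos[OF pos lam_nonneg])
  have A: "0 \<le> A"
    using repro_bound[of 0 0] by (simp add: repro_top)
  define p where "p k = surv f lam k - surv f lam (Suc k)" for k
  have p_nonneg: "0 \<le> p k" for k
    using surv_decseq[OF pos lam_nonneg] by (simp add: p_def decseq_Suc_iff)
  \<comment> \<open>\<open>A * M * tail J\<close> bounds the scaled value of all vertices of degree at least \<open>J\<close>\<close>
  define tail where "tail J = (real J + 1) * surv f lam J + deficit J" for J
  have near_max: "M * surv f lam k - scaled k r \<le> e"
    if r: "0 < r" "r < 1" and e: "M - e \<le> scaled 0 r" for r e k
  proof (cases k)
    case (Suc j)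
    have "(\<lambda>k. M * surv f lam (Suc k) - scaled (Suc k) r) sums (M * 1 - scaled 0 r)"
      by (intro sums_diff sums_mult surv_sums scaled_sums r)
    then have "M * surv f lam (Suc j) - scaled (Suc j) r \<le> M * 1 - scaled 0 r"
      using bnd(2)[OF _ _ _ _ r] sum_le_suminf[of "\<lambda>k. M * surv f lam (Suc k) - scaled (Suc k) r" "{j}"]
      by (auto simp: sums_iff)
    then show ?thesis using e Suc by simp
  qed (use e in simp)
  have near_min: "scaled k r - m * surv f lam k \<le> e"
    if r: "0 < r" "r < 1" and e: "scaled 0 r \<le> m + e" for r e k
  proof (cases k)
    case (Suc j)
    have "(\<lambda>k. scaled (Suc k) r - m * surv f lam (Suc k)) sums (scaled 0 r - m * 1)"
      by (intro sums_diff sums_mult surv_sums scaled_sums r)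
    then have "scaled (Suc j) r - m * surv f lam (Suc j) \<le> scaled 0 r - m * 1"
      using bnd(1)[OF _ _ _ _ r] sum_le_suminf[of "\<lambda>k. scaled (Suc k) r - m * surv f lam (Suc k)" "{j}"]
      by (auto simp: sums_iff)
    then show ?thesis using e Suc by simp
  qed (use e in simp)
  have key: "(M - m) * (surv f lam 1 * p 0) \<le> 2 * e * (A * real J * real J) + A * M * tail J"
    if e: "0 < e" and J: "1 \<le> J" for e J
  proof -
    have "M - e < Sup S" "Inf S < m + e"
      using e by (auto simp: M_def m_def)
    then obtain x y where x: "0 < x" "x < 1" "M - e \<le> scaled 0 x" and y: "0 < y" "y < 1" "scaled 0 y \<le> m + e"
      using less_cSup_iff[OF S(1,2), of "M - e"] cInf_less_iff[OF S(1,3), of "m + e"] by (auto simp: S_def less_imp_le)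
    define G where "G K r = exp (- lam * clock r) * worth K r" for K r
    have G_lim: "(\<lambda>K. \<bar>G K x - G K y\<bar>) \<longlonglongrightarrow> 0"
    proof (cases "x \<le> y")
      case True
      have "(\<lambda>K. \<bar>G K y - G K x\<bar>) \<longlonglongrightarrow> 0"
        unfolding G_def by (intro tendsto_rabs_zero worth_conserved[OF sM x(1) True y(2)])
      then show ?thesis by (simp add: abs_minus_commute)
    next
      case False
      then show ?thesis
        unfolding G_def by (intro tendsto_rabs_zero worth_conserved[OF sM y(1) _ x(2)]) auto
    qed
    have main: "(M - m) * (surv f lam 1 * p 0) \<le> 2 * e * (A * real J * real J) + A * M * tail J + \<bar>G K x - G K y\<bar>"
      if K: "J \<le> K" for K
    proof -
      define h where "h = repro f lam K"
      have h0: "0 \<le> h k" for k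
        unfolding h_def by (rule repro_nonneg[OF pos lam_nonneg])
      have hA: "h k \<le> A * (real k + 1)" if "k \<le> K" for k
        unfolding h_def using that by (rule repro_bound)
      have split: "G K r = (\<Sum>k<J. h k * (scaled k r - scaled (Suc k) r)) + (\<Sum>k\<in>{J..<K}. h k * (scaled k r - scaled (Suc k) r))" for r
      proof -
        have "{..<K} = {..<J} \<union> {J..<K}" using K by auto
        then show ?thesis
          unfolding G_def worth_scaled h_def by (simp add: sum.union_disjoint ivl_disj_int)
      qed
      have nn: "0 \<le> scaled k r - scaled (Suc k) r" if "0 < r" "r < 1" for k r
        using T_Suc_le[OF that, of k] by (simp add: scaled_def mult_right_mono)
      have "(\<Sum>k<J. h k * (M * p k - e)) \<le> (\<Sum>k<J. h k * (scaled k x - scaled (Suc k) x))"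
      proof (intro sum_mono mult_left_mono h0)
        fix k
        show "M * p k - e \<le> scaled k x - scaled (Suc k) x"
          using near_max[OF x, of k] bnd(2)[OF _ _ _ _ x(1,2), of "Suc k"] by (simp add: p_def algebra_simps)
      qed
      also have "\<dots> \<le> G K x"
        unfolding split using h0 nn[OF x(1,2)] by (simp add: sum_nonneg)
      finally have lo: "(\<Sum>k<J. h k * (M * p k - e)) \<le> G K x" .
      have up1: "(\<Sum>k<J. h k * (scaled k y - scaled (Suc k) y)) \<le> (\<Sum>k<J. h k * (m * p k + e))"
      proof (intro sum_mono mult_left_mono h0)
        fix k
        show "scaled k y - scaled (Suc k) y \<le> m * p k + e"
          using near_min[OF y, of k] bnd(1)[OF _ _ _ _ y(1,2), of "Suc k"] by (simp add: p_def algebra_simps)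
      qed
      have "(\<Sum>k\<in>{J..<K}. h k * (scaled k y - scaled (Suc k) y))
          \<le> (\<Sum>k\<in>{J..<K}. A * (real k + 1) * (scaled k y - scaled (Suc k) y))"
        using hA nn[OF y(1,2)] by (intro sum_mono mult_right_mono) auto
      also have "\<dots> = A * (\<Sum>k\<in>{J..<K}. (real k + 1) * (scaled k y - scaled (Suc k) y))"
        by (simp add: sum_distrib_left mult.assoc)
      also have "\<dots> \<le> A * ((real J + 1) * scaled J y + (\<Sum>k\<in>{J..<K}. scaled (Suc k) y))"
        using A K T_nonneg[OF y(1,2)] by (intro mult_left_mono sum_linear_weight_diff_le) (auto simp: scaled_def)
      also have "\<dots> \<le> A * ((real J + 1) * (M * surv f lam J) + (\<Sum>k\<in>{J..<K}. M * surv f lam (Suc k)))"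
        using A bnd(2)[OF _ _ _ _ y(1,2)] by (intro mult_left_mono add_mono sum_mono) auto
      also have "\<dots> \<le> A * ((real J + 1) * (M * surv f lam J) + M * deficit J)"
      proof -
        have "{..<K} = {..<J} \<union> {J..<K}" using K by auto
        then have "(\<Sum>k\<in>{J..<K}. surv f lam (Suc k)) = deficit J - deficit K"
          by (simp add: deficit_eq sum.union_disjoint ivl_disj_int)
        then have "(\<Sum>k\<in>{J..<K}. M * surv f lam (Suc k)) \<le> M * deficit J"
          using deficit_nonneg[of K] M0 by (simp add: mult_left_mono flip: sum_distrib_left)
        then show ?thesis using A by (simp add: mult_left_mono)
      qed
      also have "\<dots> = A * M * tail J"
        by (simp add: tail_def algebra_simps)
      finally have up: "G K y \<le> (\<Sum>k<J. h k * (m * p k + e)) + A * M * tail J"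
        unfolding split using up1 by simp
      have "(M - m) * (\<Sum>k<J. h k * p k) - 2 * e * (\<Sum>k<J. h k)
          = (\<Sum>k<J. h k * (M * p k - e)) - (\<Sum>k<J. h k * (m * p k + e))"
        by (simp add: algebra_simps sum.distrib sum_subtractf sum_distrib_left)
      also have "\<dots> \<le> A * M * tail J + \<bar>G K x - G K y\<bar>"
        using lo up by simp
      finally have 1: "(M - m) * (\<Sum>k<J. h k * p k) \<le> 2 * e * (\<Sum>k<J. h k) + A * M * tail J + \<bar>G K x - G K y\<bar>"
        by simp
      have "surv f lam 1 * p 0 \<le> h 0 * p 0"
        using repro_lower[of 0 K] K J p_nonneg by (intro mult_right_mono) (auto simp: h_def)
      also have "\<dots> = (\<Sum>k\<in>{0}. h k * p k)" by simp
      also have "\<dots> \<le> (\<Sum>k<J. h k * p k)"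
        using J h0 p_nonneg by (intro sum_mono2) auto
      finally have 2: "(M - m) * (surv f lam 1 * p 0) \<le> (M - m) * (\<Sum>k<J. h k * p k)"
        using sM[of "1/2"] sm[of "1/2"] by (intro mult_left_mono) auto
      have "(\<Sum>k<J. h k) \<le> (\<Sum>k<J. A * real J)"
      proof (intro sum_mono)
        fix k
        assume k: "k \<in> {..<J}"
        have "h k \<le> A * (real k + 1)" using k K by (intro hA) auto
        also have "\<dots> \<le> A * real J" using k A by (intro mult_left_mono) auto
        finally show "h k \<le> A * real J" .
      qed
      also have "\<dots> = A * real J * real J" by simp
      finally have "2 * e * (\<Sum>k<J. h k) \<le> 2 * e * (A * real J * real J)"
        using e by (intro mult_left_mono) auto
      with 1 2 show ?thesis by linarith
    qed
    have "(\<lambda>K. 2 * e * (A * real J * real J) + A * M * tail J + \<bar>G K x - G K y\<bar>)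
        \<longlonglongrightarrow> 2 * e * (A * real J * real J) + A * M * tail J + 0"
      by (intro tendsto_add tendsto_const G_lim)
    then show ?thesis
      using main by (intro LIMSEQ_le_const[where X = "\<lambda>K. 2 * e * (A * real J * real J) + A * M * tail J + \<bar>G K x - G K y\<bar>"]) auto
  qed
  \<comment> \<open>\<open>e \<rightarrow> 0\<close> for fixed \<open>J\<close>: the moments \<open>x\<close> and \<open>y\<close> depend on \<open>e\<close> but no longer occur\<close>
  have key': "(M - m) * (surv f lam 1 * p 0) \<le> A * M * tail J" if J: "1 \<le> J" for J
  proof (rule tendsto_lowerbound)
    show "((\<lambda>e. 2 * e * (A * real J * real J) + A * M * tail J) \<longlongrightarrow> A * M * tail J) (at_right 0)"
      by (auto intro!: tendsto_eq_intros)
    show "eventually (\<lambda>e. (M - m) * (surv f lam 1 * p 0) \<le> 2 * e * (A * real J * real J) + A * M * tail J) (at_right 0)"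
      using key[OF _ J] by (auto intro: eventually_mono[OF eventually_at_right_less])
  qed auto
  have "tail \<longlonglongrightarrow> 0"
  proof -
    have s: "summable (surv f lam)"
      using surv_sums summable_Suc_iff[of "surv f lam"] by (simp add: sums_iff)
    have 1: "(\<lambda>J. real J * surv f lam J) \<longlonglongrightarrow> 0"
      by (intro decseq_summable_times_index surv_decseq s) (auto simp: pos lam_nonneg less_imp_le[OF sp])
    have "(\<lambda>J. real J * surv f lam J + surv f lam J + deficit J) \<longlonglongrightarrow> 0 + 0 + 0"
      by (rule tendsto_add[OF tendsto_add[OF 1 summable_LIMSEQ_zero[OF s]] deficit_tendsto])
    then show ?thesis by (simp add: tail_def[abs_def] algebra_simps)
  qed
  then have "(\<lambda>J. A * M * tail J) \<longlonglongrightarrow> A * M * 0"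
    by (intro tendsto_mult tendsto_const)
  then have "(M - m) * (surv f lam 1 * p 0) \<le> A * M * 0"
    using key' by (intro LIMSEQ_le_const) auto
  moreover have "0 < p 0"
    using lam_pos pos[of 0] by (simp add: p_def surv_Suc field_simps)
  ultimately have "M \<le> m"
    using sp[of 1] by (simp add: mult_le_0_iff)
  moreover have "m \<le> M"
    using sM[of "1/2"] sm[of "1/2"] by simp
  ultimately have "m = M" by simp
  then show ?thesis
    using bnd by (intro that[of M]) (auto intro: antisym)
qed

theorem flow_unique:
  assumes r: "0 < r" "r < 1"
  shows "T k r = surv f lam k * r"
proof -
  obtain M where M: "\<And>r k. 0 < r \<Longrightarrow> r < 1 \<Longrightarrow> scaled k r = M * surv f lam k"
    using scaled_constant by blast
  have "T k r * exp (- lam * clock r) = surv f lam k * scaled 0 r"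
    using M[OF r, of k] M[OF r, of 0] by (simp add: scaled_def)
  then show ?thesis by (simp add: scaled_def T_0[OF r])
qed

end

section \<open>Degrees along the history of a recursive tree\<close>

text \<open>A recursive tree contains its own history: its restriction to the vertices up to \<open>m\<close> is the tree at time
  \<open>m\<close>. All quantities at time \<open>m\<close> are therefore functions of the final tree.\<close>
definition indeg :: "rtree \<Rightarrow> nat \<Rightarrow> nat \<Rightarrow> nat" where
  "indeg t m v = card {w. w \<le> m \<and> t w = Some v}"

definition tail_count :: "rtree \<Rightarrow> nat \<Rightarrow> nat \<Rightarrow> nat" where
  "tail_count t k m = card {v \<in> {1..m}. k \<le> indeg t m v}"

definition weight :: "(nat \<Rightarrow> real) \<Rightarrow> rtree \<Rightarrow> nat \<Rightarrow> real" where
  "weight f t m = (\<Sum>v\<in>{1..m}. f (indeg t m v))"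

definition rec_tree :: "nat \<Rightarrow> rtree \<Rightarrow> bool" where
  "rec_tree n t \<longleftrightarrow> (\<forall>w. w \<notin> {2..n} \<longrightarrow> t w = None) \<and>
     (\<forall>w\<in>{2..n}. \<exists>v. 1 \<le> v \<and> v < w \<and> t w = Some v)"

lemma rec_tree_parent:
  assumes "rec_tree n t" and "t w = Some v"
  shows "2 \<le> w" and "w \<le> n" and "1 \<le> v" and "v < w"
proof -
  have w: "w \<in> {2..n}"
    using assms by (auto simp: rec_tree_def)
  then show "2 \<le> w" "w \<le> n" by auto
  from w show "1 \<le> v" "v < w"
    using assms by (auto simp: rec_tree_def dest!: bspec[of _ _ w])
qed

lemma finite_children [simp]: "finite {w. w \<le> (m::nat) \<and> t w = Some v}"
  by (rule finite_subset[of _ "{..m}"]) auto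

lemma indeg_Suc: "indeg t (Suc m) v = indeg t m v + (if t (Suc m) = Some v then 1 else 0)"
proof (cases "t (Suc m) = Some v")
  case True
  then have "{w. w \<le> Suc m \<and> t w = Some v} = insert (Suc m) {w. w \<le> m \<and> t w = Some v}"
    by (auto simp: le_Suc_eq)
  then show ?thesis using True by (simp add: indeg_def)
next
  case False
  then have "{w. w \<le> Suc m \<and> t w = Some v} = {w. w \<le> m \<and> t w = Some v}"
    by (auto simp: le_Suc_eq)
  then show ?thesis using False by (simp add: indeg_def)
qed

lemma indeg_future: "rec_tree n t \<Longrightarrow> m \<le> v \<Longrightarrow> indeg t m v = 0"
  unfolding indeg_def by (auto dest: rec_tree_parent)

lemma indeg_update: "m \<le> n \<Longrightarrow> indeg (t(Suc n \<mapsto> v)) m u = indeg t m u"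
  unfolding indeg_def by (intro arg_cong[where f = card]) auto

lemma deg_eq_indeg: "rec_tree n t \<Longrightarrow> deg t v = indeg t n v"
  unfolding deg_def indeg_def by (intro arg_cong[where f = card]) (auto dest: rec_tree_parent)

lemma tail_count_update: "m \<le> n \<Longrightarrow> tail_count (t(Suc n \<mapsto> v)) k m = tail_count t k m"
  by (simp add: tail_count_def indeg_update)

lemma weight_update: "m \<le> n \<Longrightarrow> weight f (t(Suc n \<mapsto> v)) m = weight f t m"
  by (simp add: weight_def indeg_update)

lemma tail_count_0 [simp]: "tail_count t 0 m = m"
proof -
  have "{v \<in> {1..m}. 0 \<le> indeg t m v} = {1..m}" by auto
  then show ?thesis by (simp add: tail_count_def)
qed

lemma tail_count_Suc_le: "tail_count t (Suc k) m \<le> tail_count t k m"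
  unfolding tail_count_def by (intro card_mono) auto

lemma tail_count_diff:
  "real (tail_count t k m) - real (tail_count t (Suc k) m) = real (card {v \<in> {1..m}. indeg t m v = k})"
proof -
  have "{v \<in> {1..m}. k \<le> indeg t m v} = {v \<in> {1..m}. Suc k \<le> indeg t m v} \<union> {v \<in> {1..m}. indeg t m v = k}"
    by auto
  then have "tail_count t k m = tail_count t (Suc k) m + card {v \<in> {1..m}. indeg t m v = k}"
    unfolding tail_count_def by (subst card_Un_disjoint[symmetric]) auto
  then show ?thesis by simp
qed

text \<open>Counting tails instead of degree classes has the advantage that a step changes exactly one tail of positive index, by one.\<close>
lemma tail_count_step:
  assumes t: "rec_tree n t" and p: "t (Suc m) = Some p" and m: "1 \<le> m"
  shows "tail_count t (Suc k) (Suc m) = tail_count t (Suc k) m + (if indeg t m p = k then 1 else 0)"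
proof -
  have pm: "p \<in> {1..m}"
    using rec_tree_parent[OF t p] by auto
  have new: "indeg t (Suc m) (Suc m) = 0"
    using t by (rule indeg_future) simp
  define S where "S = {v \<in> {1..m}. Suc k \<le> indeg t m v}"
  have "{v \<in> {1..Suc m}. Suc k \<le> indeg t (Suc m) v} = (if indeg t m p = k then insert p S else S)"
    using pm new p by (auto simp: S_def indeg_Suc le_Suc_eq not_less_eq_eq split: if_splits)
  moreover have "p \<notin> S" if "indeg t m p = k"
    using that by (simp add: S_def)
  moreover have "finite S" by (simp add: S_def)
  ultimately show ?thesis
    by (simp only: tail_count_def S_def[symmetric]) simp
qed

lemma rec_tree_parent_exists: "rec_tree n t \<Longrightarrow> 1 \<le> m \<Longrightarrow> Suc m \<le> n \<Longrightarrow> \<exists>p. t (Suc m) = Some p"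
  by (auto simp: rec_tree_def dest!: bspec[of _ _ "Suc m"])

lemma tail_count_lipschitz:
  assumes t: "rec_tree n t" and m: "1 \<le> m" "m \<le> m'" "m' \<le> n"
  shows "tail_count t k m \<le> tail_count t k m' \<and> tail_count t k m' \<le> tail_count t k m + (m' - m)"
proof (cases k)
  case 0
  then show ?thesis using m by simp
next
  case (Suc j)
  show ?thesis
    using m(2,3) unfolding Suc
  proof (induction m' rule: dec_induct)
    case (step i)
    then obtain p where "t (Suc i) = Some p"
      using rec_tree_parent_exists[OF t, of i] m by auto
    then show ?case
      using tail_count_step[OF t, of i p j] step m by auto
  qed simp
qed

lemma indeg_sum:
  assumes t: "rec_tree n t" and m: "1 \<le> m" "m \<le> n"
  shows "(\<Sum>v\<in>{1..m}. indeg t m v) = m - 1"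
  using m
proof (induction m rule: dec_induct)
  case base
  then show ?case using indeg_future[OF t, of 1 1] by simp
next
  case (step m)
  then obtain p where p: "t (Suc m) = Some p"
    using rec_tree_parent_exists[OF t, of m] by auto
  have pm: "p \<in> {1..m}"
    using rec_tree_parent[OF t p] by auto
  have "(\<Sum>v\<in>{1..Suc m}. indeg t (Suc m) v) = (\<Sum>v\<in>{1..m}. indeg t m v + (if v = p then 1 else 0))"
    using p indeg_future[OF t, of "Suc m" "Suc m"] by (auto simp: indeg_Suc intro!: sum.cong)
  also have "\<dots> = (m - 1) + 1"
    using pm step by (simp add: sum.distrib)
  finally show ?case using step by simp
qed

lemma sum_tail_count_le:
  assumes t: "rec_tree n t" and m: "1 \<le> m" "m \<le> n"
  shows "(\<Sum>k<K. tail_count t (Suc k) m) \<le> m"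
proof -
  have "(\<Sum>k<K. tail_count t (Suc k) m) = (\<Sum>k<K. \<Sum>v\<in>{1..m}. if Suc k \<le> indeg t m v then 1 else 0)"
    unfolding tail_count_def by (simp add: sum.If_cases Int_def)
  also have "\<dots> = (\<Sum>v\<in>{1..m}. \<Sum>k<K. if Suc k \<le> indeg t m v then 1 else 0)"
    by (rule sum.swap)
  also have "\<dots> \<le> (\<Sum>v\<in>{1..m}. indeg t m v)"
  proof (rule sum_mono)
    fix v
    have "(\<Sum>k<K. if Suc k \<le> indeg t m v then 1 else 0) = card {k. k < K \<and> Suc k \<le> indeg t m v}"
      by (simp add: sum.If_cases Int_def lessThan_def)
    also have "\<dots> \<le> card {..<indeg t m v}"
      by (rule card_mono) auto
    finally show "(\<Sum>k<K. if Suc k \<le> indeg t m v then 1 else 0) \<le> indeg t m v" by simp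
  qed
  finally show ?thesis
    using indeg_sum[OF assms] by simp
qed

text \<open>Sums over degree classes and sums over vertices are exchanged here; the truncation at \<open>K\<close> discards the
  vertices of degree at least \<open>K\<close>.\<close>
lemma sum_degree_classes:
  fixes g :: "nat \<Rightarrow> real"
  shows "(\<Sum>k<K. g k * (real (tail_count t k m) - real (tail_count t (Suc k) m)))
       = (\<Sum>v\<in>{1..m}. if indeg t m v < K then g (indeg t m v) else 0)"
proof -
  have "(\<Sum>k<K. g k * (real (tail_count t k m) - real (tail_count t (Suc k) m)))
      = (\<Sum>k<K. \<Sum>v\<in>{1..m}. if indeg t m v = k then g k else 0)"
    unfolding tail_count_diff by (simp add: sum.If_cases Int_def mult.commute)
  also have "\<dots> = (\<Sum>v\<in>{1..m}. \<Sum>k<K. if indeg t m v = k then g k else 0)"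
    by (rule sum.swap)
  also have "\<dots> = (\<Sum>v\<in>{1..m}. if indeg t m v < K then g (indeg t m v) else 0)"
    by (intro sum.cong) auto
  finally show ?thesis .
qed

text \<open>The linear part of \<open>f\<close> contributes \<open>c\<close> times the total degree, which is the deterministic number \<open>m - 1\<close>.
  The rest is sublinear, so vertices of degree at least \<open>K\<close> contribute little of it.\<close>
lemma weight_approx:
  assumes t: "rec_tree n t" and m: "1 \<le> m" "m \<le> n" and eps: "0 \<le> eps"
    and g: "\<And>k. K \<le> k \<Longrightarrow> \<bar>f k - c * real k\<bar> \<le> eps * (real k + 1)"
  shows "\<bar>weight f t m - (c * (real m - 1) +
    (\<Sum>k<K. (f k - c * real k) * (real (tail_count t k m) - real (tail_count t (Suc k) m))))\<bar> \<le> 2 * eps * real m"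
proof -
  define d where "d = indeg t m"
  have tot: "real m - 1 = (\<Sum>v\<in>{1..m}. real (d v))"
    using indeg_sum[OF t m] m by (simp add: d_def of_nat_diff flip: of_nat_sum)
  have "weight f t m - (c * (real m - 1) +
    (\<Sum>k<K. (f k - c * real k) * (real (tail_count t k m) - real (tail_count t (Suc k) m))))
    = (\<Sum>v\<in>{1..m}. f (d v) - (c * real (d v) + (if d v < K then f (d v) - c * real (d v) else 0)))"
    unfolding sum_degree_classes tot d_def[symmetric]
    by (simp add: weight_def d_def sum_subtractf sum.distrib sum_distrib_left)
  also have "\<bar>\<dots>\<bar> \<le> (\<Sum>v\<in>{1..m}. \<bar>f (d v) - (c * real (d v) + (if d v < K then f (d v) - c * real (d v) else 0))\<bar>)"
    by (rule sum_abs)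
  also have "\<dots> \<le> (\<Sum>v\<in>{1..m}. eps * (real (d v) + 1))"
  proof (rule sum_mono)
    fix v
    show "\<bar>f (d v) - (c * real (d v) + (if d v < K then f (d v) - c * real (d v) else 0))\<bar> \<le> eps * (real (d v) + 1)"
      using g[of "d v"] eps by auto
  qed
  also have "\<dots> = eps * ((real m - 1) + real m)"
    by (simp add: tot sum_distrib_left[symmetric] sum.distrib)
  also have "\<dots> \<le> eps * (real m + real m)"
    using eps by (intro mult_left_mono) auto
  finally show ?thesis by simp
qed

lemma weight_upper:
  assumes t: "rec_tree n t" and m: "1 \<le> m" "m \<le> n" and C: "0 \<le> C" "\<And>k. f k \<le> C * (real k + 1)"
  shows "weight f t m \<le> 2 * C * real m"
proof -
  have "weight f t m \<le> (\<Sum>v\<in>{1..m}. C * (real (indeg t m v) + 1))"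
    unfolding weight_def by (intro sum_mono C)
  also have "\<dots> = C * (real (\<Sum>v\<in>{1..m}. indeg t m v) + real m)"
    by (simp add: sum_distrib_left[symmetric] sum.distrib)
  also have "\<dots> \<le> C * (real m + real m)"
    unfolding indeg_sum[OF t m] using C by (intro mult_left_mono) auto
  finally show ?thesis by simp
qed

text \<open>At least half of the vertices have at most one child.\<close>
lemma weight_lower:
  assumes t: "rec_tree n t" and m: "1 \<le> m" "m \<le> n" and pos: "\<And>k. 0 < f k"
  shows "min (f 0) (f 1) / 2 * real m \<le> weight f t m"
proof -
  define q where "q = min (f 0) (f 1)"
  have q: "0 \<le> q" using pos[of 0] pos[of 1] by (simp add: q_def)
  have "tail_count t (Suc 0) m + tail_count t (Suc 1) m \<le> m"
    using sum_tail_count_le[OF t m, of 2] by (simp add: eval_nat_numeral)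
  then have half: "real m / 2 \<le> real m - real (tail_count t 2 m)"
    using tail_count_Suc_le[of t 1 m] by (simp add: eval_nat_numeral)
  have "q * (real m / 2) \<le> q * (real m - real (tail_count t 2 m))"
    using half q by (rule mult_left_mono)
  also have "\<dots> = (\<Sum>k<2. q * (real (tail_count t k m) - real (tail_count t (Suc k) m)))"
    by (simp add: eval_nat_numeral algebra_simps)
  also have "\<dots> = (\<Sum>v\<in>{1..m}. if indeg t m v < 2 then q else 0)"
    by (rule sum_degree_classes)
  also have "\<dots> \<le> weight f t m"
    unfolding weight_def
  proof (rule sum_mono)
    fix v
    have "indeg t m v < 2 \<Longrightarrow> indeg t m v = 0 \<or> indeg t m v = 1" by linarith
    then show "(if indeg t m v < 2 then q else 0) \<le> f (indeg t m v)"
      using pos[of "indeg t m v"] by (auto simp: q_def)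
  qed
  finally show ?thesis by (simp add: q_def)
qed

lemma set_pmf_choose_parent:
  assumes "attachment_function f" and "1 \<le> m"
  shows "set_pmf (choose_parent f m t) \<subseteq> {1..m}"
  using assms by (auto simp: set_pmf_iff pmf_choose_parent split: if_splits)

lemma rec_tree_extend:
  assumes t: "rec_tree (Suc m) t" and v: "v \<in> {1..Suc m}"
  shows "rec_tree (Suc (Suc m)) (t(Suc (Suc m) \<mapsto> v))"
  unfolding rec_tree_def
proof (intro conjI allI impI ballI)
  fix w
  assume "w \<notin> {2..Suc (Suc m)}"
  then show "(t(Suc (Suc m) \<mapsto> v)) w = None"
    using t by (auto simp: rec_tree_def)
next
  fix w
  assume w: "w \<in> {2..Suc (Suc m)}"
  show "\<exists>u. 1 \<le> u \<and> u < w \<and> (t(Suc (Suc m) \<mapsto> v)) w = Some u"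
  proof (cases "w = Suc (Suc m)")
    case True
    then show ?thesis using v by auto
  next
    case False
    then have "w \<in> {2..Suc m}" using w by auto
    then show ?thesis using t False by (auto simp: rec_tree_def)
  qed
qed

lemma change_point_tree_rec_tree:
  assumes f: "attachment_function f0" "attachment_function f1"
    and t: "t \<in> set_pmf (change_point_tree f0 f1 tau n)" and n: "1 \<le> n"
  shows "rec_tree n t"
  using n t
proof (induction n arbitrary: t rule: dec_induct)
  case base
  then show ?case by (auto simp: rec_tree_def)
next
  case (step n)
  then obtain m where m: "n = Suc m" by (cases n) auto
  have att: "attachment_function (if Suc (Suc m) \<le> tau then f0 else f1)"
    using f by simp
  obtain s v where s: "s \<in> set_pmf (change_point_tree f0 f1 tau (Suc m))"
      "v \<in> set_pmf (choose_parent (if Suc (Suc m) \<le> tau then f0 else f1) (Suc m) s)"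
      "t = s(Suc (Suc m) \<mapsto> v)"
    using step.prems unfolding m by auto
  show ?case
    unfolding m s(3) using step.IH s set_pmf_choose_parent[OF att, of "Suc m" s]
    by (intro rec_tree_extend) (auto simp: m)
qed

section \<open>Exponential bounds for the martingale part\<close>

text \<open>The martingale part of the tail count with index \<open>Suc k\<close> between the change point \<open>tau\<close> and time \<open>m\<close>: increments minus
  conditional probabilities of an increment.\<close>
definition noise :: "(nat \<Rightarrow> real) \<Rightarrow> rtree \<Rightarrow> nat \<Rightarrow> nat \<Rightarrow> nat \<Rightarrow> real" where
  "noise f t k tau m = real (tail_count t (Suc k) m) - real (tail_count t (Suc k) tau)
     - (\<Sum>l\<in>{tau..<m}. f k * (real (tail_count t k l) - real (tail_count t (Suc k) l)) / weight f t l)"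

lemma noise_update: "tau \<le> m \<Longrightarrow> m \<le> n \<Longrightarrow> noise f (t(Suc n \<mapsto> v)) k tau m = noise f t k tau m"
  by (simp add: noise_def tail_count_update weight_update)

lemma exp_le_quadratic:
  fixes x :: real
  assumes "\<bar>x\<bar> \<le> 1"
  shows "exp x \<le> 1 + x + x\<^sup>2"
proof (cases "0 \<le> x")
  case True
  then show ?thesis using assms by (intro exp_bound) auto
next
  case False
  define y where "y = - x"
  have y: "0 \<le> y" using False by (simp add: y_def)
  have "1 \<le> (1 - y + y\<^sup>2) * (1 + y)"
    using y by (simp add: algebra_simps power2_eq_square)
  also have "\<dots> \<le> (1 - y + y\<^sup>2) * exp y"
  proof (rule mult_left_mono[OF exp_ge_add_one_self])
    have "0 \<le> (y - 1 / 2)\<^sup>2" by simp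
    then show "0 \<le> 1 - y + y\<^sup>2" by (simp add: power2_eq_square algebra_simps)
  qed
  finally have "exp (- y) \<le> 1 - y + y\<^sup>2"
    by (simp add: exp_minus field_simps)
  then show ?thesis by (simp add: y_def)
qed

text \<open>The second-order bound \<open>exp x \<le> 1 + x + x\<^sup>2\<close> suffices, as the linear term has mean \<open>0\<close>.\<close>
lemma centered_indicator_exp_moment:
  fixes M :: "'a pmf"
  assumes theta: "\<bar>\<theta>\<bar> \<le> 1"
  shows "(\<integral>\<^sup>+ x. ennreal (exp (\<theta> * (indicator B x - measure_pmf.prob M B))) \<partial>M) \<le> ennreal (exp (\<theta>\<^sup>2))"
proof -
  define p where "p = measure_pmf.prob M B"
  define u where "u x = 1 + \<theta> * (indicator B x - p) + \<theta>\<^sup>2" for x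
  have p: "0 \<le> p" "p \<le> 1" by (auto simp: p_def)
  have le: "exp (\<theta> * (indicator B x - p)) \<le> u x" for x
  proof -
    have 1: "\<bar>indicator B x - p\<bar> \<le> 1"
      using p by (auto simp: indicator_def)
    then have "\<bar>\<theta>\<bar> * \<bar>indicator B x - p\<bar> \<le> 1 * 1"
      using theta by (intro mult_mono) auto
    then have "exp (\<theta> * (indicator B x - p)) \<le> 1 + \<theta> * (indicator B x - p) + (\<theta> * (indicator B x - p))\<^sup>2"
      by (intro exp_le_quadratic) (simp add: abs_mult)
    also have "(\<theta> * (indicator B x - p))\<^sup>2 \<le> \<theta>\<^sup>2 * 1"
      unfolding power_mult_distrib using 1 by (intro mult_left_mono) (auto simp: abs_square_le_1)
    finally show ?thesis by (simp add: u_def)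
  qed
  have int: "integrable (measure_pmf M) (\<lambda>x. indicator B x :: real)"
    by (intro measure_pmf.integrable_const_bound[where B = 1]) (auto simp: indicator_def)
  have intu: "integrable (measure_pmf M) u"
    unfolding u_def using int by auto
  have u0: "0 \<le> u x" for x
    using le[of x] by (meson exp_ge_zero order_trans)
  have "(\<integral>\<^sup>+ x. ennreal (exp (\<theta> * (indicator B x - p))) \<partial>M) \<le> (\<integral>\<^sup>+ x. ennreal (u x) \<partial>M)"
    by (intro nn_integral_mono ennreal_leI le)
  also have "\<dots> = ennreal (measure_pmf.expectation M u)"
    using intu u0 by (intro nn_integral_eq_integral) auto
  also have "measure_pmf.expectation M u = 1 + \<theta>\<^sup>2"
    unfolding u_def using int by (simp add: p_def algebra_simps)
  also have "ennreal (1 + \<theta>\<^sup>2) \<le> ennreal (exp (\<theta>\<^sup>2))"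
    by (intro ennreal_leI) simp
  finally show ?thesis by (simp add: p_def)
qed

lemma prob_choose_degree:
  assumes f: "attachment_function f" and m: "1 \<le> m" and t: "rec_tree m t"
  shows "measure_pmf.prob (choose_parent f m t) {v. indeg t m v = k}
    = f k * (real (tail_count t k m) - real (tail_count t (Suc k) m)) / weight f t m"
proof -
  have "measure_pmf.prob (choose_parent f m t) {v. indeg t m v = k}
      = measure_pmf.prob (choose_parent f m t) ({v. indeg t m v = k} \<inter> {1..m})"
    using set_pmf_choose_parent[OF f m, of t]
    by (subst measure_Int_set_pmf[symmetric], subst (2) measure_Int_set_pmf[symmetric])
       (intro arg_cong[where f = "measure_pmf.prob _"], auto)
  also have "\<dots> = (\<Sum>v\<in>{v. indeg t m v = k} \<inter> {1..m}. f k / weight f t m)"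
    by (subst measure_measure_pmf_finite)
       (auto simp: pmf_choose_parent[OF f m] deg_eq_indeg[OF t] weight_def intro!: sum.cong)
  also have "{v. indeg t m v = k} \<inter> {1..m} = {v \<in> {1..m}. indeg t m v = k}" by auto
  finally show ?thesis
    by (simp add: tail_count_diff)
qed

text \<open>Each step multiplies the exponential moment by at most \<open>exp (\<theta>\<^sup>2)\<close>, by conditioning on the tree before the
  step.\<close>
lemma noise_exp_moment_now:
  assumes f: "attachment_function f0" "attachment_function f1"
    and tau: "1 \<le> tau" "tau \<le> m" and theta: "\<bar>\<theta>\<bar> \<le> 1"
  shows "(\<integral>\<^sup>+ t. ennreal (exp (\<theta> * noise f1 t k tau m)) \<partial>change_point_tree f0 f1 tau m)
    \<le> ennreal (exp (\<theta>\<^sup>2 * real (m - tau)))"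
  using tau(2)
proof (induction m rule: dec_induct)
  case base
  then show ?case by (simp add: noise_def)
next
  case (step m)
  then obtain i where i: "m = Suc i" using tau by (cases m) auto
  define X where "X t = noise f1 t k tau m" for t
  have inner: "(\<integral>\<^sup>+ v. ennreal (exp (\<theta> * noise f1 (t(Suc m \<mapsto> v)) k tau (Suc m))) \<partial>choose_parent f1 m t)
      \<le> ennreal (exp (\<theta> * X t)) * ennreal (exp (\<theta>\<^sup>2))"
    if t: "rec_tree m t" for t
  proof -
    define B where "B = {v. indeg t m v = k}"
    define p where "p = measure_pmf.prob (choose_parent f1 m t) B"
    have noise_new: "noise f1 (t(Suc m \<mapsto> v)) k tau (Suc m) = X t + (indicator B v - p)"
      if v: "v \<in> {1..m}" for v
    proof -
      have t': "rec_tree (Suc m) (t(Suc m \<mapsto> v))"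
        using rec_tree_extend[of i t v] t v by (simp add: i)
      have "noise f1 (t(Suc m \<mapsto> v)) k tau (Suc m) = noise f1 (t(Suc m \<mapsto> v)) k tau m
          + (if indeg t m v = k then 1 else 0) - p"
        using tail_count_step[OF t', of m v k] step.hyps i prob_choose_degree[OF f(2) _ t, of k]
        by (simp add: noise_def tail_count_update weight_update indeg_update p_def B_def)
      then show ?thesis
        using step.hyps by (simp add: noise_update X_def B_def indicator_def)
    qed
    have "(\<integral>\<^sup>+ v. ennreal (exp (\<theta> * noise f1 (t(Suc m \<mapsto> v)) k tau (Suc m))) \<partial>choose_parent f1 m t)
        = (\<integral>\<^sup>+ v. ennreal (exp (\<theta> * X t)) * ennreal (exp (\<theta> * (indicator B v - p))) \<partial>choose_parent f1 m t)"
    proof (rule nn_integral_cong_AE, unfold AE_measure_pmf_iff, rule ballI)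
      fix v
      assume "v \<in> set_pmf (choose_parent f1 m t)"
      then have "v \<in> {1..m}"
        using set_pmf_choose_parent[OF f(2), of m t] i by auto
      then show "ennreal (exp (\<theta> * noise f1 (t(Suc m \<mapsto> v)) k tau (Suc m)))
          = ennreal (exp (\<theta> * X t)) * ennreal (exp (\<theta> * (indicator B v - p)))"
        by (simp add: noise_new distrib_left exp_add ennreal_mult)
    qed
    also have "\<dots> = ennreal (exp (\<theta> * X t)) * (\<integral>\<^sup>+ v. ennreal (exp (\<theta> * (indicator B v - p))) \<partial>choose_parent f1 m t)"
      by (intro nn_integral_cmult) auto
    also have "\<dots> \<le> ennreal (exp (\<theta> * X t)) * ennreal (exp (\<theta>\<^sup>2))"
      unfolding p_def by (intro mult_left_mono centered_indicator_exp_moment theta) auto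
    finally show ?thesis .
  qed
  have "(\<integral>\<^sup>+ t. ennreal (exp (\<theta> * noise f1 t k tau (Suc m))) \<partial>change_point_tree f0 f1 tau (Suc m))
      = (\<integral>\<^sup>+ t. \<integral>\<^sup>+ v. ennreal (exp (\<theta> * noise f1 (t(Suc m \<mapsto> v)) k tau (Suc m)))
          \<partial>choose_parent f1 m t \<partial>change_point_tree f0 f1 tau m)"
    using step.hyps by (simp add: i)
  also have "\<dots> \<le> (\<integral>\<^sup>+ t. ennreal (exp (\<theta> * X t)) * ennreal (exp (\<theta>\<^sup>2)) \<partial>change_point_tree f0 f1 tau m)"
    using inner change_point_tree_rec_tree[OF f, of _ tau m] i
    by (intro nn_integral_mono_AE) (auto simp: AE_measure_pmf_iff)
  also have "\<dots> = (\<integral>\<^sup>+ t. ennreal (exp (\<theta> * X t)) \<partial>change_point_tree f0 f1 tau m) * ennreal (exp (\<theta>\<^sup>2))"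
    by (intro nn_integral_multc) auto
  also have "\<dots> \<le> ennreal (exp (\<theta>\<^sup>2 * real (m - tau))) * ennreal (exp (\<theta>\<^sup>2))"
    unfolding X_def by (intro mult_right_mono step.IH) auto
  also have "\<dots> = ennreal (exp (\<theta>\<^sup>2 * real (Suc m - tau)))"
    using step.hyps by (simp add: Suc_diff_le distrib_left exp_add ennreal_mult mult.commute)
  finally show ?case .
qed

text \<open>Later steps do not alter the history up to time \<open>m\<close>.\<close>
lemma noise_exp_moment:
  assumes f: "attachment_function f0" "attachment_function f1"
    and tau: "1 \<le> tau" "tau \<le> m" and n: "m \<le> n" and theta: "\<bar>\<theta>\<bar> \<le> 1"
  shows "(\<integral>\<^sup>+ t. ennreal (exp (\<theta> * noise f1 t k tau m)) \<partial>change_point_tree f0 f1 tau n)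
    \<le> ennreal (exp (\<theta>\<^sup>2 * real (m - tau)))"
  using n
proof (induction n rule: dec_induct)
  case base
  then show ?case using noise_exp_moment_now[OF f tau theta] .
next
  case (step n)
  then obtain i where "n = Suc i" using tau by (cases n) auto
  then show ?case
    using step tau by (simp add: noise_update)
qed

lemma pmf_chernoff:
  fixes M :: "'a pmf"
  assumes mom: "(\<integral>\<^sup>+ x. ennreal (exp (\<theta> * X x)) \<partial>M) \<le> ennreal Q" and Q: "0 \<le> Q"
    and A: "\<And>x. x \<in> A \<Longrightarrow> s \<le> \<theta> * X x"
  shows "measure_pmf.prob M A \<le> exp (- s) * Q"
proof -
  have "emeasure (measure_pmf M) A = (\<integral>\<^sup>+ x. indicator A x \<partial>M)"
    by simp
  also have "\<dots> \<le> (\<integral>\<^sup>+ x. ennreal (exp (- s)) * ennreal (exp (\<theta> * X x)) \<partial>M)"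
  proof (rule nn_integral_mono)
    fix x
    show "indicator A x \<le> ennreal (exp (- s)) * ennreal (exp (\<theta> * X x))"
    proof (cases "x \<in> A")
      case True
      have "ennreal 1 \<le> ennreal (exp (- s) * exp (\<theta> * X x))"
        using A[OF True] by (intro ennreal_leI) (simp flip: exp_add)
      then show ?thesis using True by (simp add: ennreal_mult)
    qed simp
  qed
  also have "\<dots> = ennreal (exp (- s)) * (\<integral>\<^sup>+ x. ennreal (exp (\<theta> * X x)) \<partial>M)"
    by (intro nn_integral_cmult) auto
  also have "\<dots> \<le> ennreal (exp (- s)) * ennreal Q"
    by (intro mult_left_mono mom) auto
  finally have "ennreal (measure_pmf.prob M A) \<le> ennreal (exp (- s) * Q)"
    by (simp add: measure_pmf.emeasure_eq_measure ennreal_mult Q)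
  then show ?thesis
    using Q by (subst (asm) ennreal_le_iff) auto
qed

text \<open>Chernoff's bound with \<open>\<theta> = eta / 2\<close> and with \<open>\<theta> = - eta / 2\<close>.\<close>
lemma noise_tail:
  assumes f: "attachment_function f0" "attachment_function f1"
    and tau: "1 \<le> tau" "tau \<le> m" and n: "m \<le> n" and eta: "0 < eta" "eta \<le> 1"
  shows "measure_pmf.prob (change_point_tree f0 f1 tau n) {t. eta * real n < \<bar>noise f1 t k tau m\<bar>}
    \<le> 2 * exp (- (eta\<^sup>2 * real n / 4))"
proof -
  define M where "M = change_point_tree f0 f1 tau n"
  have one: "measure_pmf.prob M {t. eta * real n < sg * noise f1 t k tau m} \<le> exp (- (eta\<^sup>2 * real n / 4))"
    if sg: "\<bar>sg\<bar> = 1" for sg :: real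
  proof -
    have sg2: "sg\<^sup>2 = 1" using sg by (metis abs_1 power2_abs power_one)
    have "measure_pmf.prob M {t. eta * real n < sg * noise f1 t k tau m}
        \<le> exp (- (eta\<^sup>2 * real n / 2)) * exp ((eta / 2 * sg)\<^sup>2 * real (m - tau))"
    proof (rule pmf_chernoff)
      show "(\<integral>\<^sup>+ t. ennreal (exp (eta / 2 * sg * noise f1 t k tau m)) \<partial>M)
          \<le> ennreal (exp ((eta / 2 * sg)\<^sup>2 * real (m - tau)))"
        unfolding M_def using eta sg by (intro noise_exp_moment[OF f tau n]) (simp add: abs_mult)
    next
      fix t
      assume "t \<in> {t. eta * real n < sg * noise f1 t k tau m}"
      then have "eta / 2 * (eta * real n) \<le> eta / 2 * (sg * noise f1 t k tau m)"
        using eta by (intro mult_left_mono) auto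
      then show "eta\<^sup>2 * real n / 2 \<le> eta / 2 * sg * noise f1 t k tau m"
        by (simp add: power2_eq_square mult_ac)
    qed simp
    also have "\<dots> = exp (- (eta\<^sup>2 * real n / 2) + eta\<^sup>2 / 4 * real (m - tau))"
      by (simp add: sg2 power_mult_distrib power_divide flip: exp_add)
    also have "\<dots> \<le> exp (- (eta\<^sup>2 * real n / 4))"
    proof -
      have "eta\<^sup>2 / 4 * real (m - tau) \<le> eta\<^sup>2 / 4 * real n"
        using n by (intro mult_left_mono) auto
      then show ?thesis by simp
    qed
    finally show ?thesis .
  qed
  have "{t. eta * real n < \<bar>noise f1 t k tau m\<bar>}
      = {t. eta * real n < 1 * noise f1 t k tau m} \<union> {t. eta * real n < - 1 * noise f1 t k tau m}"
    by auto
  then have "measure_pmf.prob M {t. eta * real n < \<bar>noise f1 t k tau m\<bar>}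
      \<le> measure_pmf.prob M {t. eta * real n < 1 * noise f1 t k tau m}
        + measure_pmf.prob M {t. eta * real n < - 1 * noise f1 t k tau m}"
    by (simp only:) (rule measure_subadditive, auto)
  also have "\<dots> \<le> exp (- (eta\<^sup>2 * real n / 4)) + exp (- (eta\<^sup>2 * real n / 4))"
    by (intro add_mono one) auto
  finally show ?thesis by (simp add: M_def)
qed

lemma noise_uniform_tail:
  assumes f: "attachment_function f0" "attachment_function f1"
    and tau: "1 \<le> tau" and eta: "0 < eta" "eta \<le> 1"
  shows "measure_pmf.prob (change_point_tree f0 f1 tau n)
      {t. \<exists>k<J. \<exists>m\<in>{tau..n}. eta * real n < \<bar>noise f1 t k tau m\<bar>}
    \<le> 2 * real J * (real n + 1) * exp (- (eta\<^sup>2 * real n / 4))"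
proof -
  define M where "M = change_point_tree f0 f1 tau n"
  define E where "E = (\<lambda>(k, m). {t. eta * real n < \<bar>noise f1 t k tau m\<bar>})"
  define I where "I = {..<J} \<times> {tau..n}"
  have "{t. \<exists>k<J. \<exists>m\<in>{tau..n}. eta * real n < \<bar>noise f1 t k tau m\<bar>} = (\<Union>i\<in>I. E i)"
    by (auto simp: I_def E_def)
  also have "measure_pmf.prob M \<dots> \<le> (\<Sum>i\<in>I. measure_pmf.prob M (E i))"
    by (intro measure_pmf.finite_measure_subadditive_finite) (auto simp: I_def)
  also have "\<dots> \<le> (\<Sum>i\<in>I. 2 * exp (- (eta\<^sup>2 * real n / 4)))"
    using noise_tail[OF f tau _ _ eta] by (intro sum_mono) (auto simp: I_def E_def M_def)
  also have "\<dots> = real (J * (Suc n - tau)) * (2 * exp (- (eta\<^sup>2 * real n / 4)))"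
    by (simp add: I_def)
  also have "\<dots> \<le> (real J * (real n + 1)) * (2 * exp (- (eta\<^sup>2 * real n / 4)))"
    by (intro mult_right_mono) (auto intro!: mult_left_mono)
  finally show ?thesis by (simp only: M_def mult_ac)
qed

section \<open>Scaling limits of trees with small martingale part\<close>

text \<open>Tychonoff's theorem in place of a diagonal argument. The limits exist for uncountably many sequences at once, so
  limits at all real times are available without any continuity argument.\<close>
lemma common_limit_filter_bounded:
  fixes X :: "'i \<Rightarrow> nat \<Rightarrow> real"
  assumes bound: "\<And>i j. \<bar>X i j\<bar> \<le> B i"
  obtains G where "G \<noteq> bot" "G \<le> sequentially" "\<And>i. \<exists>l. (X i \<longlongrightarrow> l) G"
proof -
  define Y where "Y j = (\<lambda>i. X i j)" for j
  define F where "F = filtermap Y sequentially"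
  define U where "U = (\<Pi>\<^sub>E i\<in>UNIV. {- B i..B i})"
  have "compactin (product_topology (\<lambda>i. euclidean) UNIV) U"
    unfolding U_def compactin_PiE by simp
  then have "compact U"
    by (simp add: euclidean_product_topology)
  moreover have "eventually (\<lambda>y. y \<in> U) F"
    using bound by (auto simp: F_def eventually_filtermap U_def Y_def PiE_iff abs_le_iff minus_le_iff)
  moreover have "F \<noteq> bot"
    by (simp add: F_def filtermap_bot_iff)
  ultimately obtain x where x: "inf (nhds x) F \<noteq> bot"
    unfolding compact_filter by blast
  define G where "G = inf sequentially (filtercomap Y (nhds x))"
  have "G \<noteq> bot"
  proof
    assume "G = bot"
    then have "eventually (\<lambda>_. False) G" by simp
    then obtain P Q where P: "eventually P sequentially" and Q: "eventually Q (filtercomap Y (nhds x))"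
        and PQ: "\<And>j. P j \<Longrightarrow> Q j \<Longrightarrow> False"
      unfolding G_def eventually_inf by blast
    obtain R where R: "eventually R (nhds x)" "\<And>j. R (Y j) \<Longrightarrow> Q j"
      using Q by (auto simp: eventually_filtercomap)
    have "eventually (\<lambda>y. \<not> R y) F"
      unfolding F_def eventually_filtermap using P by (rule eventually_mono) (use PQ R in blast)
    then have "eventually (\<lambda>_. False) (inf (nhds x) F)"
      unfolding eventually_inf using R(1) by blast
    then show False using x by (simp add: trivial_limit_def)
  qed
  moreover have "G \<le> sequentially" by (simp add: G_def)
  moreover have "(X i \<longlongrightarrow> x i) G" for i
  proof -
    have "filterlim Y (nhds x) G"
      unfolding filterlim_iff_le_filtercomap G_def by simp
    moreover have "((\<lambda>y. y i) \<longlongrightarrow> x i) (nhds x)"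
    proof -
      have "((\<lambda>y::'i \<Rightarrow> real. y i) \<longlongrightarrow> x i) (at x)"
        using continuous_on_product_coordinates[of i] unfolding continuous_on_def by auto
      then show ?thesis
        by (simp add: tendsto_at_iff_tendsto_nhds[of "\<lambda>y. y i"])
    qed
    ultimately have "((\<lambda>j. Y j i) \<longlongrightarrow> x i) G"
      by (rule filterlim_compose[rotated])
    then show ?thesis by (simp add: Y_def)
  qed
  ultimately show ?thesis using that by blast
qed

lemma common_limit_filter:
  fixes X :: "'i \<Rightarrow> nat \<Rightarrow> real"
  assumes bound: "\<And>i. \<exists>B. eventually (\<lambda>j. \<bar>X i j\<bar> \<le> B) sequentially"
  obtains G where "G \<noteq> bot" "G \<le> sequentially" "\<And>i. \<exists>l. (X i \<longlongrightarrow> l) G"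
proof -
  obtain B where B: "\<And>i. eventually (\<lambda>j. \<bar>X i j\<bar> \<le> B i) sequentially"
    using bound by metis
  define Y where "Y i j = (if \<bar>X i j\<bar> \<le> B i then X i j else 0)" for i j
  have "\<bar>Y i j\<bar> \<le> \<bar>B i\<bar>" for i j
    by (auto simp: Y_def)
  then obtain G where G: "G \<noteq> bot" "G \<le> sequentially" "\<And>i. \<exists>l. (Y i \<longlongrightarrow> l) G"
    using common_limit_filter_bounded[of Y "\<lambda>i. \<bar>B i\<bar>"] by blast
  have "\<exists>l. (X i \<longlongrightarrow> l) G" for i
  proof -
    have "eventually (\<lambda>j. Y i j = X i j) G"
      using filter_leD[OF G(2) B[of i]] by (rule eventually_mono) (simp add: Y_def)
    then show ?thesis
      using G(3)[of i] by (auto cong: tendsto_cong)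
  qed
  then show ?thesis using G that by blast
qed

lemma tail_sup_vanishing:
  fixes x :: "nat \<Rightarrow> real"
  assumes "x \<longlonglongrightarrow> 0"
  obtains e where "e \<longlonglongrightarrow> 0" "\<And>K k. K \<le> k \<Longrightarrow> \<bar>x k\<bar> \<le> e K"
proof -
  define e where "e K = (SUP k\<in>{K..}. \<bar>x k\<bar>)" for K
  have bdd: "bdd_above ((\<lambda>k. \<bar>x k\<bar>) ` {K..})" for K
  proof -
    obtain B where "\<And>k. \<bar>x k\<bar> \<le> B"
      using convergent_imp_Bseq[OF convergentI[OF assms]] by (auto simp: Bseq_def)
    then show ?thesis by (auto simp: bdd_above_def)
  qed
  have le: "\<bar>x k\<bar> \<le> e K" if "K \<le> k" for K k
    unfolding e_def using that by (intro cSUP_upper bdd) auto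
  have "e \<longlonglongrightarrow> 0"
  proof (rule LIMSEQ_I)
    fix r :: real
    assume r: "0 < r"
    then obtain N where N: "\<And>k. N \<le> k \<Longrightarrow> \<bar>x k\<bar> < r / 2"
      using LIMSEQ_D[OF assms, of "r / 2"] by auto
    have "norm (e K - 0) < r" if "N \<le> K" for K
    proof -
      have "e K \<le> r / 2"
        unfolding e_def using N that by (intro cSUP_least) (auto intro: less_imp_le)
      moreover have "0 \<le> e K"
        using le[of K K] by linarith
      ultimately show ?thesis using r by simp
    qed
    then show "\<exists>no. \<forall>n\<ge>no. norm (e n - 0) < r" by blast
  qed
  then show ?thesis using le that by blast
qed

text \<open>A deterministic sequence of trees whose sizes tend to infinity, whose change points are of smaller
  order, and whose martingale parts are of smaller order as well. The \<open>j\<close>-th tree controls only the degrees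
  below \<open>j\<close>, to precision \<open>1 / (j + 1)\<close>; this is enough since every degree is eventually covered.\<close>
locale tree_sequence =
  fixes f :: "nat \<Rightarrow> real" and lam c C :: real and n tau :: "nat \<Rightarrow> nat" and t :: "nat \<Rightarrow> rtree"
  assumes pos: "0 < f k"
    and C: "0 \<le> C" "f k \<le> C * (real k + 1)"
    and slope: "(\<lambda>k. f k / real k) \<longlonglongrightarrow> c" and c: "0 \<le> c" "c < lam"
    and surv_sums: "(\<lambda>k. surv f lam (Suc k)) sums 1"
    and n_lim: "filterlim n at_top sequentially"
    and tau_lim: "(\<lambda>j. real (tau j) / real (n j)) \<longlonglongrightarrow> 0"
    and tree: "rec_tree (n j) (t j)"
    and noise_small: "k < j \<Longrightarrow> tau j \<le> m \<Longrightarrow> m \<le> n j \<Longrightarrow>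
      \<bar>noise f (t j) k (tau j) m\<bar> \<le> real (n j) / real (j + 1)"
begin

definition idx :: "nat \<Rightarrow> real \<Rightarrow> nat" where
  "idx j r = nat \<lfloor>r * real (n j)\<rfloor>"

definition tails :: "nat \<Rightarrow> real \<Rightarrow> nat \<Rightarrow> real" where
  "tails k r j = real (tail_count (t j) k (idx j r)) / real (n j)"

definition weights :: "real \<Rightarrow> nat \<Rightarrow> real" where
  "weights r j = weight f (t j) (idx j r) / real (n j)"

lemma eventually_n_ge: "eventually (\<lambda>j. x \<le> real (n j)) sequentially"
  using filterlim_compose[OF filterlim_real_sequentially n_lim] by (simp add: filterlim_at_top)

lemma idx_bounds: "0 \<le> r \<Longrightarrow> r * real (n j) - 1 \<le> real (idx j r) \<and> real (idx j r) \<le> r * real (n j)"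
  unfolding idx_def by simp

lemma idx_lim:
  assumes "0 < r"
  shows "(\<lambda>j. real (idx j r) / real (n j)) \<longlonglongrightarrow> r"
proof -
  have "filterlim (\<lambda>j. real (n j)) at_top sequentially"
    by (rule filterlim_compose[OF filterlim_real_sequentially n_lim])
  then have "(\<lambda>j. r - 1 / real (n j)) \<longlonglongrightarrow> r - 0"
    by (intro tendsto_diff tendsto_const tendsto_divide_0[OF tendsto_const] filterlim_at_top_imp_at_infinity)
  moreover have "eventually (\<lambda>j. r - 1 / real (n j) \<le> real (idx j r) / real (n j)
      \<and> real (idx j r) / real (n j) \<le> r) sequentially"
    using eventually_n_ge[of 1]
  proof (rule eventually_mono)
    fix j
    assume "1 \<le> real (n j)"
    moreover from this have "(r * real (n j) - 1) / real (n j) \<le> real (idx j r) / real (n j)"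
      using idx_bounds[of r j] assms by (intro divide_right_mono) auto
    ultimately show "r - 1 / real (n j) \<le> real (idx j r) / real (n j) \<and> real (idx j r) / real (n j) \<le> r"
      using idx_bounds[of r j] assms by (simp add: diff_divide_distrib divide_le_eq)
  qed
  ultimately show ?thesis
    unfolding eventually_conj_iff diff_zero
    by (elim conjE) (rule tendsto_sandwich[OF _ _ _ tendsto_const])
qed

lemma eventually_idx:
  assumes "0 < r" "r < 1"
  shows "eventually (\<lambda>j. 1 \<le> idx j r \<and> tau j \<le> idx j r \<and> idx j r \<le> n j) sequentially"
proof -
  have "(\<lambda>j. real (idx j r) / real (n j) - real (tau j) / real (n j)) \<longlonglongrightarrow> r - 0"
    by (intro tendsto_diff idx_lim tau_lim assms)
  then have "eventually (\<lambda>j. 0 < real (idx j r) / real (n j) - real (tau j) / real (n j)) sequentially"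
    by (rule order_tendstoD(1)) (use assms in simp)
  then show ?thesis
    using eventually_n_ge[of 1]
  proof eventually_elim
    case (elim j)
    have "real (tau j) < real (idx j r)"
      using elim by (simp add: field_simps)
    moreover have "real (idx j r) \<le> 1 * real (n j)"
      using idx_bounds[of r j] assms mult_right_mono[of r 1 "real (n j)"] by simp
    ultimately show ?case by simp
  qed
qed

text \<open>A vanishing bound for the relative deviation of \<open>f\<close> from linearity beyond degree \<open>K\<close>.\<close>
definition err :: "nat \<Rightarrow> real" where
  "err = (SOME e. e \<longlonglongrightarrow> 0 \<and> (\<forall>K k. K \<le> k \<longrightarrow> \<bar>f k - c * real k\<bar> \<le> e K * (real k + 1)))"

lemma err: "err \<longlonglongrightarrow> 0" "K \<le> k \<Longrightarrow> \<bar>f k - c * real k\<bar> \<le> err K * (real k + 1)"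
proof -
  have "(\<lambda>k. (f k / real k - c) * (real k / (real k + 1))) \<longlonglongrightarrow> (c - c) * 1"
    by (intro tendsto_mult tendsto_diff slope tendsto_const) real_asymp
  then have "(\<lambda>k. (f k / real k - c) * (real k / (real k + 1))) \<longlonglongrightarrow> 0"
    by simp
  then have "(\<lambda>k. (f k - c * real k) / (real k + 1)) \<longlonglongrightarrow> 0"
  proof (rule Lim_transform_eventually, intro eventually_sequentiallyI[of 1])
    fix k :: nat
    assume k: "1 \<le> k"
    then have "f k / real k - c = (f k - c * real k) / real k"
      by (simp add: diff_divide_distrib)
    then show "(f k / real k - c) * (real k / (real k + 1)) = (f k - c * real k) / (real k + 1)"
      using k by simp
  qed
  then obtain e where e: "e \<longlonglongrightarrow> 0" "\<And>K k. K \<le> k \<Longrightarrow> \<bar>(f k - c * real k) / (real k + 1)\<bar> \<le> e K"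
    by (rule tail_sup_vanishing) blast
  then have "\<exists>e. e \<longlonglongrightarrow> 0 \<and> (\<forall>K k. K \<le> k \<longrightarrow> \<bar>f k - c * real k\<bar> \<le> e K * (real k + 1))"
    by (intro exI[of _ e]) (auto simp: field_simps abs_divide)
  from someI_ex[OF this] show "err \<longlonglongrightarrow> 0" "K \<le> k \<Longrightarrow> \<bar>f k - c * real k\<bar> \<le> err K * (real k + 1)"
    unfolding err_def[symmetric] by auto
qed

lemma err_nonneg: "0 \<le> err K"
  using order_trans[OF abs_ge_zero err(2)[of K K]] by (simp add: zero_le_mult_iff)

text \<open>The total weight as computed from the first \<open>K\<close> degree classes. Unlike the weight itself, whose increments
  \<open>f (k + 1) - f k + f 0\<close> may be large, it is Lipschitz in \<open>m\<close>.\<close>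
definition approx :: "nat \<Rightarrow> nat \<Rightarrow> nat \<Rightarrow> real" where
  "approx K j m = c * (real m - 1) +
     (\<Sum>k<K. (f k - c * real k) * (real (tail_count (t j) k m) - real (tail_count (t j) (Suc k) m)))"

lemma weight_near_approx:
  "1 \<le> m \<Longrightarrow> m \<le> n j \<Longrightarrow> \<bar>weight f (t j) m - approx K j m\<bar> \<le> 2 * err K * real m"
  unfolding approx_def by (rule weight_approx[OF tree _ _ err_nonneg err(2)])

lemma class_lipschitz:
  assumes "1 \<le> m" "m \<le> n j" "1 \<le> m'" "m' \<le> n j"
  shows "\<bar>(real (tail_count (t j) k m) - real (tail_count (t j) (Suc k) m))
    - (real (tail_count (t j) k m') - real (tail_count (t j) (Suc k) m'))\<bar> \<le> 2 * \<bar>real m - real m'\<bar>"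
proof -
  have "\<bar>real (tail_count (t j) i m) - real (tail_count (t j) i m')\<bar> \<le> \<bar>real m - real m'\<bar>" for i
    using tail_count_lipschitz[OF tree, of m m' j i] tail_count_lipschitz[OF tree, of m' m j i] assms
    by (cases "m \<le> m'") auto
  from this[of k] this[of "Suc k"] show ?thesis by (smt (verit))
qed

definition lip :: "nat \<Rightarrow> real" where
  "lip K = c + 2 * (\<Sum>k<K. \<bar>f k - c * real k\<bar>)"

lemma lip_nonneg: "0 \<le> lip K"
  unfolding lip_def using c by (intro add_nonneg_nonneg mult_nonneg_nonneg sum_nonneg) auto

lemma weight_increment:
  assumes m: "1 \<le> m" "m \<le> n j" "1 \<le> m'" "m' \<le> n j"
  shows "\<bar>weight f (t j) m - weight f (t j) m'\<bar> \<le> lip K * \<bar>real m - real m'\<bar> + 4 * err K * real (n j)"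
proof -
  define N where "N k m = real (tail_count (t j) k m) - real (tail_count (t j) (Suc k) m)" for k m
  have "approx K j m - approx K j m' = c * (real m - real m') + (\<Sum>k<K. (f k - c * real k) * (N k m - N k m'))"
    by (simp add: approx_def N_def[symmetric] right_diff_distrib sum_subtractf)
  also have "\<bar>\<dots>\<bar> \<le> \<bar>c * (real m - real m')\<bar> + (\<Sum>k<K. \<bar>(f k - c * real k) * (N k m - N k m')\<bar>)"
    by (rule order_trans[OF abs_triangle_ineq add_left_mono[OF sum_abs]])
  also have "\<dots> \<le> c * \<bar>real m - real m'\<bar> + (\<Sum>k<K. \<bar>f k - c * real k\<bar> * (2 * \<bar>real m - real m'\<bar>))"
    using c class_lipschitz[OF m] unfolding abs_mult N_def
    by (intro add_mono sum_mono mult_left_mono) auto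
  also have "\<dots> = lip K * \<bar>real m - real m'\<bar>"
    by (simp add: lip_def algebra_simps sum_distrib_left)
  finally have 1: "\<bar>approx K j m - approx K j m'\<bar> \<le> lip K * \<bar>real m - real m'\<bar>" .
  have 2: "\<bar>weight f (t j) i - approx K j i\<bar> \<le> 2 * err K * real (n j)" if "1 \<le> i" "i \<le> n j" for i
    using weight_near_approx[OF that, of K] that err_nonneg[of K]
    by (meson mult_left_mono of_nat_mono order_trans mult_nonneg_nonneg zero_le_numeral)
  show ?thesis
    using 1 2[OF m(1,2)] 2[OF m(3,4)] by linarith
qed

lemma has_common_limits:
  obtains G T sigma where "G \<noteq> bot" "G \<le> sequentially"
    "\<And>k r. 0 < r \<Longrightarrow> r < 1 \<Longrightarrow> (tails k r \<longlongrightarrow> T k r) G"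
    "\<And>r. 0 < r \<Longrightarrow> r < 1 \<Longrightarrow> (weights r \<longlongrightarrow> sigma r) G"
proof -
  define X where "X = (\<lambda>(i, r) j. if 0 < r \<and> r < 1 then
    (case i of None \<Rightarrow> weights r j | Some k \<Rightarrow> tails k r j) else 0)"
  have bound: "\<exists>B. eventually (\<lambda>j. \<bar>X p j\<bar> \<le> B) sequentially" for p
  proof -
    obtain i r where p: "p = (i, r)" by (cases p)
    show ?thesis
    proof (cases "0 < r \<and> r < 1")
      case True
      then have r: "0 < r" "r < 1" by auto
      show ?thesis
      proof (cases i)
        case None
        have "eventually (\<lambda>j. \<bar>weights r j\<bar> \<le> 2 * C) sequentially"
          using eventually_idx[OF r] eventually_n_ge[of 1]
        proof eventually_elim
          case (elim j)
          have "0 \<le> weight f (t j) (idx j r)"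
            unfolding weight_def by (intro sum_nonneg less_imp_le pos)
          moreover have "weight f (t j) (idx j r) \<le> 2 * C * real (idx j r)"
            using elim C by (intro weight_upper[OF tree]) auto
          moreover have "2 * C * real (idx j r) \<le> 2 * C * real (n j)"
            using elim C by (intro mult_left_mono) auto
          ultimately show ?case
            using elim by (simp add: weights_def divide_le_eq)
        qed
        then show ?thesis using True by (auto simp: X_def p None)
      next
        case (Some k)
        have "eventually (\<lambda>j. \<bar>tails k r j\<bar> \<le> 1) sequentially"
          using eventually_idx[OF r] eventually_n_ge[of 1]
        proof eventually_elim
          case (elim j)
          have "tail_count (t j) k (idx j r) \<le> card {1..idx j r}"
            unfolding tail_count_def by (rule card_mono) auto
          then show ?case
            using elim by (simp add: tails_def divide_le_eq)
        qed
        then show ?thesis using True by (auto simp: X_def p Some)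
      qed
    qed (auto simp: X_def p)
  qed
  obtain G where G: "G \<noteq> bot" "G \<le> sequentially" "\<And>p. \<exists>l. (X p \<longlongrightarrow> l) G"
    using common_limit_filter[of X] bound by blast
  then obtain L where L: "\<And>p. (X p \<longlongrightarrow> L p) G" by metis
  show ?thesis
  proof (rule that[OF G(1,2)])
    show "(tails k r \<longlongrightarrow> L (Some k, r)) G" if "0 < r" "r < 1" for k r
      using L[of "(Some k, r)"] that by (simp add: X_def)
    show "(weights r \<longlongrightarrow> L (None, r)) G" if "0 < r" "r < 1" for r
      using L[of "(None, r)"] that by (simp add: X_def)
  qed
qed

end

locale tree_sequence_limit = tree_sequence +
  fixes G :: "nat filter" and T :: "nat \<Rightarrow> real \<Rightarrow> real" and sigma :: "real \<Rightarrow> real"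
  assumes G: "G \<noteq> bot" "G \<le> sequentially"
    and T: "\<And>k r. 0 < r \<Longrightarrow> r < 1 \<Longrightarrow> (tails k r \<longlongrightarrow> T k r) G"
    and sigma: "\<And>r. 0 < r \<Longrightarrow> r < 1 \<Longrightarrow> (weights r \<longlongrightarrow> sigma r) G"
begin

lemma ev: "eventually P sequentially \<Longrightarrow> eventually P G"
  using G(2) by (rule filter_leD)

lemma lim: "(x \<longlonglongrightarrow> l) \<Longrightarrow> (x \<longlongrightarrow> l) G"
  using G(2) by (rule tendsto_mono)

lemma limit_T_0:
  assumes "0 < r" "r < 1"
  shows "T 0 r = r"
proof (rule tendsto_unique[OF G(1) T[OF assms]])
  show "(tails 0 r \<longlongrightarrow> r) G"
    using lim[OF idx_lim[OF assms(1)]] by (simp add: tails_def[abs_def])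
qed

lemma limit_T_nonneg: "0 < r \<Longrightarrow> r < 1 \<Longrightarrow> 0 \<le> T k r"
  by (rule tendsto_lowerbound[OF T _ G(1)]) (auto simp: tails_def)

lemma limit_T_Suc_le: "0 < r \<Longrightarrow> r < 1 \<Longrightarrow> T (Suc k) r \<le> T k r"
  by (rule tendsto_le[OF G(1) T T]) (auto simp: tails_def tail_count_Suc_le intro!: always_eventually divide_right_mono)

lemma limit_T_sum_le:
  assumes "0 < r" "r < 1"
  shows "(\<Sum>k<K. T (Suc k) r) \<le> r"
proof (rule tendsto_le[OF G(1) lim[OF idx_lim[OF assms(1)]]])
  show "((\<lambda>j. \<Sum>k<K. tails (Suc k) r j) \<longlongrightarrow> (\<Sum>k<K. T (Suc k) r)) G"
    by (intro tendsto_sum T assms)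
  show "eventually (\<lambda>j. (\<Sum>k<K. tails (Suc k) r j) \<le> real (idx j r) / real (n j)) G"
    using ev[OF eventually_idx[OF assms]]
  proof (rule eventually_mono)
    fix j
    assume "1 \<le> idx j r \<and> tau j \<le> idx j r \<and> idx j r \<le> n j"
    then have "real (\<Sum>k<K. tail_count (t j) (Suc k) (idx j r)) \<le> real (idx j r)"
      by (intro of_nat_mono sum_tail_count_le[OF tree]) auto
    then show "(\<Sum>k<K. tails (Suc k) r j) \<le> real (idx j r) / real (n j)"
      unfolding tails_def sum_divide_distrib[symmetric] by (intro divide_right_mono) auto
  qed
qed

lemma limit_sigma_lower:
  assumes "0 < r" "r < 1"
  shows "min (f 0) (f 1) / 2 * r \<le> sigma r"
proof (rule tendsto_le[OF G(1) sigma[OF assms]])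
  show "((\<lambda>j. min (f 0) (f 1) / 2 * (real (idx j r) / real (n j))) \<longlongrightarrow> min (f 0) (f 1) / 2 * r) G"
    by (intro tendsto_mult tendsto_const lim idx_lim assms)
  show "eventually (\<lambda>j. min (f 0) (f 1) / 2 * (real (idx j r) / real (n j)) \<le> weights r j) G"
    using ev[OF eventually_idx[OF assms]]
  proof (rule eventually_mono)
    fix j
    assume "1 \<le> idx j r \<and> tau j \<le> idx j r \<and> idx j r \<le> n j"
    then have "min (f 0) (f 1) / 2 * real (idx j r) \<le> weight f (t j) (idx j r)"
      by (intro weight_lower[OF tree _ _ pos]) auto
    then show "min (f 0) (f 1) / 2 * (real (idx j r) / real (n j)) \<le> weights r j"
      unfolding weights_def times_divide_eq_right by (intro divide_right_mono) auto
  qed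
qed

lemma limit_sigma_upper:
  assumes "0 < r" "r < 1"
  shows "sigma r \<le> 2 * C * r"
proof (rule tendsto_le[OF G(1) _ sigma[OF assms]])
  show "((\<lambda>j. 2 * C * (real (idx j r) / real (n j))) \<longlongrightarrow> 2 * C * r) G"
    by (intro tendsto_mult tendsto_const lim idx_lim assms)
  show "eventually (\<lambda>j. weights r j \<le> 2 * C * (real (idx j r) / real (n j))) G"
    using ev[OF eventually_idx[OF assms]]
  proof (rule eventually_mono)
    fix j
    assume "1 \<le> idx j r \<and> tau j \<le> idx j r \<and> idx j r \<le> n j"
    then have "weight f (t j) (idx j r) \<le> 2 * C * real (idx j r)"
      by (intro weight_upper[OF tree _ _ C]) auto
    then show "weights r j \<le> 2 * C * (real (idx j r) / real (n j))"
      unfolding weights_def times_divide_eq_right by (intro divide_right_mono) auto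
  qed
qed

lemma limit_sigma_approx:
  assumes r: "0 < r" "r < 1"
  shows "\<bar>sigma r - (c * r + (\<Sum>k<K. (f k - c * real k) * (T k r - T (Suc k) r)))\<bar> \<le> 2 * err K * r"
proof (rule tendsto_le[OF G(1)])
  have inv: "(\<lambda>j. 1 / real (n j)) \<longlonglongrightarrow> 0"
    by (intro tendsto_divide_0[OF tendsto_const] filterlim_at_top_imp_at_infinity
        filterlim_compose[OF filterlim_real_sequentially n_lim])
  have "((\<lambda>j. \<bar>weights r j - (c * (real (idx j r) / real (n j) - 1 / real (n j))
        + (\<Sum>k<K. (f k - c * real k) * (tails k r j - tails (Suc k) r j)))\<bar>) \<longlongrightarrow>
      \<bar>sigma r - (c * (r - 0) + (\<Sum>k<K. (f k - c * real k) * (T k r - T (Suc k) r)))\<bar>) G"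
    by (intro tendsto_rabs tendsto_diff tendsto_add tendsto_mult tendsto_const tendsto_sum
        lim[OF idx_lim] lim[OF inv] sigma T r)
  then show "((\<lambda>j. \<bar>weights r j - (c * (real (idx j r) / real (n j) - 1 / real (n j))
        + (\<Sum>k<K. (f k - c * real k) * (tails k r j - tails (Suc k) r j)))\<bar>) \<longlongrightarrow>
      \<bar>sigma r - (c * r + (\<Sum>k<K. (f k - c * real k) * (T k r - T (Suc k) r)))\<bar>) G"
    by simp
  show "((\<lambda>j. 2 * err K * (real (idx j r) / real (n j))) \<longlongrightarrow> 2 * err K * r) G"
    by (intro tendsto_mult tendsto_const lim idx_lim r)
  show "eventually (\<lambda>j. \<bar>weights r j - (c * (real (idx j r) / real (n j) - 1 / real (n j))
        + (\<Sum>k<K. (f k - c * real k) * (tails k r j - tails (Suc k) r j)))\<bar>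
      \<le> 2 * err K * (real (idx j r) / real (n j))) G"
    using ev[OF eventually_idx[OF r]]
  proof (rule eventually_mono)
    fix j
    assume "1 \<le> idx j r \<and> tau j \<le> idx j r \<and> idx j r \<le> n j"
    then have "\<bar>weight f (t j) (idx j r) - approx K j (idx j r)\<bar> / real (n j) \<le> 2 * err K * real (idx j r) / real (n j)"
      by (intro divide_right_mono weight_near_approx) auto
    moreover have "weights r j - (c * (real (idx j r) / real (n j) - 1 / real (n j))
        + (\<Sum>k<K. (f k - c * real k) * (tails k r j - tails (Suc k) r j)))
      = (weight f (t j) (idx j r) - approx K j (idx j r)) / real (n j)"
      by (simp add: weights_def approx_def tails_def diff_divide_distrib add_divide_distrib
          sum_divide_distrib right_diff_distrib)
    ultimately show "\<bar>weights r j - (c * (real (idx j r) / real (n j) - 1 / real (n j))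
        + (\<Sum>k<K. (f k - c * real k) * (tails k r j - tails (Suc k) r j)))\<bar>
      \<le> 2 * err K * (real (idx j r) / real (n j))"
      by (simp add: abs_divide)
  qed
qed

lemma limit_sigma_pos: "0 < r \<Longrightarrow> r < 1 \<Longrightarrow> 0 < sigma r"
  using limit_sigma_lower[of r] pos[of 0] pos[of 1]
  by (smt (verit, best) mult_pos_pos min_less_iff_conj half_gt_zero)

text \<open>On a short time interval around \<open>r0\<close> the degree classes and the weight are almost constant: the former are
  Lipschitz, the latter is close to a Lipschitz function. So the conditional probabilities of an increment are all
  close to \<open>D\<close>, and the number of increments is close to \<open>D\<close> times the length, up to the small martingale
  part.\<close>
lemma limit_T_local:
  assumes r0: "0 < r0" "r0 < 1" and eps: "0 < eps"
  shows "\<exists>d>0. \<forall>x y. r0 - d < x \<longrightarrow> x \<le> y \<longrightarrow> y < r0 + d \<longrightarrow>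
    \<bar>T (Suc k) y - T (Suc k) x - (y - x) * (f k * (T k r0 - T (Suc k) r0) / sigma r0)\<bar> \<le> eps * (y - x)"
proof -
  define u0 where "u0 = T k r0 - T (Suc k) r0"
  define D where "D = f k * u0 / sigma r0"
  define N where "N j m = real (tail_count (t j) k m) - real (tail_count (t j) (Suc k) m)" for j m
  have "isCont (\<lambda>p. f k * fst p / snd p) (u0, sigma r0)"
    using limit_sigma_pos[OF r0] by (intro continuous_intros) auto
  then obtain e where e: "0 < e" "\<And>p. dist p (u0, sigma r0) < e \<Longrightarrow> dist (f k * fst p / snd p) D < eps"
    unfolding continuous_at_eps_delta using eps by (force simp: D_def)
  have near: "\<bar>f k * u / v - D\<bar> \<le> eps" if "\<bar>u - u0\<bar> < e / 2" "\<bar>v - sigma r0\<bar> < e / 2" for u v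
  proof -
    have "dist (u, v) (u0, sigma r0) \<le> \<bar>u - u0\<bar> + \<bar>v - sigma r0\<bar>"
      unfolding dist_Pair_Pair dist_real_def by (rule sqrt_sum_squares_le_sum_abs[THEN order_trans]) simp
    then show ?thesis
      using e(2)[of "(u, v)"] that by (simp add: dist_real_def less_imp_le)
  qed
  obtain K where K: "4 * err K < e / 8"
    using order_tendstoD(2)[OF tendsto_mult[OF tendsto_const[of 4] err(1)], of "e / 8"] e(1)
    by (auto simp: eventually_sequentially)
  \<comment> \<open>times stay in \<open>(0,1)\<close>, degree classes move by at most \<open>e / 8\<close>, and so does the Lipschitz part of the weight\<close>
  define d where "d = Min {r0, 1 - r0, e / 32, e / (32 * (lip K + 1))}"
  have l1: "0 < lip K + 1" using lip_nonneg[of K] by simp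
  have "0 < d"
    unfolding d_def using r0 e(1) l1 by (subst Min_gr_iff) auto
  moreover have "d \<le> x" if "x \<in> {r0, 1 - r0, e / 32, e / (32 * (lip K + 1))}" for x
    unfolding d_def by (rule Min_le) (use that in auto)
  ultimately have d: "0 < d" "d \<le> r0" "d \<le> 1 - r0" "d \<le> e / 32" "d \<le> e / (32 * (lip K + 1))"
    by blast+
  have dl: "lip K * (2 * d) < e / 8"
  proof -
    have "(lip K + 1) * d \<le> e / 32"
      using d(5) l1 by (simp add: field_simps)
    then show ?thesis
      using d(1) e(1) by (simp add: algebra_simps)
  qed
  have main: "\<bar>T (Suc k) y - T (Suc k) x - (y - x) * D\<bar> \<le> eps * (y - x)"
    if xy: "r0 - d < x" "x \<le> y" "y < r0 + d" for x y
  proof (rule tendsto_le[OF G(1)])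
    have x: "0 < x" "x < 1" and y: "0 < y" "y < 1"
      using xy d by auto
    define q where "q j = real (idx j y) / real (n j) - real (idx j x) / real (n j)" for j
    have q: "(q \<longlongrightarrow> y - x) G"
      unfolding q_def by (intro tendsto_diff lim idx_lim x y)
    show "((\<lambda>j. \<bar>tails (Suc k) y j - tails (Suc k) x j - q j * D\<bar>) \<longlongrightarrow> \<bar>T (Suc k) y - T (Suc k) x - (y - x) * D\<bar>) G"
      by (intro tendsto_intros T q x y)
    have "(\<lambda>j. 2 / real (j + 1)) \<longlonglongrightarrow> 0"
      by real_asymp
    then have "((\<lambda>j. eps * q j + 2 / real (j + 1)) \<longlongrightarrow> eps * (y - x) + 0) G"
      by (intro tendsto_add tendsto_mult tendsto_const q lim)
    then show "((\<lambda>j. eps * q j + 2 / real (j + 1)) \<longlongrightarrow> eps * (y - x)) G"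
      by simp
    have E1: "eventually (\<lambda>j. \<bar>(tails k r0 j - tails (Suc k) r0 j) - u0\<bar> < e / 4) G"
      using tendstoD[OF tendsto_diff[OF T[OF r0, of k] T[OF r0, of "Suc k"]], of "e / 4"] e(1)
      by (simp add: u0_def dist_real_def)
    have E2: "eventually (\<lambda>j. \<bar>weights r0 j - sigma r0\<bar> < e / 4) G"
      using tendstoD[OF sigma[OF r0], of "e / 4"] e(1) by (simp add: dist_real_def)
    show "eventually (\<lambda>j. \<bar>tails (Suc k) y j - tails (Suc k) x j - q j * D\<bar> \<le> eps * q j + 2 / real (j + 1)) G"
      using E1 E2 ev[OF eventually_idx[OF r0]] ev[OF eventually_idx[OF x]] ev[OF eventually_idx[OF y]]
        ev[OF eventually_n_ge[of 1]] ev[OF eventually_n_ge[of "1 / d"]] ev[OF eventually_gt_at_top[of k]]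
    proof eventually_elim
      case (elim j)
      have n1: "1 \<le> real (n j)" by (rule elim)
      have nz: "n j \<noteq> 0" using n1 by (cases "n j") auto
      have dn: "1 \<le> d * real (n j)"
        using elim(7) d(1) by (simp add: field_simps)
      have ixy: "idx j x \<le> idx j y"
        unfolding idx_def using xy(2) by (intro nat_mono floor_mono mult_right_mono) auto
      have rate: "\<bar>f k * N j l / weight f (t j) l - D\<bar> \<le> eps" if l: "l \<in> {idx j x..<idx j y}" for l
      proof -
        have l1: "1 \<le> l" "l \<le> n j" using l elim by auto
        have lower: "x * real (n j) - 1 \<le> real l"
          using idx_bounds[of x j] x l by auto
        have upper: "real l \<le> y * real (n j)"
          using idx_bounds[of y j] y l by auto
        have "(r0 - d) * real (n j) \<le> x * real (n j)" "y * real (n j) \<le> (r0 + d) * real (n j)"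
          using xy by (auto intro!: mult_right_mono)
        then have close: "\<bar>real l - real (idx j r0)\<bar> \<le> 2 * d * real (n j)"
          using lower upper idx_bounds[of r0 j] r0 dn by (simp add: algebra_simps abs_le_iff)
        have "\<bar>N j l - N j (idx j r0)\<bar> \<le> 2 * \<bar>real l - real (idx j r0)\<bar>"
          unfolding N_def using l1 elim by (intro class_lipschitz) auto
        also have "\<dots> \<le> 2 * (2 * d * real (n j))"
          using close by simp
        finally have "\<bar>N j l - N j (idx j r0)\<bar> / real (n j) \<le> 4 * d"
          using n1 by (simp add: divide_le_eq)
        then have "\<bar>N j l / real (n j) - N j (idx j r0) / real (n j)\<bar> \<le> 4 * d"
          by (simp add: diff_divide_distrib[symmetric] abs_divide)
        moreover have "N j (idx j r0) / real (n j) = tails k r0 j - tails (Suc k) r0 j"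
          by (simp add: N_def tails_def diff_divide_distrib)
        ultimately have u: "\<bar>N j l / real (n j) - u0\<bar> < e / 2"
          using elim(1) d(4) e(1) by linarith
        have "\<bar>weight f (t j) l - weight f (t j) (idx j r0)\<bar> \<le> lip K * \<bar>real l - real (idx j r0)\<bar> + 4 * err K * real (n j)"
          using l1 elim by (intro weight_increment) auto
        also have "\<dots> \<le> lip K * (2 * d * real (n j)) + 4 * err K * real (n j)"
          using close lip_nonneg[of K] by (intro add_right_mono mult_left_mono) auto
        also have "\<dots> = (lip K * (2 * d) + 4 * err K) * real (n j)"
          by (simp add: algebra_simps)
        finally have "\<bar>weight f (t j) l - weight f (t j) (idx j r0)\<bar> / real (n j) \<le> lip K * (2 * d) + 4 * err K"
          using n1 by (simp add: divide_le_eq)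
        then have "\<bar>weight f (t j) l / real (n j) - weights r0 j\<bar> \<le> lip K * (2 * d) + 4 * err K"
          by (simp add: weights_def diff_divide_distrib[symmetric] abs_divide)
        then have v: "\<bar>weight f (t j) l / real (n j) - sigma r0\<bar> < e / 2"
          using elim(2) dl K by linarith
        have "f k * (N j l / real (n j)) / (weight f (t j) l / real (n j)) = f k * N j l / weight f (t j) l"
          using nz by simp
        with near[OF u v] show ?thesis by (simp only:)
      qed
      define S where "S = (\<Sum>l\<in>{idx j x..<idx j y}. f k * N j l / weight f (t j) l)"
      have "S - real (idx j y - idx j x) * D = (\<Sum>l\<in>{idx j x..<idx j y}. f k * N j l / weight f (t j) l - D)"
        by (simp add: S_def sum_subtractf)
      also have "\<bar>\<dots>\<bar> \<le> (\<Sum>l\<in>{idx j x..<idx j y}. \<bar>f k * N j l / weight f (t j) l - D\<bar>)"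
        by (rule sum_abs)
      also have "\<dots> \<le> (\<Sum>l\<in>{idx j x..<idx j y}. eps)"
        by (intro sum_mono rate)
      finally have S: "\<bar>S - real (idx j y - idx j x) * D\<bar> \<le> real (idx j y - idx j x) * eps"
        by simp
      have "(\<Sum>l\<in>{tau j..<idx j y}. f k * N j l / weight f (t j) l)
          = (\<Sum>l\<in>{tau j..<idx j x}. f k * N j l / weight f (t j) l) + S"
        unfolding S_def using elim ixy by (intro sum.atLeastLessThan_concat[symmetric]) auto
      then have "real (tail_count (t j) (Suc k) (idx j y)) - real (tail_count (t j) (Suc k) (idx j x)) - S
          = noise f (t j) k (tau j) (idx j y) - noise f (t j) k (tau j) (idx j x)"
        by (simp add: noise_def N_def)
      moreover have "\<bar>noise f (t j) k (tau j) (idx j x)\<bar> \<le> real (n j) / real (j + 1)"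
        using elim by (intro noise_small) auto
      moreover have "\<bar>noise f (t j) k (tau j) (idx j y)\<bar> \<le> real (n j) / real (j + 1)"
        using elim by (intro noise_small) auto
      ultimately have "\<bar>real (tail_count (t j) (Suc k) (idx j y)) - real (tail_count (t j) (Suc k) (idx j x)) - S\<bar>
          \<le> 2 * (real (n j) / real (j + 1))"
        by linarith
      then have "\<bar>real (tail_count (t j) (Suc k) (idx j y)) - real (tail_count (t j) (Suc k) (idx j x))
          - real (idx j y - idx j x) * D\<bar> \<le> real (idx j y - idx j x) * eps + 2 * (real (n j) / real (j + 1))"
        using S by linarith
      then have "\<bar>real (tail_count (t j) (Suc k) (idx j y)) - real (tail_count (t j) (Suc k) (idx j x))
          - real (idx j y - idx j x) * D\<bar> / real (n j)
          \<le> (real (idx j y - idx j x) * eps + 2 * (real (n j) / real (j + 1))) / real (n j)"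
        by (rule divide_right_mono) simp
      moreover have "q j = real (idx j y - idx j x) / real (n j)"
        using ixy by (simp add: q_def of_nat_diff diff_divide_distrib)
      moreover have "(real (idx j y - idx j x) * eps + 2 * (real (n j) / real (j + 1))) / real (n j)
          = eps * (real (idx j y - idx j x) / real (n j)) + 2 / real (j + 1)"
        using n1 by (simp add: field_simps)
      moreover have "\<bar>real (tail_count (t j) (Suc k) (idx j y)) - real (tail_count (t j) (Suc k) (idx j x))
          - real (idx j y - idx j x) * D\<bar> / real (n j)
        = \<bar>tails (Suc k) y j - tails (Suc k) x j - real (idx j y - idx j x) / real (n j) * D\<bar>"
        using n1 by (simp add: tails_def diff_divide_distrib[symmetric] abs_divide)
      ultimately show ?case by simp
    qed
  qed
  show ?thesis
    using d(1) main unfolding D_def u0_def by blast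
qed

lemma limit_T_deriv:
  assumes r0: "0 < r0" "r0 < 1"
  shows "(T (Suc k) has_real_derivative f k * (T k r0 - T (Suc k) r0) / sigma r0) (at r0)"
  unfolding has_field_derivative_iff
proof (rule LIM_I)
  fix eps :: real
  assume eps: "0 < eps"
  define D where "D = f k * (T k r0 - T (Suc k) r0) / sigma r0"
  obtain d where d: "0 < d" "\<And>x y. r0 - d < x \<Longrightarrow> x \<le> y \<Longrightarrow> y < r0 + d \<Longrightarrow>
      \<bar>T (Suc k) y - T (Suc k) x - (y - x) * D\<bar> \<le> eps / 2 * (y - x)"
    using limit_T_local[OF r0, of "eps / 2" k] eps unfolding D_def by auto
  have "norm ((T (Suc k) y - T (Suc k) r0) / (y - r0) - D) < eps" if y: "y \<noteq> r0" "norm (y - r0) < d" for y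
  proof -
    have "\<bar>T (Suc k) y - T (Suc k) r0 - (y - r0) * D\<bar> \<le> eps / 2 * \<bar>y - r0\<bar>"
    proof (cases "r0 \<le> y")
      case True
      then show ?thesis using d(2)[of r0 y] d(1) y by simp
    next
      case False
      then have "\<bar>T (Suc k) r0 - T (Suc k) y - (r0 - y) * D\<bar> \<le> eps / 2 * (r0 - y)"
        using d(2)[of y r0] d(1) y by simp
      moreover have "T (Suc k) r0 - T (Suc k) y - (r0 - y) * D = - (T (Suc k) y - T (Suc k) r0 - (y - r0) * D)"
        by (simp add: algebra_simps)
      ultimately show ?thesis using False by (simp only: abs_minus_cancel) simp
    qed
    then have "\<bar>T (Suc k) y - T (Suc k) r0 - (y - r0) * D\<bar> / \<bar>y - r0\<bar> \<le> eps / 2"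
      using y(1) by (simp add: divide_le_eq)
    moreover have "(T (Suc k) y - T (Suc k) r0) / (y - r0) - D = (T (Suc k) y - T (Suc k) r0 - (y - r0) * D) / (y - r0)"
      using y(1) by (simp add: diff_divide_distrib)
    ultimately have "\<bar>(T (Suc k) y - T (Suc k) r0) / (y - r0) - D\<bar> \<le> eps / 2"
      by (simp only: abs_divide)
    then show ?thesis
      using eps unfolding real_norm_def by linarith
  qed
  then show "\<exists>s>0. \<forall>x. x \<noteq> r0 \<and> norm (x - r0) < s \<longrightarrow>
      norm ((T (Suc k) x - T (Suc k) r0) / (x - r0) - f k * (T k r0 - T (Suc k) r0) / sigma r0) < eps"
    using d(1) unfolding D_def by blast
qed

text \<open>By \<open>limit_sigma_approx\<close> the limiting weight is a uniform limit of continuous functions.\<close>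
lemma limit_sigma_cont:
  assumes "0 < r" "r < 1"
  shows "isCont sigma r"
proof -
  have contT: "continuous_on {0<..<1} (T k)" for k
  proof (cases k)
    case 0
    have "continuous_on {0<..<1} (T 0) \<longleftrightarrow> continuous_on {0<..<1} (\<lambda>r::real. r)"
      by (rule continuous_on_cong) (auto simp: limit_T_0)
    then show ?thesis using 0 by simp
  next
    case (Suc i)
    then show ?thesis
      using limit_T_deriv[of _ i] by (intro continuous_at_imp_continuous_on ballI) (auto intro: DERIV_isCont)
  qed
  have "uniform_limit {0<..<1} (\<lambda>K r. c * r + (\<Sum>k<K. (f k - c * real k) * (T k r - T (Suc k) r))) sigma sequentially"
  proof (rule uniform_limitI)
    fix e :: real
    assume e: "0 < e"
    have "(\<lambda>K. 2 * err K) \<longlonglongrightarrow> 2 * 0"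
      by (intro tendsto_mult tendsto_const err(1))
    then have "eventually (\<lambda>K. 2 * err K < e) sequentially"
      by (rule order_tendstoD(2)) (use e in simp)
    then show "eventually (\<lambda>K. \<forall>r\<in>{0<..<1}. dist (c * r + (\<Sum>k<K. (f k - c * real k) * (T k r - T (Suc k) r))) (sigma r) < e) sequentially"
    proof (rule eventually_mono, intro ballI)
      fix K and r :: real
      assume K: "2 * err K < e" and "r \<in> {0<..<1}"
      then have r: "0 < r" "r < 1" by auto
      have "2 * err K * r \<le> 2 * err K * 1"
        using r err_nonneg[of K] by (intro mult_left_mono) auto
      then show "dist (c * r + (\<Sum>k<K. (f k - c * real k) * (T k r - T (Suc k) r))) (sigma r) < e"
        using limit_sigma_approx[OF r, of K] K by (simp add: dist_real_def abs_minus_commute)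
    qed
  qed
  then have "continuous_on {0<..<1} sigma"
    by (rule uniform_limit_theorem[rotated]) (auto intro!: always_eventually continuous_intros contT)
  then show ?thesis
    using assms by (simp add: continuous_on_eq_continuous_at)
qed

text \<open>The limit satisfies the assumptions of \<open>degree_flow\<close>. For the linear bound on the reproductive value any slope
  \<open>c'\<close> strictly between \<open>c\<close> and \<open>lam\<close> eventually dominates \<open>f k / (k + 1)\<close>.\<close>
lemma limit_T_eq:
  assumes "0 < r" "r < 1"
  shows "T k r = surv f lam k * r"
proof -
  define c' where "c' = (c + lam) / 2"
  have c': "0 \<le> c'" "c < c'" "c' < lam"
    using c by (auto simp: c'_def)
  obtain i where i: "\<And>k. i \<le> k \<Longrightarrow> f k / real k < c'"
    using order_tendstoD(2)[OF slope c'(2)] by (auto simp: eventually_sequentially)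
  \<comment> \<open>\<open>f 0 / 0 = 0\<close> carries no information, so the index \<open>0\<close> is excluded\<close>
  define i0 where "i0 = max i 1"
  have i0: "f k \<le> c' * (real k + 1)" if "i0 \<le> k" for k
  proof -
    have "f k \<le> c' * real k"
      using i[of k] that by (simp add: i0_def field_simps)
    then show ?thesis using c'(1) by (simp add: algebra_simps)
  qed
  define A where "A = c' / (lam - c')"
  have A: "0 \<le> A" using c' by (simp add: A_def)
  have "degree_flow f lam c (min (f 0) (f 1) / 2) (2 * C) (A + (A + 1) * real i0) T sigma (\<lambda>K. 2 * err K)"
  proof
    fix k K :: nat
    assume kK: "k \<le> K"
    have "repro f lam K k \<le> A * (real k + 1) + (A + 1) * real (i0 - k)"
      unfolding A_def by (rule repro_le[OF pos c'(1,3) i0 kK])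
    also have "\<dots> \<le> A * (real k + 1) + (A + 1) * (real i0 * (real k + 1))"
    proof (intro add_left_mono mult_left_mono)
      have "real (i0 - k) \<le> real i0 * 1" by simp
      also have "\<dots> \<le> real i0 * (real k + 1)" by (intro mult_left_mono) auto
      finally show "real (i0 - k) \<le> real i0 * (real k + 1)" .
    qed (use A in auto)
    finally show "repro f lam K k \<le> (A + (A + 1) * real i0) * (real k + 1)"
      by (simp add: algebra_simps)
  next
    show "(\<lambda>K. 2 * err K) \<longlonglongrightarrow> 0"
      using tendsto_mult[OF tendsto_const[of 2] err(1)] by simp
  qed (use pos c surv_sums limit_T_0 limit_T_nonneg limit_T_Suc_le limit_T_sum_le limit_T_deriv
      limit_sigma_lower limit_sigma_upper limit_sigma_cont limit_sigma_approx in auto)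
  then interpret degree_flow f lam c "min (f 0) (f 1) / 2" "2 * C" "A + (A + 1) * real i0" T sigma "\<lambda>K. 2 * err K" .
  show ?thesis by (rule flow_unique[OF assms])
qed

text \<open>The flow is identified for \<open>r < 1\<close>; the value at \<open>r = 1\<close> follows since the last \<open>(1 - r) n\<close> steps change a
  tail count by at most that number.\<close>
lemma limit_at_end: "((\<lambda>j. real (tail_count (t j) k (n j)) / real (n j)) \<longlongrightarrow> surv f lam k) G"
proof (rule tendstoI)
  fix e :: real
  assume e: "0 < e"
  define r where "r = max (1/2) (1 - e / 4)"
  have r: "0 < r" "r < 1" "1 - r \<le> e / 4" using e by (auto simp: r_def max_def)
  have s: "0 < surv f lam k" "surv f lam k \<le> 1"
    using surv_pos[of f lam k] pos c decseqD[OF surv_decseq[of f lam], of 0 k] by auto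
  have E1: "eventually (\<lambda>j. \<bar>tails k r j - surv f lam k * r\<bar> < e / 4) G"
    using tendstoD[OF T[OF r(1,2)], of "e / 4" k] e by (simp add: dist_real_def limit_T_eq[OF r(1,2)])
  have E2: "eventually (\<lambda>j. \<bar>real (idx j r) / real (n j) - r\<bar> < e / 4) G"
    using tendstoD[OF lim[OF idx_lim[OF r(1)]], of "e / 4"] e by (simp add: dist_real_def)
  show "eventually (\<lambda>j. dist (real (tail_count (t j) k (n j)) / real (n j)) (surv f lam k) < e) G"
    using E1 E2 ev[OF eventually_idx[OF r(1,2)]] ev[OF eventually_n_ge[of 1]]
  proof eventually_elim
    case (elim j)
    have "tail_count (t j) k (idx j r) \<le> tail_count (t j) k (n j)"
      "tail_count (t j) k (n j) \<le> tail_count (t j) k (idx j r) + (n j - idx j r)"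
      using tail_count_lipschitz[OF tree, of "idx j r" "n j" j k] elim by auto
    then have "\<bar>real (tail_count (t j) k (n j)) - real (tail_count (t j) k (idx j r))\<bar> \<le> real (n j) - real (idx j r)"
      using elim by linarith
    then have "\<bar>real (tail_count (t j) k (n j)) - real (tail_count (t j) k (idx j r))\<bar> / real (n j)
        \<le> (real (n j) - real (idx j r)) / real (n j)"
      by (rule divide_right_mono) simp
    then have "\<bar>real (tail_count (t j) k (n j)) / real (n j) - tails k r j\<bar> \<le> 1 - real (idx j r) / real (n j)"
      using elim by (simp add: tails_def abs_divide diff_divide_distrib[symmetric])
         (simp add: diff_divide_distrib)
    moreover have "surv f lam k * (1 - r) \<le> 1 * (1 - r)" "0 \<le> surv f lam k * (1 - r)"
      using s r by (auto intro!: mult_right_mono)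
    then have "surv f lam k - surv f lam k * r \<le> 1 - r" "0 \<le> surv f lam k - surv f lam k * r"
      by (simp_all only: right_diff_distrib mult_1_right mult_1_left)
    moreover have "\<bar>X - S\<bar> < e" if "\<bar>X - Y\<bar> \<le> 1 - I" "S - Q \<le> 1 - r" "0 \<le> S - Q"
      "\<bar>Y - Q\<bar> < e / 4" "\<bar>I - r\<bar> < e / 4" for X Y I S Q :: real
      using that r(3) unfolding abs_le_iff abs_less_iff by (intro conjI) (elim conjE, linarith)+
    ultimately have "\<bar>real (tail_count (t j) k (n j)) / real (n j) - surv f lam k\<bar> < e"
      using elim(1,2) by blast
    then show ?case unfolding dist_real_def .
  qed
qed

end

section \<open>Convergence of the degree proportions\<close>

lemma noise_bound_vanishes:
  assumes q: "0 < (q::real)"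
  shows "(\<lambda>n. 2 * a * (real n + 1) * exp (- (q * real n / 4))) \<longlonglongrightarrow> 0"
proof -
  have "(\<lambda>n. (real n + 1) * exp (- (q * real n / 4))) \<longlonglongrightarrow> 0"
    using q by real_asymp
  then have "(\<lambda>n. 2 * a * ((real n + 1) * exp (- (q * real n / 4)))) \<longlonglongrightarrow> 2 * a * 0"
    by (intro tendsto_mult tendsto_const)
  then show ?thesis by (simp add: mult.assoc)
qed

lemma degree_count_tail_count:
  assumes "rec_tree n t"
  shows "real (degree_count n t k) = real (tail_count t k n) - real (tail_count t (Suc k) n)"
  unfolding tail_count_diff degree_count_def by (simp add: deg_eq_indeg[OF assms])

text \<open>An event that is more likely than a large martingale part contains a tree with small martingale parts.\<close>
lemma quiet_tree_in_event:
  assumes f: "attachment_function f0" "attachment_function f1"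
    and tau: "1 \<le> tau" and n: "1 \<le> n" and eta: "0 < eta" "eta \<le> 1"
    and P: "2 * real J * (real n + 1) * exp (- (eta\<^sup>2 * real n / 4))
      < measure_pmf.prob (change_point_tree f0 f1 tau n) A"
  shows "\<exists>t\<in>A. rec_tree n t \<and> (\<forall>k<J. \<forall>m\<in>{tau..n}. \<bar>noise f1 t k tau m\<bar> \<le> eta * real n)"
proof (rule ccontr)
  define M where "M = change_point_tree f0 f1 tau n"
  define E where "E = {t. \<exists>k<J. \<exists>m\<in>{tau..n}. eta * real n < \<bar>noise f1 t k tau m\<bar>}"
  assume "\<not> ?thesis"
  then have "A \<inter> set_pmf M \<subseteq> E"
    using change_point_tree_rec_tree[OF f _ n, of _ tau] by (fastforce simp: M_def E_def not_le)
  then have "measure_pmf.prob M (A \<inter> set_pmf M) \<le> measure_pmf.prob M E"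
    by (intro measure_pmf.finite_measure_mono) auto
  also have "\<dots> \<le> 2 * real J * (real n + 1) * exp (- (eta\<^sup>2 * real n / 4))"
    unfolding M_def E_def by (rule noise_uniform_tail[OF f tau eta])
  finally show False
    using P by (simp add: M_def measure_Int_set_pmf)
qed

text \<open>Any change point of order \<open>o(n)\<close> is forgotten. The argument is by contradiction, so that the compactness
  argument can be applied to a sequence of individual trees instead of to random variables.\<close>
theorem degree_fraction_converges:
  assumes f0: "attachment_function f0" and f1: "admissible f1"
    and slope: "0 \<le> c" "(\<lambda>j. f1 j / real j) \<longlonglongrightarrow> c"
    and tau: "\<And>n. 1 \<le> n \<Longrightarrow> 1 \<le> tau n" "(\<lambda>n. real (tau n) / real n) \<longlonglongrightarrow> 0"
  shows "tendsto_in_prob (\<lambda>n. measure_pmf (change_point_tree f0 f1 (tau n) n))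
    (\<lambda>n t. real (degree_count n t k) / real n) (limit_degree_prob f1 k)"
  unfolding tendsto_in_prob_def
proof (intro allI impI)
  fix e :: real
  assume e: "0 < e"
  define A where "A n = {t. e < \<bar>real (degree_count n t k) / real n - limit_degree_prob f1 k\<bar>}" for n
  define p where "p n = measure_pmf.prob (change_point_tree f0 f1 (tau n) n) (A n)" for n
  have att1: "attachment_function f1"
    using f1 by (simp add: admissible_def)
  have pos: "0 < f1 i" for i
    using f1 by (rule admissible_pos)
  obtain C where C: "0 < C" "\<And>i. f1 i \<le> C * (real i + 1)"
    using admissible_linear_bound[OF f1] by blast
  define lam where "lam = lambda_star f1"
  have lam: "c < lam" "(\<lambda>i. surv f1 lam (Suc i)) sums 1"
    unfolding lam_def by (rule lambda_star_properties[OF f1 slope])+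
  have lam_pos: "0 < lambda_star f1"
    using lam(1) slope(1) by (simp add: lam_def)
  have "p \<longlonglongrightarrow> 0"
  proof (rule ccontr)
    assume "\<not> p \<longlonglongrightarrow> 0"
    then obtain d where d: "0 < d" "\<And>N. \<exists>n\<ge>N. d \<le> p n"
      unfolding LIMSEQ_iff by (auto simp: p_def not_less)
    have "\<exists>n t. j < n \<and> t \<in> A n \<and> rec_tree n t \<and>
        (\<forall>k<j. \<forall>m\<in>{tau n..n}. \<bar>noise f1 t k (tau n) m\<bar> \<le> 1 / real (j + 1) * real n)" for j
    proof -
      have "0 < (1 / real (j + 1))\<^sup>2" by simp
      then have "eventually (\<lambda>n. 2 * real j * (real n + 1) * exp (- ((1 / real (j + 1))\<^sup>2 * real n / 4)) < d) sequentially"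
        by (intro order_tendstoD(2)[OF noise_bound_vanishes d(1)])
      then obtain N where N: "\<And>n. N \<le> n \<Longrightarrow> 2 * real j * (real n + 1) * exp (- ((1 / real (j + 1))\<^sup>2 * real n / 4)) < d"
        by (auto simp: eventually_sequentially)
      obtain n where n: "max N (Suc j) \<le> n" "d \<le> p n"
        using d(2) by blast
      have "\<exists>t\<in>A n. rec_tree n t \<and>
          (\<forall>k<j. \<forall>m\<in>{tau n..n}. \<bar>noise f1 t k (tau n) m\<bar> \<le> 1 / real (j + 1) * real n)"
      proof (rule quiet_tree_in_event[OF f0 att1])
        show "2 * real j * (real n + 1) * exp (- ((1 / real (j + 1))\<^sup>2 * real n / 4))
            < measure_pmf.prob (change_point_tree f0 f1 (tau n) n) (A n)"
          using N[of n] n by (simp add: p_def)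
      qed (use n tau(1) in auto)
      then show ?thesis using n by (intro exI[of _ n]) auto
    qed
    then obtain n t where nt: "\<And>j. j < n j" "\<And>j. t j \<in> A (n j)" "\<And>j. rec_tree (n j) (t j)"
      "\<And>j k m. k < j \<Longrightarrow> m \<in> {tau (n j)..n j} \<Longrightarrow> \<bar>noise f1 (t j) k (tau (n j)) m\<bar> \<le> 1 / real (j + 1) * real (n j)"
      by metis
    have n_lim: "filterlim n at_top sequentially"
      by (rule filterlim_at_top_mono[OF filterlim_ident]) (intro always_eventually allI less_imp_le nt(1))
    interpret tree_sequence f1 lam c C n "\<lambda>j. tau (n j)" t
    proof
      show "(\<lambda>j. real (tau (n j)) / real (n j)) \<longlonglongrightarrow> 0"
        by (rule filterlim_compose[OF tau(2) n_lim])
      show "\<bar>noise f1 (t j) k (tau (n j)) m\<bar> \<le> real (n j) / real (j + 1)"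
        if "k < j" "tau (n j) \<le> m" "m \<le> n j" for k j m
        using nt(4)[of k j m] that by simp
    qed (use pos C slope lam n_lim nt(3) in auto)
    obtain G T sigma where G: "G \<noteq> bot" "G \<le> sequentially"
      "\<And>k r. 0 < r \<Longrightarrow> r < 1 \<Longrightarrow> (tails k r \<longlongrightarrow> T k r) G"
      "\<And>r. 0 < r \<Longrightarrow> r < 1 \<Longrightarrow> (weights r \<longlongrightarrow> sigma r) G"
      using has_common_limits by blast
    interpret tree_sequence_limit f1 lam c C n "\<lambda>j. tau (n j)" t G T sigma
      by unfold_locales (use G in auto)
    have "((\<lambda>j. real (tail_count (t j) k (n j)) / real (n j) - real (tail_count (t j) (Suc k) (n j)) / real (n j))
        \<longlongrightarrow> surv f1 lam k - surv f1 lam (Suc k)) G"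
      by (intro tendsto_diff limit_at_end)
    moreover have "surv f1 lam k - surv f1 lam (Suc k) = limit_degree_prob f1 k"
      using limit_degree_prob_surv[OF pos lam_pos, of k] by (simp add: lam_def)
    ultimately have "((\<lambda>j. real (degree_count (n j) (t j) k) / real (n j)) \<longlongrightarrow> limit_degree_prob f1 k) G"
      by (simp add: degree_count_tail_count[OF nt(3)] diff_divide_distrib)
    then have "eventually (\<lambda>j. \<bar>real (degree_count (n j) (t j) k) / real (n j) - limit_degree_prob f1 k\<bar> < e) G"
      using e by (auto simp: tendsto_iff dist_real_def)
    then have "eventually (\<lambda>j. False) G"
    proof (rule eventually_mono)
      fix j
      assume "\<bar>real (degree_count (n j) (t j) k) / real (n j) - limit_degree_prob f1 k\<bar> < e"
      then show False using nt(2)[of j] by (simp add: A_def)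
    qed
    then show False
      using G(1) by simp
  qed
  then show "(\<lambda>n. measure (measure_pmf (change_point_tree f0 f1 (tau n) n))
      {t \<in> space (measure_pmf (change_point_tree f0 f1 (tau n) n)).
        e < \<bar>real (degree_count n t k) / real n - limit_degree_prob f1 k\<bar>}) \<longlonglongrightarrow> 0"
    by (simp add: p_def[abs_def] A_def)
qed

theorem theorem3p18:
  fixes \<gamma> :: real and f0 f1 :: "nat \<Rightarrow> real" and k :: nat
  assumes "0 < \<gamma>" and "\<gamma> < 1"
    and "admissible f0"
    and "admissible f1"
    and "\<exists>c\<ge>0. (\<lambda>j. f1 j / real j) \<longlonglongrightarrow> c"
    and "x_log_x_condition f1"
  shows "tendsto_in_prob
           (\<lambda>n. measure_pmf (change_point_tree f0 f1 (nat \<lfloor>real n powr \<gamma>\<rfloor>) n))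
           (\<lambda>n t. real (degree_count n t k) / real n)
           (limit_degree_prob f1 k)"
proof -
  obtain c where c: "0 \<le> c" "(\<lambda>j. f1 j / real j) \<longlonglongrightarrow> c"
    using assms(5) by blast
  show ?thesis
  proof (rule degree_fraction_converges[OF _ assms(4) c])
    show "attachment_function f0"
      using assms(3) by (simp add: admissible_def)
    show "1 \<le> nat \<lfloor>real n powr \<gamma>\<rfloor>" if "1 \<le> n" for n
    proof -
      have "1 \<le> real n powr \<gamma>"
        using that assms(1) by (intro ge_one_powr_ge_zero) auto
      then show ?thesis by linarith
    qed
    show "(\<lambda>n. real (nat \<lfloor>real n powr \<gamma>\<rfloor>) / real n) \<longlonglongrightarrow> 0"
    proof (rule tendsto_sandwich[OF _ _ tendsto_const])
      show "(\<lambda>n. real n powr \<gamma> / real n) \<longlonglongrightarrow> 0"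
        using assms(2) by real_asymp
      show "eventually (\<lambda>n. real (nat \<lfloor>real n powr \<gamma>\<rfloor>) / real n \<le> real n powr \<gamma> / real n) sequentially"
        by (intro always_eventually allI divide_right_mono) (auto simp: of_nat_nat)
    qed auto
  qed
qed

end
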